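(* Let $\sigma>0$. For any $\lambda\ge0$ there exists a unique weak solution $k^\sigma_\lambda$ to the problem $$\partial_{xx}^2k-\partial_{yy}^2k=\tfrac\lambda\sigma k\ \text{ in }D_\infty,\qquad \partial_yk(x,0)=0,\quad k(x,x)=-\tfrac{\lambda}{2\sigma}x\quad (x>0),$$ and a unique weak solution $l^\sigma_\lambda$ to the problem $$\partial_{xx}^2l-\partial_{yy}^2l=-\tfrac\lambda\sigma l\ \text{ in }D_\infty,\qquad \partial_yl(x,0)=0,\quad l(x,x)=-\tfrac{\lambda}{2\sigma}x\quad (x>0).$$ Moreover, there exist $\lambda_\sigma>0$ and constants $C,c>0$ independent of $\sigma$ such that, for any $\lambda\ge\lambda_\sigma$, $t\ge0$ and $x\in(0,\bar e(t))$, $$\int_0^x\big(|k^\sigma_\lambda(x,y)|^2+|\nabla k^\sigma_\lambda(x,y)|^2\big)dy\le C e^{c\,\bar e(t)\sqrt{\lambda/\sigma}},$$ $$\int_0^x\big(|l^\sigma_\lambda(x,y)|^2+|\nabla l^\sigma_\lambda(x,y)|^2\big)dy\le C\Big(\frac\lambda\sigma\Big)^4e^{c\,\bar e(t)}.$$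
   Context: $D_\infty:=\{(x,y):0<y\le x<\infty\}$. Fix $\bar e_0>0$, $\bar v>0$ and $\bar e(t):=\bar e_0+\bar vt$ for $t\ge0$. For $\alpha\in\mathbb R$, consider the problem: $\partial_{xx}^2k^\alpha-\partial_{yy}^2k^\alpha=\alpha k^\alpha$ in $D_\infty$, $\partial_yk^\alpha(x,0)=0$ and $k^\alpha(x,x)=-\frac\alpha2x$ for $x>0$. A function $k^\alpha:D_\infty\to\mathbb R$ is a weak solution if: (i) the extension $\bar k^\alpha:(0,\infty)^2\to\mathbb R$, equal to $k^\alpha(x,y)$ on $D_\infty$ and to $-\frac\alpha2x$ elsewhere, satisfies for every $L>0$, when restricted to $[0,L]^2$ and viewed as a function of $x$ with values in functions of $y$: $\bar k^\alpha\in C^0([0,L],H^1(0,L))$, $\partial_x\bar k^\alpha\in C^0([0,L],L^2(0,L))$, $\partial_{xx}\bar k^\alpha\in C^0([0,L],H^1(0,L)')$; (ii) for all $L>0$ and all $v,w\in H^1(0,L)$, $$-\int_0^L\Big(\int_0^x\partial_xk^\alpha(x,y)v(y)dy\Big)w'(x)dx+w(L)\int_0^L\partial_xk^\alpha(L,y)v(y)dy+\int_0^L\int_0^x\partial_yk^\alpha(x,y)v'(y)dy\,w(x)dx=\alpha\int_0^L\Big(\int_0^xk^\alpha(x,y)v(y)dy\Big)w(x)dx-\frac\alpha2\int_0^Lv(x)w(x)dx.$$ A weak solution of the problem for $k^\sigma_\lambda$ is a weak solution of this problem with $\alpha=\lambda/\sigma$; $l$ is a weak solution of the problem for $l^\sigma_\lambda$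 if $-l$ is a weak solution of this problem with $\alpha=-\lambda/\sigma$. *)

theory Defs
  imports "HOL-Analysis.Analysis"
begin

text \<open>Elements of the spaces $L^2(0,L)$ and $H^1(0,L)$ are represented by functions on the
  reals, of which only the almost-everywhere class on $(0,L)$ matters.\<close>

definition in_L2 :: "real \<Rightarrow> (real \<Rightarrow> real) \<Rightarrow> bool" where
  "in_L2 L f \<longleftrightarrow> set_borel_measurable lebesgue {0<..<L} f \<and>
     set_integrable lebesgue {0<..<L} (\<lambda>y. (f y)\<^sup>2)"

definition L2_norm :: "real \<Rightarrow> (real \<Rightarrow> real) \<Rightarrow> real" where
  "L2_norm L f = sqrt (LINT y:{0<..<L}|lebesgue. (f y)\<^sup>2)"

text \<open>The test functions are those of class $C^1_c(0,L)$; this gives the same weak derivative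
  as $C^\infty_c(0,L)$.\<close>

definition test_function :: "real \<Rightarrow> (real \<Rightarrow> real) \<Rightarrow> bool" where
  "test_function L \<phi> \<longleftrightarrow> \<phi> C1_differentiable_on UNIV \<and> closure {y. \<phi> y \<noteq> 0} \<subseteq> {0<..<L}"

definition has_weak_deriv :: "real \<Rightarrow> (real \<Rightarrow> real) \<Rightarrow> (real \<Rightarrow> real) \<Rightarrow> bool" where
  "has_weak_deriv L u u' \<longleftrightarrow> (\<forall>\<phi>. test_function L \<phi> \<longrightarrow>
     (LINT y:{0<..<L}|lebesgue. u y * deriv \<phi> y) = - (LINT y:{0<..<L}|lebesgue. u' y * \<phi> y))"

text \<open>\<open>in_H1 L u u'\<close>: the function \<open>u\<close> belongs to $H^1(0,L)$ and \<open>u'\<close> represents its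
  weak derivative.\<close>

definition in_H1 :: "real \<Rightarrow> (real \<Rightarrow> real) \<Rightarrow> (real \<Rightarrow> real) \<Rightarrow> bool" where
  "in_H1 L u u' \<longleftrightarrow> in_L2 L u \<and> in_L2 L u' \<and> has_weak_deriv L u u'"

definition H1_norm :: "real \<Rightarrow> (real \<Rightarrow> real) \<Rightarrow> (real \<Rightarrow> real) \<Rightarrow> real" where
  "H1_norm L u u' = sqrt ((L2_norm L u)\<^sup>2 + (L2_norm L u')\<^sup>2)"

definition in_H1_dual :: "real \<Rightarrow> ((real \<Rightarrow> real) \<Rightarrow> real) \<Rightarrow> bool" where
  "in_H1_dual L \<Lambda> \<longleftrightarrow>
     (\<forall>u u' v v' a b. in_H1 L u u' \<and> in_H1 L v v' \<longrightarrow>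
        \<Lambda> (\<lambda>y. a * u y + b * v y) = a * \<Lambda> u + b * \<Lambda> v) \<and>
     (\<exists>B. \<forall>v v'. in_H1 L v v' \<longrightarrow> \<bar>\<Lambda> v\<bar> \<le> B * H1_norm L v v')"

definition H1_dual_norm :: "real \<Rightarrow> ((real \<Rightarrow> real) \<Rightarrow> real) \<Rightarrow> real" where
  "H1_dual_norm L \<Lambda> = Sup {\<bar>\<Lambda> v\<bar> | v v'. in_H1 L v v' \<and> H1_norm L v v' \<le> 1}"

text \<open>The embedding of $L^2(0,L)$ into the dual of $H^1(0,L)$.\<close>

definition L2_functional :: "real \<Rightarrow> (real \<Rightarrow> real) \<Rightarrow> (real \<Rightarrow> real) \<Rightarrow> real" where
  "L2_functional L f v = (LINT y:{0<..<L}|lebesgue. f y * v y)"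

text \<open>Continuity on $[0,L]$ and differentiation in \<open>x\<close> of maps $x \mapsto f(x,\cdot)$ with values
  in these spaces. Derivatives are limits of difference quotients in the norm of the target space,
  one-sided at the endpoints.\<close>

definition cont_H1 :: "real \<Rightarrow> (real \<Rightarrow> real \<Rightarrow> real) \<Rightarrow> (real \<Rightarrow> real \<Rightarrow> real) \<Rightarrow> bool" where
  "cont_H1 L f fy \<longleftrightarrow> (\<forall>x\<in>{0..L}. in_H1 L (f x) (fy x) \<and>
     ((\<lambda>s. H1_norm L (\<lambda>y. f s y - f x y) (\<lambda>y. fy s y - fy x y)) \<longlongrightarrow> 0) (at x within {0..L}))"

definition cont_L2 :: "real \<Rightarrow> (real \<Rightarrow> real \<Rightarrow> real) \<Rightarrow> bool" where
  "cont_L2 L f \<longleftrightarrow> (\<forall>x\<in>{0..L}. in_L2 L (f x) \<and>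
     ((\<lambda>s. L2_norm L (\<lambda>y. f s y - f x y)) \<longlongrightarrow> 0) (at x within {0..L}))"

definition cont_H1_dual :: "real \<Rightarrow> (real \<Rightarrow> (real \<Rightarrow> real) \<Rightarrow> real) \<Rightarrow> bool" where
  "cont_H1_dual L F \<longleftrightarrow> (\<forall>x\<in>{0..L}. in_H1_dual L (F x) \<and>
     ((\<lambda>s. H1_dual_norm L (\<lambda>v. F s v - F x v)) \<longlongrightarrow> 0) (at x within {0..L}))"

definition has_L2_deriv :: "real \<Rightarrow> (real \<Rightarrow> real \<Rightarrow> real) \<Rightarrow> (real \<Rightarrow> real \<Rightarrow> real) \<Rightarrow> bool" where
  "has_L2_deriv L f g \<longleftrightarrow> (\<forall>x\<in>{0..L}.
     ((\<lambda>s. L2_norm L (\<lambda>y. (f s y - f x y) / (s - x) - g x y)) \<longlongrightarrow> 0) (at x within {0..L}))"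

definition has_H1_dual_deriv ::
  "real \<Rightarrow> (real \<Rightarrow> (real \<Rightarrow> real) \<Rightarrow> real) \<Rightarrow> (real \<Rightarrow> (real \<Rightarrow> real) \<Rightarrow> real) \<Rightarrow> bool" where
  "has_H1_dual_deriv L F G \<longleftrightarrow> (\<forall>x\<in>{0..L}.
     ((\<lambda>s. H1_dual_norm L (\<lambda>v. (F s v - F x v) / (s - x) - G x v)) \<longlongrightarrow> 0) (at x within {0..L}))"

text \<open>The extension of \<open>k\<close> from $D_\infty$. At \<open>x = 0\<close> it is \<open>0\<close>, which is the only value
  compatible with continuity into $L^2(0,L)$.\<close>

definition kext :: "real \<Rightarrow> (real \<Rightarrow> real \<Rightarrow> real) \<Rightarrow> real \<Rightarrow> real \<Rightarrow> real" where
  "kext \<alpha> k x y = (if 0 < y \<and> y \<le> x then k x y else - (\<alpha> / 2) * x)"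

text \<open>Condition (i), with \<open>kx\<close> and \<open>ky\<close> representing the partial derivatives of the
  extension; restricted to $D_\infty$ they are the partial derivatives of \<open>k\<close>. The functional
  \<open>F x\<close> is the second derivative in \<open>x\<close>.\<close>

definition kernel_regular ::
  "real \<Rightarrow> (real \<Rightarrow> real \<Rightarrow> real) \<Rightarrow> (real \<Rightarrow> real \<Rightarrow> real) \<Rightarrow> (real \<Rightarrow> real \<Rightarrow> real) \<Rightarrow> bool" where
  "kernel_regular \<alpha> k kx ky \<longleftrightarrow> (\<forall>L>0.
     cont_H1 L (kext \<alpha> k) ky \<and>
     has_L2_deriv L (kext \<alpha> k) kx \<and> cont_L2 L kx \<and>
     (\<exists>F. has_H1_dual_deriv L (\<lambda>x. L2_functional L (kx x)) F \<and> cont_H1_dual L F))"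

text \<open>Condition (ii). The value \<open>w L\<close> is that of the continuous representative of \<open>w\<close>, so the
  elements of $H^1(0,L)$ are given here by their continuous representatives.\<close>

definition kernel_weak_form ::
  "real \<Rightarrow> (real \<Rightarrow> real \<Rightarrow> real) \<Rightarrow> (real \<Rightarrow> real \<Rightarrow> real) \<Rightarrow> (real \<Rightarrow> real \<Rightarrow> real) \<Rightarrow> bool" where
  "kernel_weak_form \<alpha> k kx ky \<longleftrightarrow> (\<forall>L>0. \<forall>v v' w w'.
     in_H1 L v v' \<and> continuous_on {0..L} v \<and> in_H1 L w w' \<and> continuous_on {0..L} w \<longrightarrow>
     - (LINT x:{0<..<L}|lebesgue. (LINT y:{0<..<x}|lebesgue. kx x y * v y) * w' x)
     + w L * (LINT y:{0<..<L}|lebesgue. kx L y * v y)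
     + (LINT x:{0<..<L}|lebesgue. (LINT y:{0<..<x}|lebesgue. ky x y * v' y) * w x)
     = \<alpha> * (LINT x:{0<..<L}|lebesgue. (LINT y:{0<..<x}|lebesgue. k x y * v y) * w x)
       - \<alpha> / 2 * (LINT x:{0<..<L}|lebesgue. v x * w x))"

definition weak_solution_grad ::
  "real \<Rightarrow> (real \<Rightarrow> real \<Rightarrow> real) \<Rightarrow> (real \<Rightarrow> real \<Rightarrow> real) \<Rightarrow> (real \<Rightarrow> real \<Rightarrow> real) \<Rightarrow> bool" where
  "weak_solution_grad \<alpha> k kx ky \<longleftrightarrow> kernel_regular \<alpha> k kx ky \<and> kernel_weak_form \<alpha> k kx ky"

definition k_solution_grad ::
  "real \<Rightarrow> real \<Rightarrow> (real \<Rightarrow> real \<Rightarrow> real) \<Rightarrow> (real \<Rightarrow> real \<Rightarrow> real) \<Rightarrow> (real \<Rightarrow> real \<Rightarrow> real) \<Rightarrow> bool" where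
  "k_solution_grad \<sigma> lam k kx ky \<longleftrightarrow> weak_solution_grad (lam / \<sigma>) k kx ky"

definition l_solution_grad ::
  "real \<Rightarrow> real \<Rightarrow> (real \<Rightarrow> real \<Rightarrow> real) \<Rightarrow> (real \<Rightarrow> real \<Rightarrow> real) \<Rightarrow> (real \<Rightarrow> real \<Rightarrow> real) \<Rightarrow> bool" where
  "l_solution_grad \<sigma> lam l lx ly \<longleftrightarrow>
     weak_solution_grad (- lam / \<sigma>) (\<lambda>x y. - l x y) (\<lambda>x y. - lx x y) (\<lambda>x y. - ly x y)"

definition k_solution :: "real \<Rightarrow> real \<Rightarrow> (real \<Rightarrow> real \<Rightarrow> real) \<Rightarrow> bool" where
  "k_solution \<sigma> lam k \<longleftrightarrow> (\<exists>kx ky. k_solution_grad \<sigma> lam k kx ky)"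

definition l_solution :: "real \<Rightarrow> real \<Rightarrow> (real \<Rightarrow> real \<Rightarrow> real) \<Rightarrow> bool" where
  "l_solution \<sigma> lam l \<longleftrightarrow> (\<exists>lx ly. l_solution_grad \<sigma> lam l lx ly)"

text \<open>Equality of functions on $D_\infty$ as maps \<open>x \<mapsto> k(x,\<cdot>)\<close> into function classes:
  for every \<open>x\<close>, and almost every \<open>y\<close>.\<close>

definition eq_on_D :: "(real \<Rightarrow> real \<Rightarrow> real) \<Rightarrow> (real \<Rightarrow> real \<Rightarrow> real) \<Rightarrow> bool" where
  "eq_on_D k k' \<longleftrightarrow> (\<forall>x>0. AE y in lebesgue. 0 < y \<and> y \<le> x \<longrightarrow> k x y = k' x y)"

definition unique_on_D :: "((real \<Rightarrow> real \<Rightarrow> real) \<Rightarrow> bool) \<Rightarrow> bool" where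
  "unique_on_D P \<longleftrightarrow> (\<exists>k. P k \<and> (\<forall>k'. P k' \<longrightarrow> eq_on_D k' k))"

definition ebar :: "real \<Rightarrow> real \<Rightarrow> real \<Rightarrow> real" where
  "ebar e0 v t = e0 + v * t"

definition grad_energy ::
  "(real \<Rightarrow> real \<Rightarrow> real) \<Rightarrow> (real \<Rightarrow> real \<Rightarrow> real) \<Rightarrow> (real \<Rightarrow> real \<Rightarrow> real) \<Rightarrow> real \<Rightarrow> real" where
  "grad_energy k kx ky x =
     (LINT y:{0<..<x}|lebesgue. \<bar>k x y\<bar>\<^sup>2 + (\<bar>kx x y\<bar>\<^sup>2 + \<bar>ky x y\<bar>\<^sup>2))"

end

theory Submission
  imports Defs
begin

text \<open>The problem with parameter $\alpha$ has an explicit solution. With the Bessel--Clifford functions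
  $B_m(s)=\sum_n s^n/(n!\,(n+m)!)$ it is
  $$k^\alpha(x,y)=-\frac{\alpha x}2\,B_1\Big(\frac{\alpha(x^2-y^2)}4\Big).$$
  The theorem follows from three facts: this function is a weak solution, there is no other one, and
  $B_m(s)$ is at most $e^{2\sqrt s}$ for $s\ge0$ and bounded by $1$ for $s\le0$. The last fact explains why
  $\sqrt{\lambda/\sigma}$ enters the exponent for $k^\sigma_\lambda$, where $\alpha=\lambda/\sigma$, but not for
  $l^\sigma_\lambda$, where $\alpha=-\lambda/\sigma$: in the latter case only the polynomial factors of the kernel and its
  gradient depend on $\lambda$.

  Existence (\<open>bessel_kernel_weak_solution\<close>). The Bessel equation gives the wave equation in the classical
  sense, and $\partial_xk+\partial_yk=-\frac\alpha2$ on the diagonal. The \<open>x\<close>-derivative of the extended kernel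
  jumps across the diagonal, so its derivative in \<open>x\<close> exists only as a functional on $H^1$. When the pairing of
  $\partial_x\bar k$ with some $v\in H^1$ is differentiated in \<open>x\<close> and $\partial_{yy}k$ is integrated by
  parts, the boundary terms on the diagonal cancel (\<open>kernel_functional_derivative\<close>), and the result is
  $\alpha\int kv-\int\partial_yk\,v'$. This is bounded by the $H^1$ norm of \<open>v\<close>, which yields the regularity
  in the dual space, and integrating against $w$ yields the weak equation. The calculus of weak derivatives that this
  requires, in particular integration by parts for absolutely continuous functions, is developed first.

  Uniqueness (\<open>weak_solution_unique\<close>). The weak equation is tested with $w=1$ and $v=y^{2n}$. The derivative of
  \<open>v\<close> vanishes at $y=0$, so the Neumann condition leaves no boundary term, and its second derivative is a multiple of
  $y^{2n-2}$. Therefore the even moments $m_n(x)=\int_0^xk(x,y)y^{2n}\,dy$ satisfy a triangular system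
  $m_n''=\alpha m_n+2n(2n-1)m_{n-1}+\dots$ whose inhomogeneity and initial values are the same for all solutions. Hence
  all even moments are determined, and by the Weierstrass theorem in the variable $y^2$ so is $k$. The same argument
  applies to both partial derivatives, so that every weak solution inherits the estimates of the explicit one.\<close>

section \<open>The space $L^2(0,L)$\<close>

lemma in_L2_iff_absolutely_integrable:
  "in_L2 L f \<longleftrightarrow> f absolutely_integrable_on {0<..<L} \<and> (\<lambda>y. (f y)\<^sup>2) absolutely_integrable_on {0<..<L}"
proof
  assume f: "in_L2 L f"
  have c: "(\<lambda>y. 1::real) absolutely_integrable_on {0<..<L}"
    using absolutely_integrable_on_Icc_iff_Ioo[where f="\<lambda>y. 1::real" and a=0 and b=L]
    by (simp add: absolutely_integrable_continuous_real)
  have "(\<lambda>y. 1 + (f y)\<^sup>2) absolutely_integrable_on {0<..<L}"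
    using f c by (intro set_integral_add) (auto simp: in_L2_def)
  moreover have "\<bar>f y\<bar> \<le> \<bar>1 + (f y)\<^sup>2\<bar>" for y
  proof -
    have "0 \<le> (\<bar>f y\<bar> - 1 / 2)\<^sup>2" by simp
    then show ?thesis by (simp add: power2_diff power_divide)
  qed
  ultimately have "f absolutely_integrable_on {0<..<L}"
    using f by (intro set_integrable_bound[where f="\<lambda>y. 1 + (f y)\<^sup>2" and g=f])
      (auto simp: in_L2_def)
  then show "f absolutely_integrable_on {0<..<L} \<and> (\<lambda>y. (f y)\<^sup>2) absolutely_integrable_on {0<..<L}"
    using f by (auto simp: in_L2_def)
next
  assume "f absolutely_integrable_on {0<..<L} \<and> (\<lambda>y. (f y)\<^sup>2) absolutely_integrable_on {0<..<L}"
  then show "in_L2 L f"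
    by (auto simp: in_L2_def set_borel_measurable_def set_integrable_def)
qed

lemma in_L2_mult:
  assumes "in_L2 L f" "in_L2 L g"
  shows "(\<lambda>y. f y * g y) absolutely_integrable_on {0<..<L}"
proof -
  have sq: "(\<lambda>y. (f y)\<^sup>2 + (g y)\<^sup>2) absolutely_integrable_on {0<..<L}"
    using assms by (intro set_integral_add) (auto simp: in_L2_def)
  have bnd: "\<bar>f y * g y\<bar> \<le> \<bar>(f y)\<^sup>2 + (g y)\<^sup>2\<bar>" for y
  proof -
    have "2 * (\<bar>f y\<bar> * \<bar>g y\<bar>) \<le> (f y)\<^sup>2 + (g y)\<^sup>2"
      using sum_squares_bound[of "\<bar>f y\<bar>" "\<bar>g y\<bar>"] by simp
    moreover have "0 \<le> \<bar>f y\<bar> * \<bar>g y\<bar>" by simp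
    ultimately have "\<bar>f y\<bar> * \<bar>g y\<bar> \<le> (f y)\<^sup>2 + (g y)\<^sup>2" by linarith
    then show ?thesis by (simp add: abs_mult)
  qed
  have meas: "set_borel_measurable lebesgue {0<..<L} (\<lambda>y. f y * g y)"
  proof -
    have "(\<lambda>y. (indicator {0<..<L} y *\<^sub>R f y) * (indicator {0<..<L} y *\<^sub>R g y))
        \<in> borel_measurable lebesgue"
      using assms unfolding in_L2_def set_borel_measurable_def
      by (intro borel_measurable_times) auto
    also have "(\<lambda>y. (indicator {0<..<L} y *\<^sub>R f y) * (indicator {0<..<L} y *\<^sub>R g y)) =
      (\<lambda>y. indicator {0<..<L} y *\<^sub>R (f y * g y))" by (auto simp: indicator_def)
    finally show ?thesis by (simp add: set_borel_measurable_def)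
  qed
  show ?thesis
    using sq meas
  proof (rule set_integrable_bound)
    show "AE y in lebesgue. y \<in> {0<..<L} \<longrightarrow> norm (f y * g y) \<le> norm ((f y)\<^sup>2 + (g y)\<^sup>2)"
      using bnd by (intro AE_I2) simp
  qed
qed

lemma in_L2_lincomb:
  assumes "in_L2 L f" "in_L2 L g"
  shows "in_L2 L (\<lambda>y. a * f y + b * g y)"
proof -
  have "(\<lambda>y. a\<^sup>2 * (f y)\<^sup>2 + (2 * a * b) * (f y * g y) + b\<^sup>2 * (g y)\<^sup>2) absolutely_integrable_on {0<..<L}"
    using assms in_L2_mult[OF assms]
    by (intro set_integral_add set_integrable_mult_right) (auto simp: in_L2_def)
  moreover have "(\<lambda>y. a * f y + b * g y) absolutely_integrable_on {0<..<L}"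
    using assms by (intro set_integral_add set_integrable_mult_right)
      (auto simp: in_L2_iff_absolutely_integrable)
  moreover have "(\<lambda>y. a\<^sup>2 * (f y)\<^sup>2 + (2 * a * b) * (f y * g y) + b\<^sup>2 * (g y)\<^sup>2)
     = (\<lambda>y. (a * f y + b * g y)\<^sup>2)"
    by (auto simp: power2_eq_square algebra_simps)
  ultimately show ?thesis by (simp add: in_L2_iff_absolutely_integrable)
qed

lemma in_L2_diff: "in_L2 L f \<Longrightarrow> in_L2 L g \<Longrightarrow> in_L2 L (\<lambda>y. f y - g y)"
  using in_L2_lincomb[of L f g 1 "-1"] by simp

lemma in_L2_cmult: "in_L2 L f \<Longrightarrow> in_L2 L (\<lambda>y. c * f y)"
  using in_L2_lincomb[of L f f c 0] by simp

lemma L2_norm_nonneg [simp]: "0 \<le> L2_norm L f"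
  unfolding L2_norm_def by (simp add: set_lebesgue_integral_def)

lemma H1_norm_nonneg [simp]: "0 \<le> H1_norm L f g"
  unfolding H1_norm_def by simp

lemma L2_norm_power2: "(L2_norm L f)\<^sup>2 = (LINT y:{0<..<L}|lebesgue. (f y)\<^sup>2)"
  unfolding L2_norm_def by (simp add: set_lebesgue_integral_def)

lemma L2_norm_le_H1_norm: "L2_norm L f \<le> H1_norm L f g" "L2_norm L g \<le> H1_norm L f g"
  unfolding H1_norm_def by (rule real_le_rsqrt, simp)+

lemma L2_Cauchy_Schwarz:
  assumes f: "in_L2 L f" and g: "in_L2 L g"
  shows "\<bar>LINT y:{0<..<L}|lebesgue. f y * g y\<bar> \<le> L2_norm L f * L2_norm L g"
proof -
  define F G P where "F = (L2_norm L f)\<^sup>2" and "G = (L2_norm L g)\<^sup>2"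
    and "P = (LINT y:{0<..<L}|lebesgue. f y * g y)"
  have quad: "0 \<le> F - 2 * t * P + t\<^sup>2 * G" for t
  proof -
    have "0 \<le> (LINT y:{0<..<L}|lebesgue. (f y - t * g y)\<^sup>2)"
      by (simp add: set_lebesgue_integral_def)
    also have "(\<lambda>y. (f y - t * g y)\<^sup>2) = (\<lambda>y. (f y)\<^sup>2 - (2 * t) * (f y * g y) + t\<^sup>2 * (g y)\<^sup>2)"
      by (auto simp: power2_eq_square algebra_simps)
    also have "(LINT y:{0<..<L}|lebesgue. (f y)\<^sup>2 - (2 * t) * (f y * g y) + t\<^sup>2 * (g y)\<^sup>2)
      = (LINT y:{0<..<L}|lebesgue. (f y)\<^sup>2 - (2 * t) * (f y * g y))
        + (LINT y:{0<..<L}|lebesgue. t\<^sup>2 * (g y)\<^sup>2)"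
      using f g in_L2_mult[OF f g]
      by (intro set_integral_add set_integral_diff set_integrable_mult_right) (auto simp: in_L2_def)
    also have "(LINT y:{0<..<L}|lebesgue. (f y)\<^sup>2 - (2 * t) * (f y * g y))
      = (LINT y:{0<..<L}|lebesgue. (f y)\<^sup>2) - (LINT y:{0<..<L}|lebesgue. (2 * t) * (f y * g y))"
      using f in_L2_mult[OF f g]
      by (intro set_integral_diff set_integrable_mult_right) (auto simp: in_L2_def)
    also have "\<dots> + (LINT y:{0<..<L}|lebesgue. t\<^sup>2 * (g y)\<^sup>2) = F - 2 * t * P + t\<^sup>2 * G"
      by (simp only: set_integral_mult_right F_def G_def P_def L2_norm_power2)
    finally show ?thesis .
  qed
  have G0: "G \<ge> 0" "F \<ge> 0" by (auto simp: G_def F_def)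
  have "P\<^sup>2 \<le> F * G"
  proof (cases "G = 0")
    case True
    have "P = 0"
    proof (rule ccontr)
      assume "P \<noteq> 0"
      then show False using quad[of "(F + 1) / (2 * P)"] True by (simp add: field_simps)
    qed
    then show ?thesis using True by simp
  next
    case False
    with G0 have "G > 0" by simp
    then show ?thesis using quad[of "P / G"] by (simp add: field_simps power2_eq_square)
  qed
  then have "sqrt (P\<^sup>2) \<le> sqrt (F * G)" by (rule real_sqrt_le_mono)
  then show ?thesis by (simp add: P_def F_def G_def real_sqrt_mult)
qed

lemma in_L2_bounded:
  assumes m: "set_borel_measurable lebesgue {0<..<L} f"
    and b: "\<And>y. 0 < y \<Longrightarrow> y < L \<Longrightarrow> \<bar>f y\<bar> \<le> B"
  shows "in_L2 L f"
proof -
  have c: "(\<lambda>y. B\<^sup>2) absolutely_integrable_on {0<..<L}"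
    using absolutely_integrable_on_Icc_iff_Ioo[where f="\<lambda>y. B\<^sup>2" and a=0 and b=L]
    by (simp add: absolutely_integrable_continuous_real)
  have m2: "set_borel_measurable lebesgue {0<..<L} (\<lambda>y. (f y)\<^sup>2)"
  proof -
    have "(\<lambda>y. (indicator {0<..<L} y *\<^sub>R f y)\<^sup>2) \<in> borel_measurable lebesgue"
      using m unfolding set_borel_measurable_def by (rule borel_measurable_power)
    also have "(\<lambda>y. (indicator {0<..<L} y *\<^sub>R f y)\<^sup>2) =
      (\<lambda>y. indicator {0<..<L} y *\<^sub>R (f y)\<^sup>2)" by (auto simp: indicator_def)
    finally show ?thesis by (simp add: set_borel_measurable_def)
  qed
  have "(\<lambda>y. (f y)\<^sup>2) absolutely_integrable_on {0<..<L}"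
    using c m2
  proof (rule set_integrable_bound)
    show "AE y in lebesgue. y \<in> {0<..<L} \<longrightarrow> norm ((f y)\<^sup>2) \<le> norm (B\<^sup>2)"
      using b by (intro AE_I2) (auto simp: abs_le_square_iff[symmetric] intro: order_trans[OF _ abs_ge_self])
  qed
  then show ?thesis using m by (simp add: in_L2_def)
qed

text \<open>Dominated convergence, in the form in which all $L^2$ limits below are taken: the functions
  depend on \<open>s\<close> continuously except on the diagonal \<open>y = s\<close>, so pointwise convergence may fail at
  the single point \<open>y = x\<close>.\<close>

lemma L2_norm_tendsto_0:
  fixes h :: "real \<Rightarrow> real \<Rightarrow> real"
  assumes m: "\<And>s. s \<in> S \<Longrightarrow> s \<noteq> x \<Longrightarrow> set_borel_measurable lebesgue {0<..<L} (h s)"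
    and b: "\<And>s y. s \<in> S \<Longrightarrow> s \<noteq> x \<Longrightarrow> 0 < y \<Longrightarrow> y < L \<Longrightarrow> \<bar>h s y\<bar> \<le> B"
    and lim: "\<And>y. 0 < y \<Longrightarrow> y < L \<Longrightarrow> y \<noteq> x \<Longrightarrow> ((\<lambda>s. h s y) \<longlongrightarrow> 0) (at x within S)"
  shows "((\<lambda>s. L2_norm L (h s)) \<longlongrightarrow> 0) (at x within S)"
  unfolding tendsto_at_iff_sequentially
proof (intro allI impI)
  fix X :: "nat \<Rightarrow> real" assume X: "\<forall>i. X i \<in> S - {x}" "X \<longlonglongrightarrow> x"
  have c: "(\<lambda>y. B\<^sup>2) absolutely_integrable_on {0<..<L}"
    using absolutely_integrable_on_Icc_iff_Ioo[where f="\<lambda>y. B\<^sup>2" and a=0 and b=L]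
    by (simp add: absolutely_integrable_continuous_real)
  have "(\<lambda>i. integral\<^sup>L lebesgue (\<lambda>y. indicator {0<..<L} y *\<^sub>R (h (X i) y)\<^sup>2)) \<longlonglongrightarrow> integral\<^sup>L lebesgue (\<lambda>y::real. 0::real)"
  proof (rule integral_dominated_convergence[where w="\<lambda>y. indicator {0<..<L} y *\<^sub>R B\<^sup>2"])
    show "integrable lebesgue (\<lambda>y. indicator {0<..<L} y *\<^sub>R B\<^sup>2)"
      using c by (simp add: set_integrable_def)
    show "(\<lambda>y. indicator {0<..<L} y *\<^sub>R (h (X i) y)\<^sup>2) \<in> borel_measurable lebesgue" for i
    proof -
      have "in_L2 L (h (X i))" using X(1) by (intro in_L2_bounded[where B=B] m b) auto
      then show ?thesis by (auto simp: in_L2_def set_integrable_def)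
    qed
    show "AE y in lebesgue. norm (indicator {0<..<L} y *\<^sub>R (h (X i) y)\<^sup>2) \<le> indicator {0<..<L} y *\<^sub>R B\<^sup>2" for i
      using b[of "X i"] X(1)
      by (intro AE_I2) (auto simp: indicator_def abs_le_square_iff[symmetric] intro: order_trans[OF _ abs_ge_self])
    have "AE y in lebesgue. y \<noteq> x"
      by (intro AE_completion AE_lborel_singleton)
    then show "AE y in lebesgue. (\<lambda>i. indicator {0<..<L} y *\<^sub>R (h (X i) y)\<^sup>2) \<longlonglongrightarrow> 0"
    proof eventually_elim
      case (elim y)
      show ?case
      proof (cases "0 < y \<and> y < L")
        case True
        with lim elim X have "(\<lambda>i. h (X i) y) \<longlonglongrightarrow> 0"
          unfolding tendsto_at_iff_sequentially comp_def by blast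
        from tendsto_power[OF this, of 2] show ?thesis using True by simp
      qed (auto simp: indicator_def)
    qed
  qed auto
  then have "(\<lambda>i. sqrt (LINT y:{0<..<L}|lebesgue. (h (X i) y)\<^sup>2)) \<longlonglongrightarrow> sqrt 0"
    unfolding set_lebesgue_integral_def by (intro tendsto_real_sqrt) simp
  then show "((\<lambda>s. L2_norm L (h s)) \<circ> X) \<longlonglongrightarrow> 0"
    by (simp add: L2_norm_def comp_def)
qed

lemma LINT_open_eq_integral:
  fixes f :: "real \<Rightarrow> real"
  assumes "f absolutely_integrable_on {a<..<b}"
  shows "(LINT y:{a<..<b}|lebesgue. f y) = integral {a..b} f"
  using set_lebesgue_integral_eq_integral(2)[OF assms] by (simp add: integral_open_interval_real)

lemma continuous_imp_absolutely_integrable_Ioo: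
  fixes f :: "real \<Rightarrow> real"
  assumes "continuous_on {a..b} f"
  shows "f absolutely_integrable_on {a<..<b}"
  using absolutely_integrable_continuous_real[OF assms] absolutely_integrable_on_Icc_iff_Ioo by blast

lemma in_L2_continuous:
  assumes "continuous_on {0..L} f"
  shows "in_L2 L f"
  unfolding in_L2_iff_absolutely_integrable
  by (intro conjI continuous_imp_absolutely_integrable_Ioo continuous_intros assms)

lemma L2_norm_cong: "(\<And>y. 0 < y \<Longrightarrow> y < L \<Longrightarrow> f y = g y) \<Longrightarrow> L2_norm L f = L2_norm L g"
  unfolding L2_norm_def set_lebesgue_integral_def
  by (intro arg_cong[where f=sqrt] Bochner_Integration.integral_cong) (auto simp: indicator_def)

lemma in_L2_cong: "(\<And>y. 0 < y \<Longrightarrow> y < L \<Longrightarrow> f y = g y) \<Longrightarrow> in_L2 L f = in_L2 L g"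
  unfolding in_L2_def set_borel_measurable_def set_integrable_def
  by (intro arg_cong2[where f="(\<and>)"] arg_cong2[where f="\<lambda>f M. f \<in> borel_measurable M"]
      arg_cong[where f="integrable lebesgue"]) (auto simp: indicator_def)

lemma L2_functional_diff:
  assumes "in_L2 L f" "in_L2 L g" "in_L2 L v"
  shows "L2_functional L f v - L2_functional L g v = L2_functional L (\<lambda>y. f y - g y) v"
  unfolding L2_functional_def left_diff_distrib
  using assms by (intro set_integral_diff(2)[symmetric] in_L2_mult)

lemma L2_functional_bound: "in_L2 L f \<Longrightarrow> in_L2 L v \<Longrightarrow> \<bar>L2_functional L f v\<bar> \<le> L2_norm L f * L2_norm L v"
  unfolding L2_functional_def by (rule L2_Cauchy_Schwarz)

lemma L2_functional_cong_AE:
  assumes "in_L2 L f" "in_L2 L v" "in_L2 L w" and ae: "AE y in lebesgue. 0 < y \<and> y < L \<longrightarrow> v y = w y"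
  shows "L2_functional L f v = L2_functional L f w"
  unfolding L2_functional_def set_lebesgue_integral_def
proof (rule integral_cong_AE)
  show "(\<lambda>y. indicator {0<..<L} y *\<^sub>R (f y * v y)) \<in> borel_measurable lebesgue"
    "(\<lambda>y. indicator {0<..<L} y *\<^sub>R (f y * w y)) \<in> borel_measurable lebesgue"
    using in_L2_mult[OF assms(1,2)] in_L2_mult[OF assms(1,3)] by (auto simp: set_integrable_def)
  show "AE y in lebesgue. indicator {0<..<L} y *\<^sub>R (f y * v y) = indicator {0<..<L} y *\<^sub>R (f y * w y)"
    using ae by eventually_elim (auto simp: indicator_def)
qed

text \<open>By Cauchy--Schwarz, continuity and differentiability in the $L^2$ norm pass to the pairing
  with a fixed \<open>v\<close>. This lemma and \<open>L2_functional_derivative\<close> below turn the regularity of a weak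
  solution into statements about real functions of \<open>x\<close>.\<close>

lemma continuous_on_L2_functional:
  assumes "cont_L2 L f" "in_L2 L v"
  shows "continuous_on {0..L} (\<lambda>x. L2_functional L (f x) v)"
  unfolding continuous_on_def
proof
  fix x assume x: "x \<in> {0..L}"
  have f: "in_L2 L (f s)" if "s \<in> {0..L}" for s using assms(1) that by (simp add: cont_L2_def)
  have "((\<lambda>s. L2_functional L (f s) v - L2_functional L (f x) v) \<longlongrightarrow> 0) (at x within {0..L})"
  proof (rule Lim_null_comparison)
    show "((\<lambda>s. L2_norm L (\<lambda>y. f s y - f x y) * L2_norm L v) \<longlongrightarrow> 0) (at x within {0..L})"
      using assms(1) x by (intro tendsto_mult_left_zero) (simp add: cont_L2_def)
    show "\<forall>\<^sub>F s in at x within {0..L}. norm (L2_functional L (f s) v - L2_functional L (f x) v)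
        \<le> L2_norm L (\<lambda>y. f s y - f x y) * L2_norm L v"
      using x f assms(2)
      by (auto simp: eventually_at_filter L2_functional_diff intro!: L2_functional_bound in_L2_diff eventuallyI)
  qed
  then show "((\<lambda>s. L2_functional L (f s) v) \<longlongrightarrow> L2_functional L (f x) v) (at x within {0..L})"
    by (simp only: LIM_zero_iff)
qed

lemma LINT_split:
  fixes f :: "real \<Rightarrow> real"
  assumes f: "f absolutely_integrable_on {0<..<L}" and s: "0 \<le> s" "s \<le> L"
  shows "(LINT y:{0<..<L}|lebesgue. f y) = (LINT y:{0<..<s}|lebesgue. f y) + (LINT y:{s<..<L}|lebesgue. f y)"
proof -
  have c: "f absolutely_integrable_on {0..L}" using f by (simp add: absolutely_integrable_on_Icc_iff_Ioo)
  have sub: "f absolutely_integrable_on {a<..<b}" if "0 \<le> a" "b \<le> L" for a b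
    unfolding absolutely_integrable_on_Icc_iff_Ioo[symmetric]
    by (rule absolutely_integrable_on_subinterval[OF c]) (use that in auto)
  have "integral {0..s} f + integral {s..L} f = integral {0..L} f"
    using c set_lebesgue_integral_eq_integral(1) by (intro Henstock_Kurzweil_Integration.integral_combine s) blast
  then show ?thesis using s by (simp add: LINT_open_eq_integral sub)
qed

lemma L2_functional_derivative:
  assumes f: "\<And>s. s \<in> {0..L} \<Longrightarrow> in_L2 L (f s)" and g: "in_L2 L (g x)" and v: "in_L2 L v"
    and d: "has_L2_deriv L f g" and x: "x \<in> {0..L}"
  shows "((\<lambda>s. L2_functional L (f s) v) has_real_derivative L2_functional L (g x) v) (at x within {0..L})"
proof -
  let ?h = "\<lambda>s y. (f s y - f x y) / (s - x) - g x y"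
  have h: "in_L2 L (?h s)" if "s \<in> {0..L}" for s
    using in_L2_diff[OF in_L2_cmult[OF in_L2_diff[OF f[OF that] f[OF x]], of "1 / (s - x)"] g] by simp
  have q: "L2_functional L (?h s) v = (L2_functional L (f s) v - L2_functional L (f x) v) / (s - x) - L2_functional L (g x) v"
    if "s \<in> {0..L}" for s
  proof -
    have "L2_functional L (?h s) v = L2_functional L (\<lambda>y. 1 / (s - x) * (f s y - f x y)) v - L2_functional L (g x) v"
      using L2_functional_diff[OF in_L2_cmult[OF in_L2_diff[OF f[OF that] f[OF x]], of "1 / (s - x)"] g v] by simp
    also have "L2_functional L (\<lambda>y. 1 / (s - x) * (f s y - f x y)) v
        = 1 / (s - x) * L2_functional L (\<lambda>y. f s y - f x y) v"
      unfolding L2_functional_def mult.assoc by (rule set_integral_mult_right)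
    also have "L2_functional L (\<lambda>y. f s y - f x y) v = L2_functional L (f s) v - L2_functional L (f x) v"
      by (rule L2_functional_diff[OF f[OF that] f[OF x] v, symmetric])
    finally show ?thesis by simp
  qed
  have "((\<lambda>s. (L2_functional L (f s) v - L2_functional L (f x) v) / (s - x) - L2_functional L (g x) v) \<longlongrightarrow> 0) (at x within {0..L})"
  proof (rule Lim_null_comparison)
    show "((\<lambda>s. L2_norm L (?h s) * L2_norm L v) \<longlongrightarrow> 0) (at x within {0..L})"
      using d x by (intro tendsto_mult_left_zero) (simp add: has_L2_deriv_def)
    show "\<forall>\<^sub>F s in at x within {0..L}. norm ((L2_functional L (f s) v - L2_functional L (f x) v) / (s - x)
        - L2_functional L (g x) v) \<le> L2_norm L (?h s) * L2_norm L v"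
      unfolding eventually_at_filter
    proof (intro always_eventually allI impI)
      fix s assume "s \<noteq> x" "s \<in> {0..L}"
      from L2_functional_bound[OF h[OF this(2)] v]
      show "norm ((L2_functional L (f s) v - L2_functional L (f x) v) / (s - x)
        - L2_functional L (g x) v) \<le> L2_norm L (?h s) * L2_norm L v"
        unfolding q[OF \<open>s \<in> {0..L}\<close>] by simp
    qed
  qed
  then show ?thesis unfolding has_field_derivative_iff by (simp only: LIM_zero_iff)
qed

section \<open>Functions determined by their integrals\<close>

text \<open>The sign of \<open>g\<close> is a measurable function, hence an almost everywhere limit of continuous
  ones. Clamping these to $[-1,1]$ and cutting them off near the endpoints gives admissible test
  functions, and in the limit \<open>g\<close> is orthogonal to its own sign, so $\int|g|=0$.\<close>

lemma AE_zero_if_orthogonal_to_continuous: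
  fixes g :: "real \<Rightarrow> real"
  assumes g: "g absolutely_integrable_on {a<..<b}"
    and orth: "\<And>\<psi> \<delta>. continuous_on UNIV \<psi> \<Longrightarrow> \<delta> > 0 \<Longrightarrow>
      (\<And>y. y \<le> a + \<delta> \<or> b - \<delta> \<le> y \<Longrightarrow> \<psi> y = 0) \<Longrightarrow> (LINT y:{a<..<b}|lebesgue. g y * \<psi> y) = 0"
  shows "AE y in lebesgue. a < y \<and> y < b \<longrightarrow> g y = 0"
proof -
  let ?I = "{a<..<b}"
  have "(\<lambda>y. indicator ?I y *\<^sub>R g y) \<in> borel_measurable lebesgue"
    using g by (auto simp: set_integrable_def)
  then have "(\<lambda>y. sgn (indicator ?I y *\<^sub>R g y)) \<in> borel_measurable lebesgue"
    by measurable
  then have "(\<lambda>y. sgn (indicator ?I y *\<^sub>R g y)) measurable_on UNIV"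
    by (rule lebesgue_measurable_imp_measurable_on) simp
  then obtain k N where k: "negligible N" "\<And>n. continuous_on UNIV (k n)"
    "\<And>y. y \<notin> N \<Longrightarrow> (\<lambda>n. k n y) \<longlonglongrightarrow> sgn (indicator ?I y *\<^sub>R g y)"
    unfolding measurable_on_def by auto
  \<comment> \<open>A continuous cutoff that vanishes within $1/(n+1)$ of the endpoints and tends to \<open>1\<close> inside.\<close>
  define cut where "cut n y = max 0 (min 1 (real (Suc n) * min (y - a) (b - y) - 1))" for n :: nat and y :: real
  define \<psi> where "\<psi> n y = max (-1) (min 1 (k n y)) * cut n y" for n :: nat and y :: real
  have cut1: "0 \<le> cut n y" "cut n y \<le> 1" for n y by (auto simp: cut_def)
  have cut_lim: "(\<lambda>n. cut n y) \<longlonglongrightarrow> 1" if "a < y" "y < b" for y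
  proof -
    define m where "m = min (y - a) (b - y)"
    have m: "0 < m" using that by (simp add: m_def)
    obtain N :: nat where N: "2 / m < real N" using reals_Archimedean2 by blast
    have "1 \<le> real (Suc n) * m - 1" if "n \<ge> N" for n
    proof -
      have "2 / m \<le> real (Suc n)" using N that by linarith
      then show ?thesis using m by (simp add: pos_divide_le_eq)
    qed
    then have "\<forall>\<^sub>F n in sequentially. 1 \<le> real (Suc n) * min (y - a) (b - y) - 1"
      unfolding m_def by (rule eventually_sequentiallyI)
    then have "\<forall>\<^sub>F n in sequentially. cut n y = 1" by eventually_elim (auto simp: cut_def)
    then show ?thesis by (rule tendsto_eventually)
  qed
  have cont: "continuous_on UNIV (\<psi> n)" for n
    unfolding \<psi>_def cut_def by (intro continuous_intros k(2))
  have AEN: "AE y in lebesgue. y \<notin> N"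
    using k(1) by (auto simp: negligible_iff_null_sets intro: AE_not_in)
  have "(\<lambda>n. integral\<^sup>L lebesgue (\<lambda>y. indicator ?I y *\<^sub>R (g y * \<psi> n y)))
      \<longlonglongrightarrow> integral\<^sup>L lebesgue (\<lambda>y. indicator ?I y *\<^sub>R \<bar>g y\<bar>)"
  proof (rule integral_dominated_convergence)
    show w: "integrable lebesgue (\<lambda>y. indicator ?I y *\<^sub>R \<bar>g y\<bar>)"
      using set_integrable_abs[OF g] by (simp add: set_integrable_def)
    then show "(\<lambda>y. indicator ?I y *\<^sub>R \<bar>g y\<bar>) \<in> borel_measurable lebesgue" by auto
    have "\<psi> n \<in> borel_measurable lebesgue" for n
    proof -
      from cont have "\<psi> n \<in> borel_measurable borel" by (rule borel_measurable_continuous_onI)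
      then show ?thesis by (simp add: measurable_completion)
    qed
    then have "(\<lambda>y. (indicator ?I y *\<^sub>R g y) * \<psi> n y) \<in> borel_measurable lebesgue" for n
      using \<open>(\<lambda>y. indicator ?I y *\<^sub>R g y) \<in> borel_measurable lebesgue\<close> by (intro borel_measurable_times)
    then show "(\<lambda>y. indicator ?I y *\<^sub>R (g y * \<psi> n y)) \<in> borel_measurable lebesgue" for n
      by (simp add: mult.assoc)
    show "AE y in lebesgue. norm (indicator ?I y *\<^sub>R (g y * \<psi> n y)) \<le> indicator ?I y *\<^sub>R \<bar>g y\<bar>" for n
    proof (rule AE_I2)
      fix y
      have "\<bar>\<psi> n y\<bar> = \<bar>max (-1) (min 1 (k n y))\<bar> * cut n y"
        unfolding \<psi>_def abs_mult using cut1(1)[of n y] by simp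
      also have "\<dots> \<le> 1 * 1" using cut1[of n y] by (intro mult_mono) auto
      finally have "\<bar>\<psi> n y\<bar> \<le> 1" by simp
      then have "\<bar>g y\<bar> * \<bar>\<psi> n y\<bar> \<le> \<bar>g y\<bar> * 1" by (intro mult_left_mono) auto
      then show "norm (indicator ?I y *\<^sub>R (g y * \<psi> n y)) \<le> indicator ?I y *\<^sub>R \<bar>g y\<bar>"
        by (auto simp: indicator_def abs_mult)
    qed
    show "AE y in lebesgue. (\<lambda>n. indicator ?I y *\<^sub>R (g y * \<psi> n y)) \<longlonglongrightarrow> indicator ?I y *\<^sub>R \<bar>g y\<bar>"
      using AEN
    proof eventually_elim
      case (elim y)
      show ?case
      proof (cases "y \<in> ?I")
        case True
        have "(\<lambda>n. \<psi> n y) \<longlonglongrightarrow> max (-1) (min 1 (sgn (g y))) * 1"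
          unfolding \<psi>_def using k(3)[OF elim] True
          by (intro tendsto_mult tendsto_max tendsto_min tendsto_const cut_lim) auto
        also have "max (-1) (min 1 (sgn (g y))) * 1 = sgn (g y)" by (auto simp: sgn_if)
        finally have "(\<lambda>n. g y * \<psi> n y) \<longlonglongrightarrow> g y * sgn (g y)" by (intro tendsto_intros)
        then show ?thesis using True by (simp add: abs_sgn)
      qed (auto simp: indicator_def)
    qed
  qed
  moreover have "integral\<^sup>L lebesgue (\<lambda>y. indicator ?I y *\<^sub>R (g y * \<psi> n y)) = 0" for n
  proof -
    have "(LINT y:?I|lebesgue. g y * \<psi> n y) = 0"
    proof (rule orth[OF cont, of "1 / real (Suc n)"])
      fix y assume "y \<le> a + 1 / real (Suc n) \<or> b - 1 / real (Suc n) \<le> y"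
      then have "min (y - a) (b - y) \<le> 1 / real (Suc n)" by auto
      then have "real (Suc n) * min (y - a) (b - y) \<le> real (Suc n) * (1 / real (Suc n))"
        by (intro mult_left_mono) auto
      then have "real (Suc n) * min (y - a) (b - y) - 1 \<le> 0" by simp
      then have "cut n y = 0" unfolding cut_def by linarith
      then show "\<psi> n y = 0" by (simp add: \<psi>_def)
    qed simp
    then show ?thesis by (simp add: set_lebesgue_integral_def)
  qed
  ultimately have "integral\<^sup>L lebesgue (\<lambda>y. indicator ?I y *\<^sub>R \<bar>g y\<bar>) = 0"
    by (simp add: LIMSEQ_const_iff)
  then have "AE y in lebesgue. indicator ?I y *\<^sub>R \<bar>g y\<bar> = 0"
    using set_integrable_abs[OF g] unfolding set_integrable_def
    by (subst (asm) integral_nonneg_eq_0_iff_AE) auto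
  then show ?thesis by eventually_elim (auto simp: indicator_def)
qed

text \<open>On $(0,b)$ the variable $y$ is a continuous function of $y^2$, so by the Weierstrass theorem
  the polynomials in $y^2$ are already dense among the continuous functions. Even moments are
  the ones that the Neumann condition at \<open>y = 0\<close> leaves accessible.\<close>

lemma AE_zero_if_even_moments_zero:
  fixes g :: "real \<Rightarrow> real"
  assumes g: "g absolutely_integrable_on {0<..<b}"
    and mom: "\<And>n. (LINT y:{0<..<b}|lebesgue. g y * y ^ (2 * n)) = 0"
  shows "AE y in lebesgue. 0 < y \<and> y < b \<longrightarrow> g y = 0"
proof (rule AE_zero_if_orthogonal_to_continuous[OF g])
  fix \<psi> :: "real \<Rightarrow> real" assume \<psi>: "continuous_on UNIV \<psi>"
  let ?I = "{0<..<b}"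
  define N where "N = (LINT y:?I|lebesgue. \<bar>g y\<bar>)"
  have prod: "(\<lambda>y. g y * f y) absolutely_integrable_on ?I" if "continuous_on UNIV f" for f :: "real \<Rightarrow> real"
  proof -
    have c: "continuous_on {0..b} f" using that by (rule continuous_on_subset) auto
    then have "bounded (f ` {0..b})" by (intro compact_imp_bounded compact_continuous_image) auto
    then have "bounded (f ` ?I)" by (rule bounded_subset) auto
    moreover have "f \<in> borel_measurable (lebesgue_on ?I)"
      using that by (intro continuous_imp_measurable_on_sets_lebesgue) (auto intro: continuous_on_subset)
    ultimately show ?thesis using absolutely_integrable_bounded_measurable_product_real[of f ?I g] g
      by (simp add: mult.commute)
  qed
  have "\<bar>LINT y:?I|lebesgue. g y * \<psi> y\<bar> \<le> e * N" if e: "e > 0" for e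
  proof -
    have "continuous_on {0..b\<^sup>2} (\<lambda>t. \<psi> (sqrt t))"
      by (intro continuous_on_compose2[OF \<psi>] continuous_intros) auto
    then obtain p where p: "real_polynomial_function p" "\<And>t. t \<in> {0..b\<^sup>2} \<Longrightarrow> \<bar>\<psi> (sqrt t) - p t\<bar> < e"
      using Stone_Weierstrass_real_polynomial_function[OF compact_Icc _ e] by blast
    then obtain a m where a: "p = (\<lambda>t. \<Sum>i\<le>m. a i * t ^ i)"
      using real_polynomial_function_iff_sum by metis
    \<comment> \<open>An even polynomial, close to \<open>\<psi>\<close> on $[0,b]$ and orthogonal to \<open>g\<close>.\<close>
    define q where "q y = p (y\<^sup>2)" for y
    have cq: "continuous_on UNIV q" unfolding q_def a by (intro continuous_intros)
    have close: "\<bar>\<psi> y - q y\<bar> \<le> e" if "0 < y" "y < b" for y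
    proof -
      have "y\<^sup>2 \<in> {0..b\<^sup>2}" using that by (auto intro: power_mono)
      from p(2)[OF this] that show ?thesis by (simp add: q_def)
    qed
    have "(LINT y:?I|lebesgue. g y * q y) = (LINT y:?I|lebesgue. (\<Sum>i\<le>m. a i * (g y * y ^ (2 * i))))"
      by (simp add: q_def a sum_distrib_left power_mult[symmetric] mult_ac)
    also have "\<dots> = (\<Sum>i\<le>m. LINT y:?I|lebesgue. a i * (g y * y ^ (2 * i)))"
      unfolding set_lebesgue_integral_def
      by (subst scaleR_sum_right, rule Bochner_Integration.integral_sum)
         (use prod in \<open>auto simp: set_integrable_def continuous_intros mult.left_commute[of _ "a _"]\<close>)
    also have "\<dots> = 0" using mom by simp
    finally have q0: "(LINT y:?I|lebesgue. g y * q y) = 0" .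
    have "(LINT y:?I|lebesgue. g y * \<psi> y) = (LINT y:?I|lebesgue. g y * \<psi> y) - (LINT y:?I|lebesgue. g y * q y)"
      using q0 by simp
    also have "\<dots> = (LINT y:?I|lebesgue. g y * \<psi> y - g y * q y)"
      using prod[OF \<psi>] prod[OF cq] by simp
    finally have "\<bar>LINT y:?I|lebesgue. g y * \<psi> y\<bar> = \<bar>LINT y:?I|lebesgue. g y * \<psi> y - g y * q y\<bar>" by simp
    also have "\<dots> \<le> (LINT y:?I|lebesgue. \<bar>g y * \<psi> y - g y * q y\<bar>)"
      using set_integral_norm_bound[of lebesgue ?I "\<lambda>y. g y * \<psi> y - g y * q y"] prod[OF \<psi>] prod[OF cq]
      by (simp add: set_integral_diff)
    also have "\<dots> \<le> (LINT y:?I|lebesgue. e * \<bar>g y\<bar>)"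
    proof (rule set_integral_mono)
      show "set_integrable lebesgue ?I (\<lambda>y. \<bar>g y * \<psi> y - g y * q y\<bar>)"
        using prod[OF \<psi>] prod[OF cq] by (intro set_integrable_abs set_integral_diff)
      show "set_integrable lebesgue ?I (\<lambda>y. e * \<bar>g y\<bar>)"
        using g by (intro set_integrable_mult_right set_integrable_abs)
      fix y assume "y \<in> ?I"
      then have "\<bar>g y\<bar> * \<bar>\<psi> y - q y\<bar> \<le> \<bar>g y\<bar> * e" using close by (intro mult_left_mono) auto
      then show "\<bar>g y * \<psi> y - g y * q y\<bar> \<le> e * \<bar>g y\<bar>"
        by (simp add: abs_mult[symmetric] right_diff_distrib mult.commute)
    qed
    also have "\<dots> = e * N" by (simp add: N_def)
    finally show ?thesis .
  qed
  note bound = this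
  have "N \<ge> 0" unfolding N_def set_lebesgue_integral_def by simp
  show "(LINT y:?I|lebesgue. g y * \<psi> y) = 0"
  proof (rule ccontr)
    define A where "A = \<bar>LINT y:?I|lebesgue. g y * \<psi> y\<bar>"
    assume "(LINT y:?I|lebesgue. g y * \<psi> y) \<noteq> 0"
    then have "A > 0" by (simp add: A_def)
    have "A \<le> A / (2 * (N + 1)) * N" unfolding A_def
      using \<open>A > 0\<close> \<open>N \<ge> 0\<close> by (intro bound) (auto simp: A_def)
    also have "\<dots> < A" using \<open>A > 0\<close> \<open>N \<ge> 0\<close> by (simp add: field_simps add_nonneg_pos)
    finally show False by simp
  qed
qed

section \<open>Weak derivatives and continuous representatives\<close>

text \<open>An estimate for short increments whose bound is itself an increment adds up over a uniform
  subdivision.\<close>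

lemma increment_bound_from_local:
  fixes Z P :: "real \<Rightarrow> real"
  assumes "\<delta> > 0" "0 \<le> b"
    and loc: "\<And>s t. 0 \<le> s \<Longrightarrow> s \<le> t \<Longrightarrow> t \<le> b \<Longrightarrow> t - s < \<delta> \<Longrightarrow> \<bar>Z t - Z s\<bar> \<le> P t - P s"
  shows "\<bar>Z b - Z 0\<bar> \<le> P b - P 0"
proof -
  obtain n :: nat where n: "b / \<delta> < real n" using reals_Archimedean2 by blast
  have "n > 0" using n \<open>\<delta> > 0\<close> \<open>0 \<le> b\<close> by (cases n) (auto simp: field_simps)
  define h where "h = b / real n"
  have h: "0 \<le> h" "h < \<delta>" "real n * h = b"
    using n \<open>n > 0\<close> assms(1,2) by (auto simp: h_def field_simps)
  have "k \<le> n \<Longrightarrow> \<bar>Z (real k * h) - Z 0\<bar> \<le> P (real k * h) - P 0" for k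
  proof (induction k)
    case (Suc k)
    have "real (Suc k) * h \<le> real n * h" using Suc.prems h by (intro mult_right_mono) auto
    then have "\<bar>Z (real (Suc k) * h) - Z (real k * h)\<bar> \<le> P (real (Suc k) * h) - P (real k * h)"
      using h by (intro loc) (auto simp: algebra_simps)
    then show ?case using Suc by simp
  qed simp
  from this[of n] show ?thesis using h by simp
qed

lemma absolutely_integrable_continuous_mult:
  fixes f g :: "real \<Rightarrow> real"
  assumes f: "continuous_on {a..b} f" and g: "g absolutely_integrable_on {a..b}"
  shows "(\<lambda>x. f x * g x) absolutely_integrable_on {a..b}"
proof -
  have "bounded (f ` {a..b})" using f by (intro compact_imp_bounded compact_continuous_image) auto
  moreover have "f \<in> borel_measurable (lebesgue_on {a..b})"
    using f by (intro continuous_imp_measurable_on_sets_lebesgue) auto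
  ultimately show ?thesis
    using g by (intro absolutely_integrable_bounded_measurable_product_real) auto
qed

text \<open>Integration by parts for two indefinite integrals of integrable functions. The factors
  are differentiable almost everywhere at best, so the fundamental theorem of calculus does not
  apply to the product. Instead, the defect \<open>Z\<close> of the formula on $[0,t]$ has increments over $[s,t]$ bounded by
  the oscillation of the factors on $[s,t]$ times the integral of $|u'|+|f'|$ over $[s,t]$. By
  uniform continuity the oscillation is at most any given \<open>e\<close> on short intervals, and the bounds
  add up to \<open>e\<close> times a constant.\<close>

lemma integral_by_parts_absolutely_continuous:
  fixes u f :: "real \<Rightarrow> real"
  assumes b: "0 \<le> b"
    and u': "u' absolutely_integrable_on {0..b}" and f': "f' absolutely_integrable_on {0..b}"
    and u: "\<And>y. 0 \<le> y \<Longrightarrow> y \<le> b \<Longrightarrow> u y = u 0 + integral {0..y} u'"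
    and f: "\<And>y. 0 \<le> y \<Longrightarrow> y \<le> b \<Longrightarrow> f y = f 0 + integral {0..y} f'"
  shows "integral {0..b} (\<lambda>y. u' y * f y) + integral {0..b} (\<lambda>y. u y * f' y) = u b * f b - u 0 * f 0"
proof -
  have iu: "u' integrable_on {0..b}" and if': "f' integrable_on {0..b}"
    using u' f' set_lebesgue_integral_eq_integral(1) by auto
  have cu: "continuous_on {0..b} u"
    using continuous_on_add[OF continuous_on_const indefinite_integral_continuous_1[OF iu], of "u 0"]
    by (rule continuous_on_eq) (rule u[symmetric]; simp)
  have cf: "continuous_on {0..b} f"
    using continuous_on_add[OF continuous_on_const indefinite_integral_continuous_1[OF if'], of "f 0"]
    by (rule continuous_on_eq) (rule f[symmetric]; simp)
  have a1: "(\<lambda>y. f y * u' y) absolutely_integrable_on {0..b}"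
    by (rule absolutely_integrable_continuous_mult[OF cf u'])
  have a2: "(\<lambda>y. u y * f' y) absolutely_integrable_on {0..b}"
    by (rule absolutely_integrable_continuous_mult[OF cu f'])
  have i1: "(\<lambda>y. u' y * f y) integrable_on {0..b}"
    using set_lebesgue_integral_eq_integral(1)[OF a1] by (simp add: mult.commute)
  have i2: "(\<lambda>y. u y * f' y) integrable_on {0..b}"
    using set_lebesgue_integral_eq_integral(1)[OF a2] .
  define p where "p y = \<bar>u' y\<bar> + \<bar>f' y\<bar>" for y
  have pa: "p absolutely_integrable_on {0..b}"
    unfolding p_def by (intro set_integral_add set_integrable_abs u' f')
  then have ip: "p integrable_on {0..b}" using set_lebesgue_integral_eq_integral(1) by blast
  define q where "q y = u' y * f y + u y * f' y" for y
  have iq: "q integrable_on {0..b}" unfolding q_def using i1 i2 by (rule integrable_add)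
  \<comment> \<open>The defect of the formula on $[0,t]$, up to the constant \<open>u 0 * f 0\<close>.\<close>
  define Z where "Z t = u t * f t - integral {0..t} q" for t
  have diff: "integral {0..t} g - integral {0..s} g = integral {s..t} g"
    if "g integrable_on {0..b}" "0 \<le> s" "s \<le> t" "t \<le> b" for g :: "real \<Rightarrow> real" and s t
  proof -
    have "g integrable_on {0..t}" using that(1) by (rule integrable_on_subinterval) (use that in auto)
    from Henstock_Kurzweil_Integration.integral_combine[OF that(2,3) this] show ?thesis by simp
  qed
  have est: "\<bar>Z b - Z 0\<bar> \<le> e * integral {0..b} p" if e: "e > 0" for e
  proof -
    have uc: "uniformly_continuous_on {0..b} u" "uniformly_continuous_on {0..b} f"
      using cu cf by (auto intro: compact_uniformly_continuous)
    obtain d1 where d1: "d1 > 0"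
      "\<And>s t. s \<in> {0..b} \<Longrightarrow> t \<in> {0..b} \<Longrightarrow> dist t s < d1 \<Longrightarrow> dist (u t) (u s) < e"
      using uniformly_continuous_onE[OF uc(1) e] by blast
    obtain d2 where d2: "d2 > 0"
      "\<And>s t. s \<in> {0..b} \<Longrightarrow> t \<in> {0..b} \<Longrightarrow> dist t s < d2 \<Longrightarrow> dist (f t) (f s) < e"
      using uniformly_continuous_onE[OF uc(2) e] by blast
    note d = d1(1) d2(1) d1(2)[unfolded dist_real_def] d2(2)[unfolded dist_real_def]
    have "\<bar>Z b - Z 0\<bar> \<le> e * integral {0..b} p - e * integral {0..0} p"
    proof (rule increment_bound_from_local[of "min d1 d2" b Z "\<lambda>t. e * integral {0..t} p"])
      fix s t assume st: "0 \<le> s" "s \<le> t" "t \<le> b" "t - s < min d1 d2"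
      have sub: "g integrable_on {s..t}" if "g integrable_on {0..b}" for g :: "real \<Rightarrow> real"
        using that by (rule integrable_on_subinterval) (use st in auto)
      have eu: "u t - u s = integral {s..t} u'" using u[of s] u[of t] st diff[OF iu, of s t] by simp
      have ef: "f t - f s = integral {s..t} f'" using f[of s] f[of t] st diff[OF if', of s t] by simp
      have "Z t - Z s = (u t - u s) * f t + u s * (f t - f s) - integral {s..t} q"
        using diff[OF iq, of s t] st by (simp add: Z_def algebra_simps)
      also have "\<dots> = integral {s..t} (\<lambda>y. u' y * f t + u s * f' y) - integral {s..t} q"
        unfolding eu ef using sub[OF iu] sub[OF if']
        by (subst Henstock_Kurzweil_Integration.integral_add) (auto intro: integrable_on_mult_left integrable_on_mult_right)
      also have "\<dots> = integral {s..t} (\<lambda>y. (u' y * f t + u s * f' y) - q y)"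
        using sub[OF iu] sub[OF if'] sub[OF iq]
        by (subst Henstock_Kurzweil_Integration.integral_diff)
          (auto intro!: integrable_add integrable_on_mult_left integrable_on_mult_right)
      also have "norm \<dots> \<le> integral {s..t} (\<lambda>y. e * p y)"
      proof (rule integral_norm_bound_integral)
        show "(\<lambda>y. (u' y * f t + u s * f' y) - q y) integrable_on {s..t}"
          using sub[OF iu] sub[OF if'] sub[OF iq]
          by (intro integrable_diff integrable_add integrable_on_mult_left integrable_on_mult_right)
        show "(\<lambda>y. e * p y) integrable_on {s..t}" using sub[OF ip] by (rule integrable_on_mult_right)
        fix y assume y: "y \<in> {s..t}"
        have "(u' y * f t + u s * f' y) - q y = u' y * (f t - f y) - f' y * (u y - u s)"
          by (simp add: q_def algebra_simps)
        also have "\<bar>\<dots>\<bar> \<le> \<bar>u' y\<bar> * \<bar>f t - f y\<bar> + \<bar>f' y\<bar> * \<bar>u y - u s\<bar>"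
          by (metis abs_mult abs_triangle_ineq4)
        also have "\<dots> \<le> \<bar>u' y\<bar> * e + \<bar>f' y\<bar> * e"
          using y st d(4)[of y t] d(3)[of s y] by (intro add_mono mult_left_mono) (auto intro: less_imp_le)
        also have "\<dots> = e * p y" by (simp add: p_def algebra_simps)
        finally show "norm ((u' y * f t + u s * f' y) - q y) \<le> e * p y" by simp
      qed
      also have "\<dots> = e * integral {0..t} p - e * integral {0..s} p"
        using diff[OF ip, of s t] st by (simp add: right_diff_distrib[symmetric])
      finally show "\<bar>Z t - Z s\<bar> \<le> e * integral {0..t} p - e * integral {0..s} p" by simp
    qed (use d b in auto)
    then show ?thesis by simp
  qed
  have I0: "integral {0..b} p \<ge> 0" by (intro integral_nonneg ip) (simp add: p_def)
  have "Z b - Z 0 = 0"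
  proof (rule ccontr)
    assume "Z b - Z 0 \<noteq> 0"
    define A where "A = \<bar>Z b - Z 0\<bar>"
    define N where "N = integral {0..b} p"
    have "A > 0" using \<open>Z b - Z 0 \<noteq> 0\<close> by (simp add: A_def)
    have "N \<ge> 0" using I0 by (simp add: N_def)
    have "A \<le> A / (2 * (N + 1)) * N"
      using est[of "A / (2 * (N + 1))"] \<open>A > 0\<close> \<open>N \<ge> 0\<close> by (simp add: A_def N_def)
    also have "\<dots> < A" using \<open>A > 0\<close> \<open>N \<ge> 0\<close> by (simp add: field_simps add_nonneg_pos)
    finally show False by simp
  qed
  then have "u b * f b - u 0 * f 0 = integral {0..b} q" by (simp add: Z_def)
  also have "\<dots> = integral {0..b} (\<lambda>y. u' y * f y) + integral {0..b} (\<lambda>y. u y * f' y)"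
    unfolding q_def using i1 i2 by (rule Henstock_Kurzweil_Integration.integral_add)
  finally show ?thesis by simp
qed

text \<open>What the weak formulation uses of a test function: a classical derivative, continuous on the
  whole line, and the vanishing at both endpoints.\<close>

lemma test_functionD:
  assumes "test_function L \<phi>"
  shows "\<And>y. (\<phi> has_real_derivative deriv \<phi> y) (at y)" "continuous_on UNIV (deriv \<phi>)"
    "\<And>y. y \<le> 0 \<or> L \<le> y \<Longrightarrow> \<phi> y = 0"
proof -
  obtain D where D: "\<And>y. (\<phi> has_vector_derivative D y) (at y)" "continuous_on UNIV D"
    using assms unfolding test_function_def C1_differentiable_on_def by auto
  then have D1: "(\<phi> has_real_derivative D y) (at y)" for y
    by (simp add: has_real_derivative_iff_has_vector_derivative)
  then have "deriv \<phi> = D" using DERIV_imp_deriv by blast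
  then show "\<And>y. (\<phi> has_real_derivative deriv \<phi> y) (at y)" "continuous_on UNIV (deriv \<phi>)"
    using D1 D by auto
  show "\<phi> y = 0" if "y \<le> 0 \<or> L \<le> y" for y
  proof (rule ccontr)
    assume "\<phi> y \<noteq> 0"
    then have "y \<in> closure {y. \<phi> y \<noteq> 0}" by (intro subsetD[OF closure_subset]) simp
    then show False using assms that unfolding test_function_def by auto
  qed
qed

lemma derivative_imp_integral:
  fixes f f' :: "real \<Rightarrow> real"
  assumes "\<And>y. 0 \<le> y \<Longrightarrow> y \<le> b \<Longrightarrow> (f has_real_derivative f' y) (at y within {0..b})"
    and "0 \<le> y" "y \<le> b"
  shows "f y = f 0 + integral {0..y} f'"
proof -
  have "(f' has_integral f y - f 0) {0..y}"
  proof (rule fundamental_theorem_of_calculus)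
    fix z assume "z \<in> {0..y}"
    then have "(f has_real_derivative f' z) (at z within {0..y})"
      using assms by (intro DERIV_subset[OF assms(1)]) auto
    then show "(f has_vector_derivative f' z) (at z within {0..y})"
      by (simp add: has_real_derivative_iff_has_vector_derivative)
  qed (use assms in auto)
  then show ?thesis by (simp add: integral_unique)
qed

lemma has_weak_deriv_indefinite_integral:
  assumes L: "L > 0" and u': "u' absolutely_integrable_on {0<..<L}"
    and u: "\<And>y. 0 < y \<Longrightarrow> y < L \<Longrightarrow> u y = c + integral {0..y} u'"
  shows "has_weak_deriv L u u'"
  unfolding has_weak_deriv_def
proof (intro allI impI)
  fix \<phi> assume "test_function L \<phi>"
  note \<phi> = test_functionD[OF this]
  have u'c: "u' absolutely_integrable_on {0..L}" using u' by (simp add: absolutely_integrable_on_Icc_iff_Ioo)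
  define U where "U y = c + integral {0..y} u'" for y
  have iu: "u' integrable_on {0..L}" using u'c set_lebesgue_integral_eq_integral(1) by blast
  have cU: "continuous_on {0..L} U"
    unfolding U_def by (intro continuous_intros indefinite_integral_continuous_1 iu)
  have c\<phi>: "continuous_on {0..L} \<phi>"
    using \<phi>(1) by (meson DERIV_isCont continuous_at_imp_continuous_on)
  have c\<phi>': "continuous_on {0..L} (deriv \<phi>)" using \<phi>(2) by (rule continuous_on_subset) auto
  have "integral {0..L} (\<lambda>y. u' y * \<phi> y) + integral {0..L} (\<lambda>y. U y * deriv \<phi> y) = U L * \<phi> L - U 0 * \<phi> 0"
  proof (rule integral_by_parts_absolutely_continuous)
    show "deriv \<phi> absolutely_integrable_on {0..L}" by (rule absolutely_integrable_continuous_real[OF c\<phi>'])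
    show "\<phi> y = \<phi> 0 + integral {0..y} (deriv \<phi>)" if "0 \<le> y" "y \<le> L" for y
      using that \<phi>(1) by (intro derivative_imp_integral[of L]) (auto intro: has_field_derivative_at_within)
  qed (use L u'c in \<open>auto simp: U_def\<close>)
  moreover have "\<phi> L = 0" "\<phi> 0 = 0" using \<phi>(3) by auto
  moreover have "(LINT y:{0<..<L}|lebesgue. u' y * \<phi> y) = integral {0..L} (\<lambda>y. u' y * \<phi> y)"
    using absolutely_integrable_continuous_mult[OF c\<phi> u'c]
    by (intro LINT_open_eq_integral) (simp add: absolutely_integrable_on_Icc_iff_Ioo mult.commute)
  moreover have "(LINT y:{0<..<L}|lebesgue. u y * deriv \<phi> y) = integral {0..L} (\<lambda>y. U y * deriv \<phi> y)"
  proof -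
    have "(LINT y:{0<..<L}|lebesgue. u y * deriv \<phi> y) = (LINT y:{0<..<L}|lebesgue. U y * deriv \<phi> y)"
      by (intro set_lebesgue_integral_cong) (auto simp: U_def u)
    also have "\<dots> = integral {0..L} (\<lambda>y. U y * deriv \<phi> y)"
      by (intro LINT_open_eq_integral continuous_imp_absolutely_integrable_Ioo continuous_intros cU c\<phi>')
    finally show ?thesis .
  qed
  ultimately show "(LINT y:{0<..<L}|lebesgue. u y * deriv \<phi> y) = - (LINT y:{0<..<L}|lebesgue. u' y * \<phi> y)"
    by simp
qed

lemma in_H1_C1:
  fixes v v' :: "real \<Rightarrow> real"
  assumes L: "L > 0" and v: "\<And>y. 0 \<le> y \<Longrightarrow> y \<le> L \<Longrightarrow> (v has_real_derivative v' y) (at y within {0..L})"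
    and c: "continuous_on {0..L} v'"
  shows "in_H1 L v v'"
  unfolding in_H1_def
proof (intro conjI)
  have "continuous_on {0..L} v"
    by (rule DERIV_continuous_on[where D=v']) (use v in simp)
  then show "in_L2 L v" by (rule in_L2_continuous)
  show "in_L2 L v'" using c by (rule in_L2_continuous)
  show "has_weak_deriv L v v'"
  proof (rule has_weak_deriv_indefinite_integral[OF L])
    show "v' absolutely_integrable_on {0<..<L}" by (rule continuous_imp_absolutely_integrable_Ioo[OF c])
    show "v y = v 0 + integral {0..y} v'" if "0 < y" "y < L" for y
      using that v by (intro derivative_imp_integral[of L]) auto
  qed
qed

text \<open>A continuous function with compact support in $(0,L)$ is the derivative of a test function
  exactly when its integral vanishes. Subtracting a multiple of a fixed bump \<open>\<psi>0\<close> makes the integral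
  of any such \<open>\<psi>\<close> vanish, and the multiple accounts for the constant \<open>c\<close>: the function $f-c$ is
  orthogonal to every \<open>\<psi>\<close>.\<close>

lemma du_Bois_Reymond:
  fixes f :: "real \<Rightarrow> real"
  assumes L: "L > 0" and f: "f absolutely_integrable_on {0<..<L}"
    and orth: "\<And>\<phi>. test_function L \<phi> \<Longrightarrow> (LINT y:{0<..<L}|lebesgue. f y * deriv \<phi> y) = 0"
  shows "\<exists>c. AE y in lebesgue. 0 < y \<and> y < L \<longrightarrow> f y = c"
proof -
  let ?I = "{0<..<L}"
  have fc: "f absolutely_integrable_on {0..L}" using f by (simp add: absolutely_integrable_on_Icc_iff_Ioo)
  have prod: "(\<lambda>y. f y * \<psi> y) absolutely_integrable_on ?I" if "continuous_on UNIV \<psi>" for \<psi>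
    using absolutely_integrable_continuous_mult[OF continuous_on_subset[OF that] fc]
    by (simp add: absolutely_integrable_on_Icc_iff_Ioo mult.commute)
  define \<psi>0 where "\<psi>0 y = max 0 (min (y - L / 4) (3 * L / 4 - y))" for y
  have c0: "continuous_on UNIV \<psi>0" unfolding \<psi>0_def by (intro continuous_intros)
  define I0 where "I0 = integral {0..L} \<psi>0"
  have I0: "I0 > 0"
  proof -
    have "I0 \<ge> 0" unfolding I0_def
      by (intro integral_nonneg integrable_continuous_real continuous_on_subset[OF c0]) (auto simp: \<psi>0_def)
    moreover have "I0 \<noteq> 0"
    proof
      assume "I0 = 0"
      have "continuous_on {0..L} \<psi>0" using c0 by (rule continuous_on_subset) simp
      moreover have "\<psi>0 y \<ge> 0" for y by (simp add: \<psi>0_def)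
      ultimately have "\<forall>y\<in>{0..L}. \<psi>0 y = 0"
        using \<open>I0 = 0\<close> integral_eq_0_iff[of 0 L \<psi>0] L unfolding I0_def by blast
      then have "\<psi>0 (L / 2) = 0" using L by simp
      then show False using L by (simp add: \<psi>0_def)
    qed
    ultimately show ?thesis by simp
  qed
  define c where "c = (LINT y:?I|lebesgue. f y * \<psi>0 y) / I0"
  have "AE y in lebesgue. 0 < y \<and> y < L \<longrightarrow> f y - c = 0"
  proof (rule AE_zero_if_orthogonal_to_continuous)
    have "(\<lambda>y. c) absolutely_integrable_on ?I" by (intro continuous_imp_absolutely_integrable_Ioo continuous_intros)
    then show "(\<lambda>y. f y - c) absolutely_integrable_on ?I" using f by (intro set_integral_diff)
    fix \<psi> :: "real \<Rightarrow> real" and \<delta>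
    assume \<psi>: "continuous_on UNIV \<psi>" "\<delta> > 0" and supp: "\<And>y. y \<le> 0 + \<delta> \<or> L - \<delta> \<le> y \<Longrightarrow> \<psi> y = 0"
    define I where "I = integral {0..L} \<psi>"
    \<comment> \<open>The correction that makes the integral vanish, so that \<open>\<theta>\<close> is the derivative of a test function.\<close>
    define \<theta> where "\<theta> y = \<psi> y - I / I0 * \<psi>0 y" for y
    have c\<theta>: "continuous_on UNIV \<theta>" unfolding \<theta>_def by (intro continuous_intros c0 \<psi>)
    have "\<exists>F. \<forall>x::real. -\<infinity> < ereal x \<longrightarrow> ereal x < \<infinity> \<longrightarrow> (F has_vector_derivative \<theta> x) (at x)"
      by (rule einterval_antiderivative) (use c\<theta> continuous_on_eq_continuous_at[OF open_UNIV] in auto)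
    then obtain F where F: "\<And>x. (F has_real_derivative \<theta> x) (at x)"
      by (auto simp: has_real_derivative_iff_has_vector_derivative)
    define \<phi> where "\<phi> y = F y - F 0" for y
    have d\<phi>: "(\<phi> has_real_derivative \<theta> x) (at x)" for x
      unfolding \<phi>_def by (auto intro!: derivative_eq_intros F)
    define \<delta>' where "\<delta>' = min \<delta> (L / 4)"
    have \<delta>': "\<delta>' > 0" "\<delta>' \<le> \<delta>" "\<delta>' \<le> L / 4" using \<psi> L by (auto simp: \<delta>'_def)
    have \<theta>0: "\<theta> y = 0" if "y \<le> \<delta>' \<or> L - \<delta>' \<le> y" for y
      using that \<delta>' supp[of y] by (auto simp: \<theta>_def \<psi>0_def)
    have "integral {0..L} \<theta> = 0"
    proof -
      have "integral {0..L} \<theta> = integral {0..L} \<psi> - integral {0..L} (\<lambda>y. I / I0 * \<psi>0 y)"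
        unfolding \<theta>_def
        by (intro Henstock_Kurzweil_Integration.integral_diff integrable_continuous_real continuous_intros
            continuous_on_subset[OF c0] continuous_on_subset[OF \<psi>(1)]) auto
      then show ?thesis using I0 by (simp add: I_def I0_def[symmetric])
    qed
    then have \<phi>L: "\<phi> L = 0"
      using derivative_imp_integral[of L \<phi> \<theta> L] L d\<phi> by (auto simp: \<phi>_def intro: has_field_derivative_at_within)
    have \<phi>0: "\<phi> 0 = 0" by (simp add: \<phi>_def)
    have \<phi>z: "\<phi> y = 0" if y: "y < \<delta>' \<or> L - \<delta>' < y" for y
    proof -
      have *: "\<phi> y = \<phi> x" if S: "convex S" "\<And>z. z \<in> S \<Longrightarrow> \<theta> z = 0" "x \<in> S" "y \<in> S" for S x
      proof (rule has_field_derivative_zero_constant[OF S(1), of \<phi>, THEN exE])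
        show "(\<phi> has_field_derivative 0) (at z within S)" if "z \<in> S" for z
          using d\<phi>[of z] S(2)[OF that] by (simp add: has_field_derivative_at_within)
      qed (use S in auto)
      from y show ?thesis
      proof
        assume "y < \<delta>'" then show ?thesis using *[of "{..\<delta>'}" 0] \<theta>0 \<delta>' \<phi>0 by auto
      next
        assume "L - \<delta>' < y" then show ?thesis using *[of "{L - \<delta>'..}" L] \<theta>0 \<delta>' \<phi>L by auto
      qed
    qed
    have "test_function L \<phi>"
      unfolding test_function_def
    proof
      show "\<phi> C1_differentiable_on UNIV"
        unfolding C1_differentiable_on_def using d\<phi> c\<theta>
        by (auto simp: has_real_derivative_iff_has_vector_derivative)
      have "closure {y. \<phi> y \<noteq> 0} \<subseteq> {\<delta>'..L - \<delta>'}"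
        by (rule closure_minimal) (use \<phi>z in \<open>auto simp: not_less[symmetric]\<close>)
      also have "\<dots> \<subseteq> {0<..<L}" using \<delta>' by auto
      finally show "closure {y. \<phi> y \<noteq> 0} \<subseteq> {0<..<L}" .
    qed
    from orth[OF this] have "(LINT y:?I|lebesgue. f y * \<theta> y) = 0"
      using d\<phi> DERIV_imp_deriv by (metis (no_types, lifting) ext)
    moreover have "(LINT y:?I|lebesgue. f y * \<theta> y) = (LINT y:?I|lebesgue. f y * \<psi> y - I / I0 * (f y * \<psi>0 y))"
      by (simp add: \<theta>_def algebra_simps)
    moreover have "\<dots> = (LINT y:?I|lebesgue. f y * \<psi> y) - (LINT y:?I|lebesgue. I / I0 * (f y * \<psi>0 y))"
      using prod[OF \<psi>(1)] prod[OF c0] by (intro set_integral_diff set_integrable_mult_right)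
    moreover have "(LINT y:?I|lebesgue. I / I0 * (f y * \<psi>0 y)) = c * I"
      by (simp only: set_integral_mult_right) (simp add: c_def)
    ultimately have "(LINT y:?I|lebesgue. f y * \<psi> y) = c * I" by simp
    moreover have "(LINT y:?I|lebesgue. c * \<psi> y) = c * I"
    proof -
      have "(LINT y:?I|lebesgue. \<psi> y) = I" unfolding I_def
        by (intro LINT_open_eq_integral continuous_imp_absolutely_integrable_Ioo continuous_on_subset[OF \<psi>(1)]) auto
      then show ?thesis by simp
    qed
    moreover have "(LINT y:?I|lebesgue. (f y - c) * \<psi> y)
        = (LINT y:?I|lebesgue. f y * \<psi> y) - (LINT y:?I|lebesgue. c * \<psi> y)"
      unfolding left_diff_distrib
      by (intro set_integral_diff prod[OF \<psi>(1)] continuous_imp_absolutely_integrable_Ioo continuous_intros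
          continuous_on_subset[OF \<psi>(1)]) auto
    ultimately show "(LINT y:?I|lebesgue. (f y - c) * \<psi> y) = 0" by (simp only: diff_self)
  qed
  then show ?thesis by auto
qed

text \<open>Both \<open>u\<close> and the indefinite integral of \<open>u'\<close> have weak derivative \<open>u'\<close>, so their
  difference is constant by du Bois-Reymond.\<close>

lemma in_H1_integral_representation:
  assumes L: "L > 0" and u: "in_H1 L u u'"
  shows "\<exists>c. AE y in lebesgue. 0 < y \<and> y < L \<longrightarrow> u y = c + integral {0..y} u'"
proof -
  let ?I = "{0<..<L}"
  have au: "u absolutely_integrable_on ?I" "u' absolutely_integrable_on ?I"
    using u by (auto simp: in_H1_def in_L2_iff_absolutely_integrable)
  then have auc: "u absolutely_integrable_on {0..L}" "u' absolutely_integrable_on {0..L}"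
    by (auto simp: absolutely_integrable_on_Icc_iff_Ioo)
  define V where "V y = integral {0..y} u'" for y
  have cV: "continuous_on {0..L} V" unfolding V_def
    using auc(2) set_lebesgue_integral_eq_integral(1) by (intro indefinite_integral_continuous_1) blast
  have aV: "V absolutely_integrable_on ?I" by (rule continuous_imp_absolutely_integrable_Ioo[OF cV])
  have "\<exists>c. AE y in lebesgue. 0 < y \<and> y < L \<longrightarrow> u y - V y = c"
  proof (rule du_Bois_Reymond[OF L])
    show "(\<lambda>y. u y - V y) absolutely_integrable_on ?I" using au aV by (intro set_integral_diff)
    fix \<phi> assume \<phi>: "test_function L \<phi>"
    have c\<phi>': "continuous_on {0..L} (deriv \<phi>)" using test_functionD(2)[OF \<phi>] by (rule continuous_on_subset) auto
    have "has_weak_deriv L V u'"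
      by (rule has_weak_deriv_indefinite_integral[OF L au(2), where c=0]) (simp add: V_def)
    then have "(LINT y:?I|lebesgue. u y * deriv \<phi> y) = (LINT y:?I|lebesgue. V y * deriv \<phi> y)"
      using u \<phi> by (simp add: in_H1_def has_weak_deriv_def)
    moreover have "(LINT y:?I|lebesgue. (u y - V y) * deriv \<phi> y)
        = (LINT y:?I|lebesgue. u y * deriv \<phi> y) - (LINT y:?I|lebesgue. V y * deriv \<phi> y)"
      unfolding left_diff_distrib
    proof (rule set_integral_diff)
      show "(\<lambda>y. u y * deriv \<phi> y) absolutely_integrable_on ?I"
        using absolutely_integrable_continuous_mult[OF c\<phi>' auc(1)]
        by (simp add: absolutely_integrable_on_Icc_iff_Ioo mult.commute)
      show "(\<lambda>y. V y * deriv \<phi> y) absolutely_integrable_on ?I"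
        by (intro continuous_imp_absolutely_integrable_Ioo continuous_intros cV c\<phi>')
    qed
    ultimately show "(LINT y:?I|lebesgue. (u y - V y) * deriv \<phi> y) = 0" by simp
  qed
  then obtain c where "AE y in lebesgue. 0 < y \<and> y < L \<longrightarrow> u y - V y = c" by blast
  then have "AE y in lebesgue. 0 < y \<and> y < L \<longrightarrow> u y = c + integral {0..y} u'"
    by eventually_elim (auto simp: V_def)
  then show ?thesis by blast
qed

lemma continuous_AE_zero:
  fixes h :: "real \<Rightarrow> real"
  assumes ab: "a < b" and c: "continuous_on {a..b} h" and z: "AE y in lebesgue. a < y \<and> y < b \<longrightarrow> h y = 0"
    and y: "a \<le> y" "y \<le> b"
  shows "h y = 0"
proof -
  have ch: "continuous_on {a..b} (\<lambda>y. \<bar>h y\<bar>)" using c by (intro continuous_intros)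
  have "integral {a..b} (\<lambda>y. \<bar>h y\<bar>) = (LINT y:{a<..<b}|lebesgue. \<bar>h y\<bar>)"
    by (rule LINT_open_eq_integral[symmetric]) (rule continuous_imp_absolutely_integrable_Ioo[OF ch])
  also have "\<dots> = 0"
    unfolding set_lebesgue_integral_def
    by (rule integral_eq_zero_AE) (use z in \<open>auto elim!: eventually_mono simp: indicator_def\<close>)
  finally show ?thesis using integral_eq_0_iff[OF ch ab] y by simp
qed

text \<open>For a continuous function the almost everywhere identity above holds everywhere, and the
  constant is the value at \<open>0\<close>.\<close>

lemma in_H1_continuous_representation:
  assumes L: "L > 0" and u: "in_H1 L u u'" and cu: "continuous_on {0..L} u"
    and y: "0 \<le> y" "y \<le> L"
  shows "u y = u 0 + integral {0..y} u'"
proof -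
  obtain c where c: "AE y in lebesgue. 0 < y \<and> y < L \<longrightarrow> u y = c + integral {0..y} u'"
    using in_H1_integral_representation[OF L u] by blast
  have "u' absolutely_integrable_on {0..L}"
    using u by (auto simp: in_H1_def in_L2_iff_absolutely_integrable absolutely_integrable_on_Icc_iff_Ioo)
  then have "u' integrable_on {0..L}" using set_lebesgue_integral_eq_integral(1) by blast
  then have cont: "continuous_on {0..L} (\<lambda>y. u y - (c + integral {0..y} u'))"
    by (intro continuous_intros cu indefinite_integral_continuous_1)
  have "u y - (c + integral {0..y} u') = 0" if "0 \<le> y" "y \<le> L" for y
    by (rule continuous_AE_zero[OF L cont _ that]) (use c in \<open>auto elim!: eventually_mono\<close>)
  from this[of 0] this[of y] y L show ?thesis by simp
qed

text \<open>Functionals on $H^1(0,L)$ see only almost everywhere classes, while point values and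
  integration by parts need the continuous representative.\<close>

lemma in_H1_continuous_representative:
  assumes L: "L > 0" and v: "in_H1 L v v'"
  obtains w where "in_H1 L w v'" "continuous_on {0..L} w" "AE y in lebesgue. 0 < y \<and> y < L \<longrightarrow> v y = w y"
proof -
  obtain c where c: "AE y in lebesgue. 0 < y \<and> y < L \<longrightarrow> v y = c + integral {0..y} v'"
    using in_H1_integral_representation[OF L v] by blast
  define w where "w y = c + integral {0..y} v'" for y
  have v': "v' absolutely_integrable_on {0<..<L}" "in_L2 L v'"
    using v by (auto simp: in_H1_def in_L2_iff_absolutely_integrable)
  then have "v' integrable_on {0..L}"
    using set_lebesgue_integral_eq_integral(1)[of "{0..L}" v'] by (simp add: absolutely_integrable_on_Icc_iff_Ioo)
  then have cw: "continuous_on {0..L} w"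
    unfolding w_def by (intro continuous_intros indefinite_integral_continuous_1)
  have "in_H1 L w v'"
    unfolding in_H1_def
    using v' by (intro conjI in_L2_continuous[OF cw] has_weak_deriv_indefinite_integral[OF L, where c=c])
      (auto simp: w_def)
  then show thesis using that cw c by (simp add: w_def)
qed

section \<open>Bessel--Clifford functions\<close>

text \<open>The Bessel--Clifford functions: for $s>0$, \<open>bessel_clifford m s\<close> is $s^{-m/2}I_m(2\sqrt s)$
  and \<open>bessel_clifford m (- s)\<close> is $s^{-m/2}J_m(2\sqrt s)$. They are
  entire functions of \<open>s\<close>, so one formula serves both signs of \<open>\<alpha>\<close>.\<close>

definition bessel_clifford :: "nat \<Rightarrow> real \<Rightarrow> real" where
  "bessel_clifford m s = (\<Sum>n. s ^ n / (fact n * fact (n + m)))"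

lemma bessel_clifford_summable: "summable (\<lambda>n. (s::real) ^ n / (fact n * fact (n + m)))"
proof (rule summable_comparison_test'[where N=0])
  show "summable (\<lambda>n. \<bar>s\<bar> ^ n / fact n)"
    using summable_exp[of "\<bar>s\<bar>"] by (simp add: field_simps)
  fix n
  have "\<bar>s\<bar> ^ n / (fact n * fact (n + m)) \<le> \<bar>s\<bar> ^ n / (fact n * 1)"
    by (intro divide_left_mono mult_left_mono fact_ge_1) auto
  then show "norm (s ^ n / (fact n * fact (n + m))) \<le> \<bar>s\<bar> ^ n / fact n"
    by (simp add: power_abs abs_mult)
qed

lemma bessel_clifford_sums: "(\<lambda>n. s ^ n / (fact n * fact (n + m))) sums bessel_clifford m s"
  unfolding bessel_clifford_def by (rule summable_sums[OF bessel_clifford_summable])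

lemma has_real_derivative_bessel_clifford:
  "(bessel_clifford m has_real_derivative bessel_clifford (Suc m) s) (at s)"
proof -
  define c :: "nat \<Rightarrow> real" where "c n = 1 / (fact n * fact (n + m))" for n
  have "((\<lambda>s. \<Sum>n. c n * s ^ n) has_real_derivative (\<Sum>n. diffs c n * s ^ n)) (at s)"
    using bessel_clifford_summable[of _ m]
    by (intro termdiffs_strong_converges_everywhere) (simp add: c_def)
  moreover have "(\<lambda>s. \<Sum>n. c n * s ^ n) = bessel_clifford m"
    by (auto simp: fun_eq_iff bessel_clifford_def c_def)
  moreover have "diffs c n = 1 / (fact n * fact (n + Suc m))" for n
    unfolding diffs_def c_def by (simp add: fact_Suc field_simps del: of_nat_Suc)
  ultimately show ?thesis by (simp add: bessel_clifford_def)
qed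

lemmas has_real_derivative_bessel_clifford' [derivative_intros] =
  DERIV_chain2[OF has_real_derivative_bessel_clifford]

lemma continuous_on_bessel_clifford [continuous_intros]:
  "continuous_on S f \<Longrightarrow> continuous_on S (\<lambda>x. bessel_clifford m (f x))"
proof -
  have "continuous_on UNIV (bessel_clifford m)"
    by (meson DERIV_continuous_on has_field_derivative_at_within has_real_derivative_bessel_clifford)
  then show "continuous_on S f \<Longrightarrow> continuous_on S (\<lambda>x. bessel_clifford m (f x))"
    by (rule continuous_on_compose2) auto
qed

lemma bessel_clifford_0: "bessel_clifford m 0 = 1 / fact m"
  unfolding bessel_clifford_def by (subst suminf_finite[of "{0}"]) auto

text \<open>Together with the rule that differentiation raises the index by one, this three-term recurrence
  is the Bessel equation $sB''+(m+1)B'=B$.\<close>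

lemma bessel_clifford_recurrence:
  "s * bessel_clifford (Suc (Suc m)) s + real (Suc m) * bessel_clifford (Suc m) s = bessel_clifford m s"
proof -
  let ?t = "\<lambda>m n. s ^ n / (fact n * fact (n + m)) :: real"
  have "(\<lambda>n. ?t m (Suc n)) sums (bessel_clifford m s - ?t m 0)"
    using bessel_clifford_sums[of s m] by (subst sums_Suc_iff) simp
  moreover have "(\<lambda>n. s * ?t (Suc (Suc m)) n + real (Suc m) * ?t (Suc m) (Suc n)) sums
    (s * bessel_clifford (Suc (Suc m)) s + real (Suc m) * (bessel_clifford (Suc m) s - ?t (Suc m) 0))"
  proof (intro sums_add sums_mult)
    show "(\<lambda>n. ?t (Suc (Suc m)) n) sums bessel_clifford (Suc (Suc m)) s" by (rule bessel_clifford_sums)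
    show "(\<lambda>n. ?t (Suc m) (Suc n)) sums (bessel_clifford (Suc m) s - ?t (Suc m) 0)"
      using bessel_clifford_sums[of s "Suc m"] by (subst sums_Suc_iff) simp
  qed
  moreover have "s * ?t (Suc (Suc m)) n + real (Suc m) * ?t (Suc m) (Suc n) = ?t m (Suc n)" for n
  proof -
    define F G where "F = (fact n :: real)" and "G = (fact (n + Suc m) :: real)"
    have pos: "F > 0" "G > 0" by (auto simp: F_def G_def)
    have f1: "fact (n + Suc (Suc m)) = (real n + real m + 2) * G"
      and f2: "fact (Suc n + Suc m) = (real n + real m + 2) * G"
      and f3: "fact (Suc n + m) = G" and f4: "(fact (Suc n) :: real) = (real n + 1) * F"
      by (simp_all add: F_def G_def algebra_simps)
    have "s * s ^ n / (F * ((real n + real m + 2) * G))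
        + (real m + 1) * (s * s ^ n / ((real n + 1) * F * ((real n + real m + 2) * G)))
        = s * s ^ n / ((real n + 1) * F * G)"
    proof -
      have "real n + 1 \<noteq> 0" "real n + real m + 2 \<noteq> 0" by linarith+
      then show ?thesis using pos by (simp add: divide_simps) algebra
    qed
    then show ?thesis unfolding f1 f2 f3 f4 F_def[symmetric] by (simp add: add.commute)
  qed
  ultimately have "s * bessel_clifford (Suc (Suc m)) s
      + real (Suc m) * (bessel_clifford (Suc m) s - ?t (Suc m) 0) = bessel_clifford m s - ?t m 0"
    by (metis (no_types, lifting) sums_cong sums_unique2)
  moreover have "real (Suc m) * ?t (Suc m) 0 = ?t m 0" by (simp add: fact_Suc field_simps del: of_nat_Suc)
  ultimately show ?thesis by (simp only: right_diff_distrib)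
qed

lemma power_divide_fact_le_exp:
  assumes "0 \<le> (z::real)"
  shows "z ^ n / fact n \<le> exp z"
proof -
  have "(\<lambda>n. z ^ n / fact n) sums exp z"
    using exp_converges[of z] by (simp add: divide_inverse mult.commute)
  from sum_le_suminf[OF sums_summable[OF this], of "{n}"] sums_unique[OF this] assms
  show ?thesis by simp
qed

text \<open>With $r=\sqrt s$ and $a_n=r^n/n!$, the series is dominated by $\sum a_n^2$, and each $a_n$ is at most
  $\sum a_n=e^r$. Hence $\sum a_n^2\le e^{2r}$.\<close>

lemma bessel_clifford_growth:
  assumes s: "0 \<le> s"
  shows "0 \<le> bessel_clifford m s" "bessel_clifford m s \<le> exp (2 * sqrt s)"
proof -
  define r where "r = sqrt s"
  define a where "a n = r ^ n / fact n" for n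
  have r: "r \<ge> 0" "r * r = s" using s by (auto simp: r_def)
  have a: "a sums exp r" "a n \<ge> 0" for n
    using exp_converges[of r] r by (simp_all add: a_def[abs_def] divide_inverse mult.commute)
  have le: "a n \<le> exp r" for n
    unfolding a_def using r(1) by (rule power_divide_fact_le_exp)
  show "0 \<le> bessel_clifford m s"
    unfolding bessel_clifford_def using s by (intro suminf_nonneg bessel_clifford_summable) auto
  have "bessel_clifford m s \<le> exp r * exp r"
  proof (rule sums_le[OF _ bessel_clifford_sums sums_mult[OF a(1)]])
    fix n
    have "s ^ n / (fact n * fact (n + m)) \<le> s ^ n / (fact n * fact n)"
      using s by (intro divide_left_mono mult_left_mono fact_mono) auto
    also have "\<dots> = a n * a n" using r(2) by (simp add: a_def power_mult_distrib[symmetric])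
    also have "\<dots> \<le> exp r * a n" using le a(2) by (intro mult_right_mono)
    finally show "s ^ n / (fact n * fact (n + m)) \<le> exp r * a n" .
  qed
  then show "bessel_clifford m s \<le> exp (2 * sqrt s)"
    by (simp add: r_def exp_add[symmetric])
qed

text \<open>On the negative half-line the functions oscillate. Writing $H(r)=B_m(-r)$, the energy
  $rH'^2+H^2$ has derivative $-(2m+1)H'^2$ by the Bessel equation, so it never exceeds its
  value $1/m!^2$ at $r=0$.\<close>

lemma bessel_clifford_bounded_nonpos:
  assumes s: "s \<le> 0"
  shows "\<bar>bessel_clifford m s\<bar> \<le> 1"
proof -
  define E where "E r = r * (bessel_clifford (Suc m) (- r))\<^sup>2 + (bessel_clifford m (- r))\<^sup>2" for r
  have "E (- s) \<le> E 0"
  proof (rule DERIV_nonpos_imp_nonincreasing[of 0 "- s" E])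
    fix r :: real
    let ?A = "bessel_clifford (Suc m) (- r)" and ?B = "bessel_clifford m (- r)"
      and ?C = "bessel_clifford (Suc (Suc m)) (- r)"
    have "(E has_real_derivative (?A\<^sup>2 - r * (2 * ?A * ?C) - 2 * ?B * ?A)) (at r)"
      unfolding E_def by (auto intro!: derivative_eq_intros simp: algebra_simps power2_eq_square)
    moreover have "?A\<^sup>2 - r * (2 * ?A * ?C) - 2 * ?B * ?A = - (2 * real m + 1) * ?A\<^sup>2"
      unfolding bessel_clifford_recurrence[of "- r" m, symmetric] 
      by (simp add: algebra_simps power2_eq_square)
    moreover have "- (2 * real m + 1) * ?A\<^sup>2 \<le> 0" by (simp add: mult_nonpos_nonneg)
    ultimately show "\<exists>y. (E has_real_derivative y) (at r) \<and> y \<le> 0" by metis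
  qed (use s in auto)
  moreover have "(bessel_clifford m s)\<^sup>2 \<le> E (- s)"
    using mult_nonpos_nonneg[OF s zero_le_power2[of "bessel_clifford (Suc m) s"]] by (simp add: E_def)
  moreover have "E 0 \<le> 1\<^sup>2"
  proof -
    have "E 0 = (1 / fact m)\<^sup>2" by (simp add: E_def bessel_clifford_0)
    also have "\<dots> \<le> 1\<^sup>2" by (intro power_mono) (auto simp: fact_ge_1)
    finally show ?thesis .
  qed
  ultimately have "(bessel_clifford m s)\<^sup>2 \<le> 1\<^sup>2" by linarith
  then show ?thesis by (simp only: abs_le_square_iff[symmetric] abs_one)
qed

section \<open>The explicit kernel\<close>

text \<open>The solution of the characteristic problem, with $\alpha(x^2-y^2)/4$ as the argument of the
  Bessel--Clifford function. It is $-\alpha x\,I_1(z)/z$ with $z=\sqrt{\alpha(x^2-y^2)}$.\<close>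

definition bessel_kernel :: "real \<Rightarrow> real \<Rightarrow> real \<Rightarrow> real" where
  "bessel_kernel \<alpha> x y = - (\<alpha> * x / 2) * bessel_clifford 1 (\<alpha> * (x\<^sup>2 - y\<^sup>2) / 4)"

definition kernel_x :: "real \<Rightarrow> real \<Rightarrow> real \<Rightarrow> real" where
  "kernel_x \<alpha> x y = - (\<alpha> / 2) * bessel_clifford 1 (\<alpha> * (x\<^sup>2 - y\<^sup>2) / 4)
     - (\<alpha>\<^sup>2 * x\<^sup>2 / 4) * bessel_clifford 2 (\<alpha> * (x\<^sup>2 - y\<^sup>2) / 4)"

definition kernel_y :: "real \<Rightarrow> real \<Rightarrow> real \<Rightarrow> real" where
  "kernel_y \<alpha> x y = (\<alpha>\<^sup>2 * x * y / 4) * bessel_clifford 2 (\<alpha> * (x\<^sup>2 - y\<^sup>2) / 4)"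

definition kernel_xx :: "real \<Rightarrow> real \<Rightarrow> real \<Rightarrow> real" where
  "kernel_xx \<alpha> x y = - (3 * \<alpha>\<^sup>2 * x / 4) * bessel_clifford 2 (\<alpha> * (x\<^sup>2 - y\<^sup>2) / 4)
     - (\<alpha> ^ 3 * x ^ 3 / 8) * bessel_clifford 3 (\<alpha> * (x\<^sup>2 - y\<^sup>2) / 4)"

definition kernel_yy :: "real \<Rightarrow> real \<Rightarrow> real \<Rightarrow> real" where
  "kernel_yy \<alpha> x y = (\<alpha>\<^sup>2 * x / 4) * bessel_clifford 2 (\<alpha> * (x\<^sup>2 - y\<^sup>2) / 4)
     - (\<alpha> ^ 3 * x * y\<^sup>2 / 8) * bessel_clifford 3 (\<alpha> * (x\<^sup>2 - y\<^sup>2) / 4)"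

lemma kernel_continuous [continuous_intros]:
  assumes "continuous_on S f" "continuous_on S g"
  shows "continuous_on S (\<lambda>z. bessel_kernel \<alpha> (f z) (g z))" "continuous_on S (\<lambda>z. kernel_x \<alpha> (f z) (g z))"
    "continuous_on S (\<lambda>z. kernel_y \<alpha> (f z) (g z))" "continuous_on S (\<lambda>z. kernel_xx \<alpha> (f z) (g z))"
    "continuous_on S (\<lambda>z. kernel_yy \<alpha> (f z) (g z))"
  unfolding bessel_kernel_def kernel_x_def kernel_y_def kernel_xx_def kernel_yy_def
  by (intro continuous_intros assms; simp)+

lemma kernel_derivatives:
  "((\<lambda>x. bessel_kernel \<alpha> x y) has_real_derivative kernel_x \<alpha> x y) (at x)"
  "((\<lambda>y. bessel_kernel \<alpha> x y) has_real_derivative kernel_y \<alpha> x y) (at y)"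
  "((\<lambda>x. kernel_x \<alpha> x y) has_real_derivative kernel_xx \<alpha> x y) (at x)"
  "((\<lambda>y. kernel_y \<alpha> x y) has_real_derivative kernel_yy \<alpha> x y) (at y)"
  unfolding bessel_kernel_def kernel_x_def kernel_y_def kernel_xx_def kernel_yy_def
  by (auto intro!: derivative_eq_intros simp: numeral_2_eq_2 numeral_3_eq_3 field_simps)

lemma kernel_wave_equation: "kernel_xx \<alpha> x y = kernel_yy \<alpha> x y + \<alpha> * bessel_kernel \<alpha> x y"
proof -
  define q where "q = \<alpha> * (x\<^sup>2 - y\<^sup>2) / 4"
  define b2 b3 where "b2 = bessel_clifford 2 q" and "b3 = bessel_clifford 3 q"
  have b1: "bessel_clifford 1 q = q * b3 + 2 * b2"
    using bessel_clifford_recurrence[of q 1] by (simp add: b2_def b3_def numeral_2_eq_2 numeral_3_eq_3)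
  show ?thesis
    unfolding bessel_kernel_def kernel_xx_def kernel_yy_def q_def[symmetric] b1 b2_def[symmetric] b3_def[symmetric]
    unfolding q_def by (simp add: field_simps power2_eq_square power3_eq_cube)
qed

lemma kernel_diagonal: "bessel_kernel \<alpha> x x = - (\<alpha> * x / 2)"
  by (simp add: bessel_kernel_def bessel_clifford_0)

text \<open>This is the derivative of the boundary values \<open>- (\<alpha> * x / 2)\<close> along the diagonal. It makes the
  boundary terms at \<open>y = x\<close> cancel when the weak equation is derived.\<close>

lemma kernel_gradient_diagonal: "kernel_x \<alpha> x x + kernel_y \<alpha> x x = - (\<alpha> / 2)"
  by (simp add: kernel_x_def kernel_y_def bessel_clifford_0 power2_eq_square)

lemma kernel_y_at_0 [simp]: "kernel_y \<alpha> x 0 = 0" by (simp add: kernel_y_def)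

section \<open>Functions glued along the diagonal\<close>

text \<open>The extension of a function from $D_\infty$ by a function of \<open>x\<close> alone. The kernel is glued
  continuously, its derivatives with a jump across the diagonal.\<close>

definition glue :: "(real \<Rightarrow> real \<Rightarrow> real) \<Rightarrow> (real \<Rightarrow> real) \<Rightarrow> real \<Rightarrow> real \<Rightarrow> real" where
  "glue g c x y = (if y \<le> x then g x y else c x)"

lemma LINT_glue_0:
  assumes "x \<le> L"
  shows "(LINT y:{0<..<L}|lebesgue. glue g (\<lambda>_. 0) x y * v y) = (LINT y:{0<..<x}|lebesgue. g x y * v y)"
  unfolding set_lebesgue_integral_def
  by (rule integral_discrete_difference[where X="{x}"]) (use assms in \<open>auto simp: glue_def indicator_def\<close>)

lemma glue_bounded:
  assumes g: "continuous_on UNIV (\<lambda>z. g (fst z) (snd z))" and c: "continuous_on UNIV c"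
  shows "\<exists>B. \<forall>x y. 0 \<le> x \<and> x \<le> L \<and> 0 \<le> y \<and> y \<le> L \<longrightarrow> \<bar>glue g c x y\<bar> \<le> B \<and> \<bar>g x y\<bar> \<le> B"
proof -
  have "bounded ((\<lambda>z. g (fst z) (snd z)) ` ({0..L} \<times> {0..L}))"
    by (intro compact_imp_bounded compact_continuous_image compact_Times compact_Icc continuous_on_subset[OF g]) auto
  then obtain B1 where B1: "\<And>x y. 0 \<le> x \<Longrightarrow> x \<le> L \<Longrightarrow> 0 \<le> y \<Longrightarrow> y \<le> L \<Longrightarrow> \<bar>g x y\<bar> \<le> B1"
    unfolding bounded_iff by fastforce
  have "bounded (c ` {0..L})"
    by (intro compact_imp_bounded compact_continuous_image compact_Icc continuous_on_subset[OF c]) auto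
  then obtain B2 where B2: "\<And>x. 0 \<le> x \<Longrightarrow> x \<le> L \<Longrightarrow> \<bar>c x\<bar> \<le> B2"
    unfolding bounded_iff by fastforce
  show ?thesis
    using B1 B2 by (intro exI[of _ "max B1 B2"]) (auto simp: glue_def le_max_iff_disj)
qed

lemma glue_in_L2:
  assumes g: "continuous_on UNIV (\<lambda>z. g (fst z) (snd z))" and c: "continuous_on UNIV c" and x: "0 \<le> x" "x \<le> L"
  shows "in_L2 L (glue g c x)"
proof -
  have "continuous_on UNIV (g x)"
    using continuous_on_compose2[OF g, of UNIV "\<lambda>y. (x, y)"] continuous_on_Pair[OF continuous_on_const continuous_on_id, of UNIV x]
    by simp
  then have "g x \<in> borel_measurable borel" by (rule borel_measurable_continuous_onI)
  then have "(\<lambda>y. indicator {0<..<L} y *\<^sub>R glue g c x y) \<in> borel_measurable borel"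
    unfolding glue_def by measurable
  then have "set_borel_measurable lebesgue {0<..<L} (glue g c x)"
    unfolding set_borel_measurable_def by (simp add: measurable_completion)
  moreover obtain B where B: "\<And>x y. 0 \<le> x \<and> x \<le> L \<and> 0 \<le> y \<and> y \<le> L \<Longrightarrow> \<bar>glue g c x y\<bar> \<le> B"
    using glue_bounded[OF g c] by blast
  ultimately show ?thesis by (rule in_L2_bounded) (use B x in auto)
qed

lemma eventually_within_less:
  fixes x y :: real
  shows "y < x \<Longrightarrow> \<forall>\<^sub>F s in at x within S. y < s" "x < y \<Longrightarrow> \<forall>\<^sub>F s in at x within S. s < y"
  using order_tendstoD[OF tendsto_ident_at[of x S]] by auto

lemma glue_cont_L2:
  assumes g: "continuous_on UNIV (\<lambda>z. g (fst z) (snd z))" and c: "continuous_on UNIV c"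
  shows "cont_L2 L (glue g c)"
  unfolding cont_L2_def
proof (intro ballI conjI)
  fix x assume x: "x \<in> {0..L}"
  then show "in_L2 L (glue g c x)" by (intro glue_in_L2 assms) auto
  obtain B where B: "\<And>x y. 0 \<le> x \<and> x \<le> L \<and> 0 \<le> y \<and> y \<le> L \<Longrightarrow> \<bar>glue g c x y\<bar> \<le> B"
    using glue_bounded[OF g c] by blast
  show "((\<lambda>s. L2_norm L (\<lambda>y. glue g c s y - glue g c x y)) \<longlongrightarrow> 0) (at x within {0..L})"
  proof (rule L2_norm_tendsto_0[where B="B + B"])
    fix s assume s: "s \<in> {0..L}"
    have "in_L2 L (\<lambda>y. glue g c s y - glue g c x y)"
      using s x by (intro in_L2_diff glue_in_L2 assms) auto
    then show "set_borel_measurable lebesgue {0<..<L} (\<lambda>y. glue g c s y - glue g c x y)"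
      by (simp add: in_L2_def)
    show "\<bar>glue g c s y - glue g c x y\<bar> \<le> B + B" if "0 < y" "y < L" for y
      using B[of s y] B[of x y] s x that by simp
  next
    fix y assume y: "0 < y" "y < L" "y \<noteq> x"
    have "((\<lambda>s. glue g c s y) \<longlongrightarrow> glue g c x y) (at x within {0..L})"
    proof (cases "y < x")
      case True
      have "continuous_on UNIV (\<lambda>s. g s y)"
        using continuous_on_compose2[OF g, of UNIV "\<lambda>s. (s, y)"] continuous_on_Pair[OF continuous_on_id continuous_on_const, of UNIV y]
        by simp
      then have "((\<lambda>s. g s y) \<longlongrightarrow> g x y) (at x within {0..L})"
        by (simp add: continuous_on_def) (meson tendsto_within_subset subset_UNIV)
      moreover have "\<forall>\<^sub>F s in at x within {0..L}. g s y = glue g c s y"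
        using eventually_within_less(1)[OF True] by eventually_elim (simp add: glue_def)
      ultimately show ?thesis using True by (simp add: glue_def[of g c x y] tendsto_cong)
    next
      case False
      then have xy: "x < y" using y by simp
      have "((\<lambda>s. c s) \<longlongrightarrow> c x) (at x within {0..L})"
        using c by (simp add: continuous_on_def) (meson tendsto_within_subset subset_UNIV)
      moreover have "\<forall>\<^sub>F s in at x within {0..L}. c s = glue g c s y"
        using eventually_within_less(2)[OF xy] by eventually_elim (simp add: glue_def)
      ultimately show ?thesis using xy by (simp add: glue_def[of g c x y] tendsto_cong)
    qed
    then show "((\<lambda>s. glue g c s y - glue g c x y) \<longlongrightarrow> 0) (at x within {0..L})"
      by (simp add: LIM_zero)
  qed
qed

text \<open>The integral over $[0,s]$ of \<open>G s\<close> is split as the integral of \<open>G s\<close> over the fixed interval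
  $[0,x]$, the integral of the fixed function \<open>G x\<close> between \<open>x\<close> and \<open>s\<close>, and a remainder \<open>R\<close>, in
  which both the function and the endpoint vary. The remainder is of second order in $s-x$.\<close>

lemma leibniz_rule_moving_endpoint:
  fixes G G' :: "real \<Rightarrow> real \<Rightarrow> real"
  assumes dG: "\<And>s y. s \<in> {0..L} \<Longrightarrow> y \<in> {0..L} \<Longrightarrow>
      ((\<lambda>s. G s y) has_real_derivative G' s y) (at s within {0..L})"
    and cG: "\<And>s. s \<in> {0..L} \<Longrightarrow> continuous_on {0..L} (G s)"
    and cG': "continuous_on ({0..L} \<times> {0..L}) (\<lambda>(s, y). G' s y)"
    and x: "x \<in> {0..L}"
  shows "((\<lambda>s. integral {0..s} (G s)) has_real_derivative G x x + integral {0..x} (G' x)) (at x within {0..L})"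
proof -
  have int: "G s integrable_on {a..b}" if "s \<in> {0..L}" "0 \<le> a" "b \<le> L" for s a b
    using that by (intro integrable_continuous_real continuous_on_subset[OF cG]) auto
  have "bounded ((\<lambda>(s, y). G' s y) ` ({0..L} \<times> {0..L}))"
    by (intro compact_imp_bounded compact_continuous_image cG' compact_Times compact_Icc)
  then obtain M where M: "\<And>s y. s \<in> {0..L} \<Longrightarrow> y \<in> {0..L} \<Longrightarrow> \<bar>G' s y\<bar> \<le> M"
    unfolding bounded_iff by fastforce
  have lip: "\<bar>G s y - G x y\<bar> \<le> M * \<bar>s - x\<bar>" if "s \<in> {0..L}" "y \<in> {0..L}" for s y
    using field_differentiable_bound[of "{0..L}" "\<lambda>s. G s y" "\<lambda>s. G' s y" M s x] dG M that x by simp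
  define R where "R s = integral {0..s} (\<lambda>y. G s y - G x y) - integral {0..x} (\<lambda>y. G s y - G x y)" for s
  have R: "\<bar>R s\<bar> \<le> M * \<bar>s - x\<bar> * \<bar>s - x\<bar>" if s: "s \<in> {0..L}" for s
  proof -
    have d: "(\<lambda>y. G s y - G x y) integrable_on {a..b}" if "0 \<le> a" "b \<le> L" for a b
      using int[OF s that] int[OF x that] by (rule integrable_diff)
    have b: "\<bar>integral {a..b} (\<lambda>y. G s y - G x y)\<bar> \<le> M * \<bar>s - x\<bar> * (b - a)" if "0 \<le> a" "a \<le> b" "b \<le> L" for a b
    proof -
      have "continuous_on {a..b} (\<lambda>y. G s y - G x y)"
        by (intro continuous_intros continuous_on_subset[OF cG[OF s]] continuous_on_subset[OF cG[OF x]])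
          (use that in auto)
      then show ?thesis
        using integral_bound[of a b "\<lambda>y. G s y - G x y" "M * \<bar>s - x\<bar>"] that lip[OF s] by simp
    qed
    show ?thesis
    proof (cases "x \<le> s")
      case True
      have "R s = integral {x..s} (\<lambda>y. G s y - G x y)"
        using Henstock_Kurzweil_Integration.integral_combine[OF _ True d[of 0 s]] x s by (simp add: R_def)
      then show ?thesis using b[of x s] True x s by simp
    next
      case False
      then have "s \<le> x" by simp
      have "R s = - integral {s..x} (\<lambda>y. G s y - G x y)"
        using Henstock_Kurzweil_Integration.integral_combine[OF _ \<open>s \<le> x\<close> d[of 0 x]] x s by (simp add: R_def)
      then show ?thesis using b[of s x] False x s by simp
    qed
  qed
  have dR: "(R has_real_derivative 0) (at x within {0..L})"
    unfolding has_field_derivative_iff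
  proof (rule Lim_null_comparison)
    have "((\<lambda>s. M * \<bar>s - x\<bar>) \<longlongrightarrow> M * \<bar>x - x\<bar>) (at x within {0..L})" by (intro tendsto_intros)
    then show "((\<lambda>s. M * \<bar>s - x\<bar>) \<longlongrightarrow> 0) (at x within {0..L})" by simp
    show "\<forall>\<^sub>F s in at x within {0..L}. norm ((R s - R x) / (s - x)) \<le> M * \<bar>s - x\<bar>"
      unfolding eventually_at_filter
    proof (intro always_eventually allI impI)
      fix s assume "s \<noteq> x" "s \<in> {0..L}"
      then show "norm ((R s - R x) / (s - x)) \<le> M * \<bar>s - x\<bar>"
        using R[of s] by (simp add: R_def[of x] abs_divide pos_divide_le_eq)
    qed
  qed
  have d1: "((\<lambda>s. integral (cbox 0 x) (G s)) has_real_derivative integral (cbox 0 x) (G' x)) (at x within {0..L})"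
  proof (rule leibniz_rule_field_derivative)
    show "((\<lambda>s. G s y) has_real_derivative G' s y) (at s within {0..L})"
      if "s \<in> {0..L}" "y \<in> cbox 0 x" for s y using that x by (intro dG) auto
    show "G s integrable_on cbox 0 x" if "s \<in> {0..L}" for s using that int x by auto
    show "continuous_on ({0..L} \<times> cbox 0 x) (\<lambda>(s, y). G' s y)"
      by (rule continuous_on_subset[OF cG']) (use x in auto)
  qed (use x in auto)
  have d2: "((\<lambda>s. integral {0..s} (G x)) has_real_derivative G x x) (at x within {0..L})"
    by (rule integral_has_real_derivative[OF cG[OF x] x])
  have "((\<lambda>s. integral (cbox 0 x) (G s) + integral {0..s} (G x) - integral {0..x} (G x) + R s)
      has_real_derivative integral (cbox 0 x) (G' x) + G x x - 0 + 0) (at x within {0..L})"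
    by (intro DERIV_add DERIV_diff d1 d2 dR DERIV_const)
  moreover have "integral (cbox 0 x) (G s) + integral {0..s} (G x) - integral {0..x} (G x) + R s = integral {0..s} (G s)"
    if "s \<in> {0..L}" for s
    using int[OF that, of 0 s] int[OF that, of 0 x] int[OF x, of 0 s] int[OF x, of 0 x] that x
    by (simp add: R_def Henstock_Kurzweil_Integration.integral_diff)
  ultimately show ?thesis
    using x by (auto intro: has_field_derivative_transform_within[where d=1] simp: add.commute)
qed

section \<open>Regularity of the extended kernel\<close>

text \<open>The extended kernel, its two partial derivatives, and the kernel extended by \<open>0\<close> instead,
  which is how it enters the right-hand side of the equation.\<close>

abbreviation kernel_ext_x :: "real \<Rightarrow> real \<Rightarrow> real \<Rightarrow> real" where
  "kernel_ext_x \<alpha> \<equiv> glue (kernel_x \<alpha>) (\<lambda>_. - (\<alpha> / 2))"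

abbreviation kernel_ext_y :: "real \<Rightarrow> real \<Rightarrow> real \<Rightarrow> real" where
  "kernel_ext_y \<alpha> \<equiv> glue (kernel_y \<alpha>) (\<lambda>_. 0)"

abbreviation kernel_ext_0 :: "real \<Rightarrow> real \<Rightarrow> real \<Rightarrow> real" where
  "kernel_ext_0 \<alpha> \<equiv> glue (bessel_kernel \<alpha>) (\<lambda>_. 0)"

abbreviation kernel_ext :: "real \<Rightarrow> real \<Rightarrow> real \<Rightarrow> real" where
  "kernel_ext \<alpha> \<equiv> glue (bessel_kernel \<alpha>) (\<lambda>x. - (\<alpha> * x / 2))"

lemma kext_kernel: "0 < y \<Longrightarrow> kext \<alpha> (bessel_kernel \<alpha>) x y = kernel_ext \<alpha> x y"
  by (simp add: kext_def glue_def)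

lemma kernel_continuous_UNIV:
  "continuous_on UNIV (\<lambda>z. bessel_kernel \<alpha> (fst z) (snd z))" "continuous_on UNIV (\<lambda>z. kernel_x \<alpha> (fst z) (snd z))"
  "continuous_on UNIV (\<lambda>z. kernel_y \<alpha> (fst z) (snd z))"
  by (intro continuous_intros)+

lemma cont_L2_kernel_ext:
  "cont_L2 L (kernel_ext_x \<alpha>)" "cont_L2 L (kernel_ext_y \<alpha>)" "cont_L2 L (kernel_ext_0 \<alpha>)" "cont_L2 L (kernel_ext \<alpha>)"
  by (intro glue_cont_L2 kernel_continuous_UNIV continuous_intros; simp)+

lemma in_L2_kernel_ext:
  assumes "x \<in> {0..L}"
  shows "in_L2 L (kernel_ext_x \<alpha> x)" "in_L2 L (kernel_ext_y \<alpha> x)" "in_L2 L (kernel_ext_0 \<alpha> x)" "in_L2 L (kernel_ext \<alpha> x)"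
  using cont_L2_kernel_ext[of L \<alpha>] assms unfolding cont_L2_def by auto

text \<open>The extended kernel is constant in \<open>y\<close> beyond the diagonal and continuous across it, so it has
  no jump there and \<open>kernel_ext_y\<close> is its weak derivative.\<close>

lemma kernel_ext_y_primitive:
  assumes x: "0 \<le> x" and y: "0 < y"
  shows "kernel_ext \<alpha> x y = bessel_kernel \<alpha> x 0 + integral {0..y} (kernel_ext_y \<alpha> x)"
proof -
  have ftc: "integral {0..z} (kernel_y \<alpha> x) = bessel_kernel \<alpha> x z - bessel_kernel \<alpha> x 0" if "0 \<le> z" for z
  proof -
    have "bessel_kernel \<alpha> x z = bessel_kernel \<alpha> x 0 + integral {0..z} (kernel_y \<alpha> x)"
      by (rule derivative_imp_integral[of z])
        (use that in \<open>auto intro: has_field_derivative_at_within kernel_derivatives(2)\<close>)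
    then show ?thesis by simp
  qed
  have int: "kernel_y \<alpha> x integrable_on {0..z}" for z
    by (intro integrable_continuous_real continuous_intros)
  show ?thesis
  proof (cases "y \<le> x")
    case True
    have "integral {0..y} (kernel_ext_y \<alpha> x) = integral {0..y} (kernel_y \<alpha> x)"
      by (rule integral_cong) (use True in \<open>auto simp: glue_def\<close>)
    then show ?thesis using ftc[of y] True y by (simp add: glue_def[of _ _ _ y])
  next
    case False
    have 1: "(kernel_ext_y \<alpha> x has_integral integral {0..x} (kernel_y \<alpha> x)) {0..x}"
      by (rule has_integral_eq[OF _ integrable_integral[OF int]]) (auto simp: glue_def)
    have 2: "(kernel_ext_y \<alpha> x has_integral 0) {x..y}"
      by (rule has_integral_spike_finite[of "{x}" _ _ "\<lambda>_. 0"]) (auto simp: glue_def)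
    have "integral {0..y} (kernel_ext_y \<alpha> x) = integral {0..x} (kernel_y \<alpha> x)"
      using has_integral_combine[OF x _ 1 2] False by (auto intro: integral_unique)
    then show ?thesis using ftc[OF x] False kernel_diagonal[of \<alpha> x] by (simp add: glue_def[of _ _ _ y])
  qed
qed

lemma cont_H1_kext_kernel:
  assumes L: "L > 0"
  shows "cont_H1 L (kext \<alpha> (bessel_kernel \<alpha>)) (kernel_ext_y \<alpha>)"
  unfolding cont_H1_def
proof (intro ballI conjI)
  fix x assume x: "x \<in> {0..L}"
  show "in_H1 L (kext \<alpha> (bessel_kernel \<alpha>) x) (kernel_ext_y \<alpha> x)"
    unfolding in_H1_def
  proof (intro conjI)
    show "in_L2 L (kext \<alpha> (bessel_kernel \<alpha>) x)"
      using in_L2_kernel_ext(4)[OF x] by (simp cong: in_L2_cong add: kext_kernel)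
    show "in_L2 L (kernel_ext_y \<alpha> x)" by (rule in_L2_kernel_ext(2)[OF x])
    then show "has_weak_deriv L (kext \<alpha> (bessel_kernel \<alpha>) x) (kernel_ext_y \<alpha> x)"
      using L x by (intro has_weak_deriv_indefinite_integral[where c="bessel_kernel \<alpha> x 0"])
        (auto simp: in_L2_iff_absolutely_integrable kext_kernel kernel_ext_y_primitive)
  qed
  have "((\<lambda>s. sqrt ((L2_norm L (\<lambda>y. kernel_ext \<alpha> s y - kernel_ext \<alpha> x y))\<^sup>2
      + (L2_norm L (\<lambda>y. kernel_ext_y \<alpha> s y - kernel_ext_y \<alpha> x y))\<^sup>2)) \<longlongrightarrow> sqrt (0\<^sup>2 + 0\<^sup>2)) (at x within {0..L})"
    using cont_L2_kernel_ext(4,2)[of L \<alpha>] x by (intro tendsto_intros) (auto simp: cont_L2_def)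
  moreover have "L2_norm L (\<lambda>y. kernel_ext \<alpha> s y - kernel_ext \<alpha> x y)
      = L2_norm L (\<lambda>y. kext \<alpha> (bessel_kernel \<alpha>) s y - kext \<alpha> (bessel_kernel \<alpha>) x y)" for s
    by (rule L2_norm_cong) (simp add: kext_kernel)
  ultimately show "((\<lambda>s. H1_norm L (\<lambda>y. kext \<alpha> (bessel_kernel \<alpha>) s y - kext \<alpha> (bessel_kernel \<alpha>) x y)
      (\<lambda>y. kernel_ext_y \<alpha> s y - kernel_ext_y \<alpha> x y)) \<longlongrightarrow> 0) (at x within {0..L})"
    by (simp add: H1_norm_def)
qed

text \<open>The Lipschitz bound in \<open>x\<close> dominates the difference quotients, whose pointwise limit exists
  off the diagonal. When $x<y\le s$ the segment from \<open>x\<close> to \<open>s\<close> is split at the diagonal.\<close>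

lemma kernel_ext_lipschitz:
  "\<exists>M. \<forall>x s y. 0 \<le> x \<and> x \<le> L \<and> 0 \<le> s \<and> s \<le> L \<and> 0 \<le> y \<and> y \<le> L \<longrightarrow>
    \<bar>kernel_ext \<alpha> s y - kernel_ext \<alpha> x y\<bar> \<le> M * \<bar>s - x\<bar>"
proof -
  obtain B where B: "\<And>x y. 0 \<le> x \<and> x \<le> L \<and> 0 \<le> y \<and> y \<le> L \<Longrightarrow> \<bar>kernel_x \<alpha> x y\<bar> \<le> B"
    using glue_bounded[OF kernel_continuous_UNIV(2) continuous_on_const, of L \<alpha> 0] by blast
  define M where "M = max B (\<bar>\<alpha>\<bar> / 2)"
  have lip1: "\<bar>bessel_kernel \<alpha> s y - bessel_kernel \<alpha> x y\<bar> \<le> M * \<bar>s - x\<bar>"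
    if "0 \<le> s" "s \<le> L" "0 \<le> x" "x \<le> L" "0 \<le> y" "y \<le> L" for s x y
  proof -
    have "norm (bessel_kernel \<alpha> s y - bessel_kernel \<alpha> x y) \<le> M * norm (s - x)"
    proof (rule field_differentiable_bound[of "{0..L}" "\<lambda>s. bessel_kernel \<alpha> s y" "\<lambda>s. kernel_x \<alpha> s y"])
      show "((\<lambda>s. bessel_kernel \<alpha> s y) has_field_derivative kernel_x \<alpha> z y) (at z within {0..L})" for z
        by (rule has_field_derivative_at_within[OF kernel_derivatives(1)])
      show "norm (kernel_x \<alpha> z y) \<le> M" if "z \<in> {0..L}" for z
        using B[of z y] that \<open>0 \<le> y\<close> \<open>y \<le> L\<close> by (simp add: M_def le_max_iff_disj)
    qed (use that in auto)
    then show ?thesis by simp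
  qed
  have lip2: "\<bar>\<alpha> * x / 2 - \<alpha> * s / 2\<bar> \<le> M * \<bar>s - x\<bar>" for s x
  proof -
    have "\<alpha> * x / 2 - \<alpha> * s / 2 = \<alpha> / 2 * (x - s)" by (simp add: algebra_simps)
    then have "\<bar>\<alpha> * x / 2 - \<alpha> * s / 2\<bar> = \<bar>\<alpha>\<bar> / 2 * \<bar>s - x\<bar>"
      by (simp only: abs_mult abs_divide abs_minus_commute)
    also have "\<dots> \<le> M * \<bar>s - x\<bar>" by (intro mult_right_mono) (auto simp: M_def)
    finally show ?thesis .
  qed
  have main: "\<bar>kernel_ext \<alpha> s y - kernel_ext \<alpha> x y\<bar> \<le> M * \<bar>s - x\<bar>"
    if "0 \<le> x" "x \<le> s" "s \<le> L" "0 \<le> y" "y \<le> L" for s x y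
  proof -
    consider "y \<le> x" | "s < y" | "x < y" "y \<le> s" by linarith
    then show ?thesis
    proof cases
      case 1 then show ?thesis using lip1[of s x y] that by (simp add: glue_def)
    next
      case 2 then show ?thesis using lip2[of s x] that by (simp add: glue_def)
    next
      case 3
      have "\<bar>kernel_ext \<alpha> s y - kernel_ext \<alpha> x y\<bar>
          = \<bar>(bessel_kernel \<alpha> s y - bessel_kernel \<alpha> y y) + (\<alpha> * x / 2 - \<alpha> * y / 2)\<bar>"
        using 3 by (simp add: glue_def kernel_diagonal)
      also have "\<dots> \<le> M * \<bar>s - y\<bar> + M * \<bar>y - x\<bar>"
        using lip2[where s=y and x=x] that
        by (intro order_trans[OF abs_triangle_ineq] add_mono lip1) auto
      also have "\<dots> = M * \<bar>s - x\<bar>" using 3 by (simp add: algebra_simps)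
      finally show ?thesis .
    qed
  qed
  have "\<bar>kernel_ext \<alpha> s y - kernel_ext \<alpha> x y\<bar> \<le> M * \<bar>s - x\<bar>"
    if "0 \<le> x" "x \<le> L" "0 \<le> s" "s \<le> L" "0 \<le> y" "y \<le> L" for s x y
    using main[of x s y] main[of s x y] that by (cases "x \<le> s") (simp_all add: abs_minus_commute)
  then show ?thesis by blast
qed

lemma has_L2_deriv_kext_kernel:
  "has_L2_deriv L (kext \<alpha> (bessel_kernel \<alpha>)) (kernel_ext_x \<alpha>)"
  unfolding has_L2_deriv_def
proof
  fix x assume x: "x \<in> {0..L}"
  let ?h = "\<lambda>s y. (kernel_ext \<alpha> s y - kernel_ext \<alpha> x y) / (s - x) - kernel_ext_x \<alpha> x y"
  obtain M where M: "\<And>x s y. 0 \<le> x \<and> x \<le> L \<and> 0 \<le> s \<and> s \<le> L \<and> 0 \<le> y \<and> y \<le> L \<Longrightarrow>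
    \<bar>kernel_ext \<alpha> s y - kernel_ext \<alpha> x y\<bar> \<le> M * \<bar>s - x\<bar>"
    using kernel_ext_lipschitz[of L \<alpha>] by blast
  obtain B where B: "\<And>x y. 0 \<le> x \<and> x \<le> L \<and> 0 \<le> y \<and> y \<le> L \<Longrightarrow> \<bar>kernel_ext_x \<alpha> x y\<bar> \<le> B"
    using glue_bounded[OF kernel_continuous_UNIV(2) continuous_on_const, of L] by blast
  have "((\<lambda>s. L2_norm L (?h s)) \<longlongrightarrow> 0) (at x within {0..L})"
  proof (rule L2_norm_tendsto_0[where B="M + B"])
    fix s assume s: "s \<in> {0..L}" "s \<noteq> x"
    have "in_L2 L (\<lambda>y. 1 / (s - x) * (kernel_ext \<alpha> s y - kernel_ext \<alpha> x y) - kernel_ext_x \<alpha> x y)"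
      using s x by (intro in_L2_diff in_L2_cmult in_L2_kernel_ext) auto
    then show "set_borel_measurable lebesgue {0<..<L} (?h s)" by (simp add: in_L2_def)
    fix y assume y: "0 < y" "y < L"
    have "\<bar>(kernel_ext \<alpha> s y - kernel_ext \<alpha> x y) / (s - x)\<bar> \<le> M"
      using M[of x s y] s x y by (simp add: abs_divide pos_divide_le_eq)
    moreover have "\<bar>kernel_ext_x \<alpha> x y\<bar> \<le> B" using B[of x y] x y by simp
    ultimately show "\<bar>?h s y\<bar> \<le> M + B" by linarith
  next
    fix y assume y: "0 < y" "y < L" "y \<noteq> x"
    have "((\<lambda>s. kernel_ext \<alpha> s y) has_real_derivative kernel_ext_x \<alpha> x y) (at x within {0..L})"
    proof (cases "y < x")
      case True
      have "((\<lambda>s. bessel_kernel \<alpha> s y) has_real_derivative kernel_x \<alpha> x y) (at x within {0..L})"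
        using kernel_derivatives(1) by (rule has_field_derivative_at_within)
      then have "((\<lambda>s. kernel_ext \<alpha> s y) has_real_derivative kernel_x \<alpha> x y) (at x within {0..L})"
        by (rule has_field_derivative_transform_within[where d="x - y"])
          (use True x in \<open>auto simp: glue_def dist_real_def\<close>)
      then show ?thesis using True by (simp add: glue_def[of _ _ x])
    next
      case False
      have "((\<lambda>s. - (\<alpha> * s / 2)) has_real_derivative - (\<alpha> / 2)) (at x within {0..L})"
        by (auto intro!: derivative_eq_intros)
      then have "((\<lambda>s. kernel_ext \<alpha> s y) has_real_derivative - (\<alpha> / 2)) (at x within {0..L})"
        by (rule has_field_derivative_transform_within[where d="y - x"])
          (use False x y in \<open>auto simp: glue_def dist_real_def\<close>)
      then show ?thesis using False y by (simp add: glue_def[of _ _ x])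
    qed
    then show "((\<lambda>s. ?h s y) \<longlongrightarrow> 0) (at x within {0..L})"
      unfolding has_field_derivative_iff by (rule LIM_zero)
  qed
  moreover have "L2_norm L (?h s) = L2_norm L (\<lambda>y. (kext \<alpha> (bessel_kernel \<alpha>) s y - kext \<alpha> (bessel_kernel \<alpha>) x y) / (s - x) - kernel_ext_x \<alpha> x y)" for s
    by (rule L2_norm_cong) (simp add: kext_kernel)
  ultimately show "((\<lambda>s. L2_norm L (\<lambda>y. (kext \<alpha> (bessel_kernel \<alpha>) s y - kext \<alpha> (bessel_kernel \<alpha>) x y) / (s - x)
      - kernel_ext_x \<alpha> x y)) \<longlongrightarrow> 0) (at x within {0..L})" by simp
qed

section \<open>The weak equation for the explicit kernel\<close>

lemma L2_functional_glue_0: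
  assumes x: "x \<le> L" and i: "(\<lambda>y. g x y * v y) absolutely_integrable_on {0<..<x}"
  shows "L2_functional L (glue g (\<lambda>_. 0) x) v = integral {0..x} (\<lambda>y. g x y * v y)"
  unfolding L2_functional_def LINT_glue_0[OF x] by (rule LINT_open_eq_integral[OF i])

text \<open>The Leibniz rule produces the boundary term $\partial_xk(x,x)v(x)$; replacing $\partial_{xx}k$ by
  $\partial_{yy}k+\alpha k$ and integrating by parts in \<open>y\<close> produces $\partial_yk(x,x)v(x)$ and, by
  $\partial_yk(x,0)=0$, nothing at \<open>y = 0\<close>. The two boundary terms add up to
  $-\frac\alpha2v(x)$.\<close>

lemma kernel_moment_derivative:
  assumes L: "L > 0" and v: "in_H1 L v v'" and cv: "continuous_on {0..L} v" and x: "x \<in> {0..L}"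
  shows "((\<lambda>s. integral {0..s} (\<lambda>y. kernel_x \<alpha> s y * v y)) has_real_derivative
      - (\<alpha> / 2) * v x - L2_functional L (kernel_ext_y \<alpha> x) v' + \<alpha> * L2_functional L (kernel_ext_0 \<alpha> x) v)
    (at x within {0..L})"
proof -
  have ckv: "continuous_on {0..x} (\<lambda>y. g y * v y)" if "continuous_on UNIV g" for g :: "real \<Rightarrow> real"
    using x by (intro continuous_intros continuous_on_subset[OF that] continuous_on_subset[OF cv]) auto
  have cyy: "continuous_on UNIV (kernel_yy \<alpha> x)" and c0: "continuous_on UNIV (bessel_kernel \<alpha> x)"
    and cy: "continuous_on UNIV (kernel_y \<alpha> x)" by (intro continuous_intros)+
  have v'a: "v' absolutely_integrable_on {0..L}"
    using v by (auto simp: in_H1_def in_L2_iff_absolutely_integrable absolutely_integrable_on_Icc_iff_Ioo)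
  have v'x: "v' absolutely_integrable_on {0..x}"
    using v'a x by (intro absolutely_integrable_on_subinterval[OF v'a]) auto
  have deriv: "((\<lambda>s. integral {0..s} (\<lambda>y. kernel_x \<alpha> s y * v y)) has_real_derivative
      kernel_x \<alpha> x x * v x + integral {0..x} (\<lambda>y. kernel_xx \<alpha> x y * v y)) (at x within {0..L})"
  proof (rule leibniz_rule_moving_endpoint[OF _ _ _ x])
    fix s y assume "s \<in> {0..L}"
    show "((\<lambda>s. kernel_x \<alpha> s y * v y) has_real_derivative kernel_xx \<alpha> s y * v y) (at s within {0..L})"
      by (rule DERIV_cmult_right[OF has_field_derivative_at_within[OF kernel_derivatives(3)]])
    show "continuous_on {0..L} (\<lambda>y. kernel_x \<alpha> s y * v y)" by (intro continuous_intros cv)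
  next
    show "continuous_on ({0..L} \<times> {0..L}) (\<lambda>(s, y). kernel_xx \<alpha> s y * v y)"
      unfolding split_beta by (intro continuous_intros continuous_on_compose2[OF cv]) auto
  qed
  moreover have "integral {0..x} (\<lambda>y. kernel_xx \<alpha> x y * v y)
      = integral {0..x} (\<lambda>y. kernel_yy \<alpha> x y * v y) + \<alpha> * integral {0..x} (\<lambda>y. bessel_kernel \<alpha> x y * v y)"
  proof -
    have "(\<lambda>y. kernel_xx \<alpha> x y * v y) = (\<lambda>y. kernel_yy \<alpha> x y * v y + \<alpha> * (bessel_kernel \<alpha> x y * v y))"
      by (simp add: kernel_wave_equation algebra_simps)
    then show ?thesis
      using ckv[OF cyy] ckv[OF c0]
      by (simp add: Henstock_Kurzweil_Integration.integral_add integrable_continuous_real integrable_on_mult_right)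
  qed
  moreover have "integral {0..x} (\<lambda>y. v' y * kernel_y \<alpha> x y) + integral {0..x} (\<lambda>y. v y * kernel_yy \<alpha> x y)
      = v x * kernel_y \<alpha> x x - v 0 * kernel_y \<alpha> x 0"
  proof (rule integral_by_parts_absolutely_continuous[OF _ v'x])
    show "kernel_yy \<alpha> x absolutely_integrable_on {0..x}"
      by (intro absolutely_integrable_continuous_real continuous_intros)
    show "v y = v 0 + integral {0..y} v'" if "0 \<le> y" "y \<le> x" for y
      using that x by (intro in_H1_continuous_representation[OF L v cv]) auto
    show "kernel_y \<alpha> x y = kernel_y \<alpha> x 0 + integral {0..y} (kernel_yy \<alpha> x)" if "0 \<le> y" "y \<le> x" for y
      using that kernel_derivatives(4)
      by (intro derivative_imp_integral[of x]) (auto intro: has_field_derivative_at_within)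
  qed (use x in auto)
  moreover have "L2_functional L (kernel_ext_y \<alpha> x) v' = integral {0..x} (\<lambda>y. kernel_y \<alpha> x y * v' y)"
    using x by (intro L2_functional_glue_0)
      (auto simp: absolutely_integrable_on_Icc_iff_Ioo[symmetric]
        intro!: absolutely_integrable_continuous_mult v'x continuous_on_subset[OF cy])
  moreover have "L2_functional L (kernel_ext_0 \<alpha> x) v = integral {0..x} (\<lambda>y. bessel_kernel \<alpha> x y * v y)"
    using x by (intro L2_functional_glue_0 continuous_imp_absolutely_integrable_Ioo ckv[OF c0]) auto
  moreover have "kernel_x \<alpha> x x * v x + kernel_y \<alpha> x x * v x = - (\<alpha> / 2) * v x"
    by (simp only: kernel_gradient_diagonal distrib_right[symmetric])
  ultimately have "kernel_x \<alpha> x x * v x + integral {0..x} (\<lambda>y. kernel_xx \<alpha> x y * v y)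
      = - (\<alpha> / 2) * v x - L2_functional L (kernel_ext_y \<alpha> x) v' + \<alpha> * L2_functional L (kernel_ext_0 \<alpha> x) v"
    by (simp add: mult.commute)
  with deriv show ?thesis by simp
qed

text \<open>The inner integral \<open>P\<close> is continuously differentiable with the derivative just computed.
  Integrating \<open>P'\<close> against \<open>w\<close> by parts is the weak equation.\<close>

lemma kernel_weak_form_kernel: "kernel_weak_form \<alpha> (bessel_kernel \<alpha>) (kernel_ext_x \<alpha>) (kernel_ext_y \<alpha>)"
  unfolding kernel_weak_form_def
proof (intro allI impI)
  fix L :: real and v v' w w' :: "real \<Rightarrow> real"
  assume L: "L > 0"
  assume "in_H1 L v v' \<and> continuous_on {0..L} v \<and> in_H1 L w w' \<and> continuous_on {0..L} w"
  then have v: "in_H1 L v v'" and cv: "continuous_on {0..L} v"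
    and w: "in_H1 L w w'" and cw: "continuous_on {0..L} w" by auto
  define P where "P x = integral {0..x} (\<lambda>y. kernel_x \<alpha> x y * v y)" for x
  define Q where "Q x = L2_functional L (kernel_ext_y \<alpha> x) v'" for x
  define M where "M x = L2_functional L (kernel_ext_0 \<alpha> x) v" for x
  define P' where "P' x = - (\<alpha> / 2) * v x - Q x + \<alpha> * M x" for x
  have dP: "(P has_real_derivative P' x) (at x within {0..L})" if "0 \<le> x" "x \<le> L" for x
    unfolding P_def P'_def Q_def M_def using that by (intro kernel_moment_derivative[OF L v cv]) auto
  have cQ: "continuous_on {0..L} Q" and cM: "continuous_on {0..L} M"
    unfolding Q_def M_def using v
    by (auto intro!: continuous_on_L2_functional cont_L2_kernel_ext simp: in_H1_def)
  then have cP': "continuous_on {0..L} P'" unfolding P'_def by (intro continuous_intros cv)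
  have cP: "continuous_on {0..L} P" using dP by (auto intro!: DERIV_continuous_on)
  have w'a: "w' absolutely_integrable_on {0..L}"
    using w by (auto simp: in_H1_def in_L2_iff_absolutely_integrable absolutely_integrable_on_Icc_iff_Ioo)
  have parts: "integral {0..L} (\<lambda>x. w' x * P x) + integral {0..L} (\<lambda>x. w x * P' x) = w L * P L - w 0 * P 0"
  proof (rule integral_by_parts_absolutely_continuous[OF _ w'a])
    show "P' absolutely_integrable_on {0..L}" by (rule absolutely_integrable_continuous_real[OF cP'])
    show "w y = w 0 + integral {0..y} w'" if "0 \<le> y" "y \<le> L" for y
      using that by (intro in_H1_continuous_representation[OF L w cw])
    show "P y = P 0 + integral {0..y} P'" if "0 \<le> y" "y \<le> L" for y
      using that dP by (intro derivative_imp_integral[of L])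
  qed (use L in auto)
  have ePx: "(LINT y:{0<..<x}|lebesgue. kernel_ext_x \<alpha> x y * v y) = P x" if "0 \<le> x" "x \<le> L" for x
  proof -
    have "(LINT y:{0<..<x}|lebesgue. kernel_ext_x \<alpha> x y * v y) = (LINT y:{0<..<x}|lebesgue. kernel_x \<alpha> x y * v y)"
      by (rule set_lebesgue_integral_cong) (auto simp: glue_def)
    also have "\<dots> = P x" unfolding P_def using that
      by (intro LINT_open_eq_integral continuous_imp_absolutely_integrable_Ioo continuous_intros
          continuous_on_subset[OF cv]) auto
    finally show ?thesis .
  qed
  have eQx: "(LINT y:{0<..<x}|lebesgue. kernel_ext_y \<alpha> x y * v' y) = Q x" if "0 \<le> x" "x \<le> L" for x
  proof -
    have "(LINT y:{0<..<x}|lebesgue. kernel_ext_y \<alpha> x y * v' y) = (LINT y:{0<..<x}|lebesgue. kernel_y \<alpha> x y * v' y)"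
      by (rule set_lebesgue_integral_cong) (auto simp: glue_def)
    then show ?thesis unfolding Q_def L2_functional_def LINT_glue_0[OF that(2)] .
  qed
  have eMx: "(LINT y:{0<..<x}|lebesgue. bessel_kernel \<alpha> x y * v y) = M x" if "0 \<le> x" "x \<le> L" for x
    unfolding M_def L2_functional_def LINT_glue_0[OF that(2)] ..
  have cont_LINT: "(LINT x:{0<..<L}|lebesgue. f x) = integral {0..L} f" if "continuous_on {0..L} f" for f :: "real \<Rightarrow> real"
    by (intro LINT_open_eq_integral continuous_imp_absolutely_integrable_Ioo that)
  have I1: "(LINT x:{0<..<L}|lebesgue. (LINT y:{0<..<x}|lebesgue. kernel_ext_x \<alpha> x y * v y) * w' x)
      = integral {0..L} (\<lambda>x. w' x * P x)"
  proof -
    have "(LINT x:{0<..<L}|lebesgue. (LINT y:{0<..<x}|lebesgue. kernel_ext_x \<alpha> x y * v y) * w' x)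
      = (LINT x:{0<..<L}|lebesgue. P x * w' x)"
      by (rule set_lebesgue_integral_cong) (auto simp: ePx)
    also have "\<dots> = integral {0..L} (\<lambda>x. P x * w' x)"
      by (intro LINT_open_eq_integral)
        (simp add: absolutely_integrable_on_Icc_iff_Ioo[symmetric] absolutely_integrable_continuous_mult[OF cP w'a])
    finally show ?thesis by (simp add: mult.commute)
  qed
  have I2: "(LINT x:{0<..<L}|lebesgue. (LINT y:{0<..<x}|lebesgue. kernel_ext_y \<alpha> x y * v' y) * w x)
      = integral {0..L} (\<lambda>x. Q x * w x)"
  proof -
    have "(LINT x:{0<..<L}|lebesgue. (LINT y:{0<..<x}|lebesgue. kernel_ext_y \<alpha> x y * v' y) * w x)
      = (LINT x:{0<..<L}|lebesgue. Q x * w x)"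
      by (rule set_lebesgue_integral_cong) (auto simp: eQx)
    then show ?thesis by (simp add: cont_LINT continuous_intros cQ cw)
  qed
  have I3: "(LINT x:{0<..<L}|lebesgue. (LINT y:{0<..<x}|lebesgue. bessel_kernel \<alpha> x y * v y) * w x)
      = integral {0..L} (\<lambda>x. M x * w x)"
  proof -
    have "(LINT x:{0<..<L}|lebesgue. (LINT y:{0<..<x}|lebesgue. bessel_kernel \<alpha> x y * v y) * w x)
      = (LINT x:{0<..<L}|lebesgue. M x * w x)"
      by (rule set_lebesgue_integral_cong) (auto simp: eMx)
    then show ?thesis by (simp add: cont_LINT continuous_intros cM cw)
  qed
  have I4: "(LINT x:{0<..<L}|lebesgue. v x * w x) = integral {0..L} (\<lambda>x. v x * w x)"
    by (intro cont_LINT continuous_intros cv cw)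
  have "(\<lambda>x. w x * P' x) = (\<lambda>x. - (\<alpha> / 2) * (v x * w x) - Q x * w x + \<alpha> * (M x * w x))"
    by (auto simp: P'_def algebra_simps)
  moreover have "integral {0..L} (\<lambda>x. - (\<alpha> / 2) * (v x * w x) - Q x * w x + \<alpha> * (M x * w x))
      = - (\<alpha> / 2) * integral {0..L} (\<lambda>x. v x * w x) - integral {0..L} (\<lambda>x. Q x * w x)
        + \<alpha> * integral {0..L} (\<lambda>x. M x * w x)"
  proof -
    have "((\<lambda>x. - (\<alpha> / 2) * (v x * w x) - Q x * w x + \<alpha> * (M x * w x)) has_integral
        - (\<alpha> / 2) * integral {0..L} (\<lambda>x. v x * w x) - integral {0..L} (\<lambda>x. Q x * w x)
        + \<alpha> * integral {0..L} (\<lambda>x. M x * w x)) {0..L}"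
      by (intro has_integral_add has_integral_diff has_integral_mult_right integrable_integral
          integrable_continuous_real continuous_intros cv cw cQ cM)
    then show ?thesis by (rule integral_unique)
  qed
  ultimately have "integral {0..L} (\<lambda>x. w x * P' x) = - (\<alpha> / 2) * integral {0..L} (\<lambda>x. v x * w x)
      - integral {0..L} (\<lambda>x. Q x * w x) + \<alpha> * integral {0..L} (\<lambda>x. M x * w x)" by simp
  with parts have "integral {0..L} (\<lambda>x. w' x * P x) - \<alpha> / 2 * integral {0..L} (\<lambda>x. v x * w x)
      - integral {0..L} (\<lambda>x. Q x * w x) + \<alpha> * integral {0..L} (\<lambda>x. M x * w x) = w L * P L"
    by (simp add: P_def[of 0])
  then show "- (LINT x:{0<..<L}|lebesgue. (LINT y:{0<..<x}|lebesgue. kernel_ext_x \<alpha> x y * v y) * w' x)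
     + w L * (LINT y:{0<..<L}|lebesgue. kernel_ext_x \<alpha> L y * v y)
     + (LINT x:{0<..<L}|lebesgue. (LINT y:{0<..<x}|lebesgue. kernel_ext_y \<alpha> x y * v' y) * w x)
     = \<alpha> * (LINT x:{0<..<L}|lebesgue. (LINT y:{0<..<x}|lebesgue. bessel_kernel \<alpha> x y * v y) * w x)
       - \<alpha> / 2 * (LINT x:{0<..<L}|lebesgue. v x * w x)"
    unfolding I1 I2 I3 I4 using ePx[of L] L by simp
qed

section \<open>The second derivative with values in the dual of $H^1(0,L)$\<close>

lemma in_H1_zero: "in_H1 L (\<lambda>_. 0) (\<lambda>_. 0)"
  by (auto simp: in_H1_def has_weak_deriv_def intro!: in_L2_continuous)

text \<open>A bound on the functional bounds the supremum that defines its norm. The zero function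
  shows that this supremum is not over the empty set, whose supremum has no specified value.\<close>

lemma H1_dual_norm_bounds:
  assumes b: "\<And>v v'. in_H1 L v v' \<Longrightarrow> \<bar>\<Lambda> v\<bar> \<le> B * H1_norm L v v'" and B: "0 \<le> B"
  shows "0 \<le> H1_dual_norm L \<Lambda>" "H1_dual_norm L \<Lambda> \<le> B"
proof -
  let ?S = "{\<bar>\<Lambda> v\<bar> | v v'. in_H1 L v v' \<and> H1_norm L v v' \<le> 1}"
  have "H1_norm L (\<lambda>_. 0) (\<lambda>_. 0) = 0" by (simp add: H1_norm_def L2_norm_def)
  then have mem: "\<bar>\<Lambda> (\<lambda>_. 0)\<bar> \<in> ?S" using in_H1_zero[of L] by force
  have le: "z \<le> B" if "z \<in> ?S" for z
  proof -
    from that obtain v v' where v: "z = \<bar>\<Lambda> v\<bar>" "in_H1 L v v'" "H1_norm L v v' \<le> 1" by blast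
    have "z \<le> B * H1_norm L v v'" using b v by simp
    also have "\<dots> \<le> B * 1" using v(3) B by (rule mult_left_mono)
    finally show ?thesis by simp
  qed
  show "H1_dual_norm L \<Lambda> \<le> B" unfolding H1_dual_norm_def using mem le by (intro cSup_least) auto
  have "bdd_above ?S" using le by (rule bdd_aboveI)
  then have "\<bar>\<Lambda> (\<lambda>_. 0)\<bar> \<le> H1_dual_norm L \<Lambda>" unfolding H1_dual_norm_def using mem by (intro cSup_upper)
  then show "0 \<le> H1_dual_norm L \<Lambda>" by linarith
qed

text \<open>For the extended kernel the part beyond the diagonal contributes $-\frac\alpha2\int_x^Lv$ to the
  pairing, whose derivative $\frac\alpha2v(x)$ cancels the last boundary term. What remains depends on \<open>v\<close>
  only through the pairings of \<open>v\<close> and \<open>v'\<close> with $L^2$ functions; this is why the second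
  derivative in \<open>x\<close> is a functional on $H^1(0,L)$.\<close>

lemma kernel_functional_derivative:
  assumes L: "L > 0" and v: "in_H1 L v v'" and x: "x \<in> {0..L}"
  shows "((\<lambda>s. L2_functional L (kernel_ext_x \<alpha> s) v) has_real_derivative
      \<alpha> * L2_functional L (kernel_ext_0 \<alpha> x) v - L2_functional L (kernel_ext_y \<alpha> x) v') (at x within {0..L})"
proof -
  obtain w where w: "in_H1 L w v'" and cw: "continuous_on {0..L} w"
    and ae: "AE y in lebesgue. 0 < y \<and> y < L \<longrightarrow> v y = w y"
    using in_H1_continuous_representative[OF L v] .
  have eq: "L2_functional L f v = L2_functional L f w" if "in_L2 L f" for f
    using that v w ae by (intro L2_functional_cong_AE) (auto simp: in_H1_def)
  have split: "L2_functional L (kernel_ext_x \<alpha> s) w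
      = integral {0..s} (\<lambda>y. kernel_x \<alpha> s y * w y) - (\<alpha> / 2) * (integral {0..L} w - integral {0..s} w)"
    if s: "s \<in> {0..L}" for s
  proof -
    have iw: "w integrable_on {a..b}" if "0 \<le> a" "b \<le> L" for a b
      using that by (intro integrable_continuous_real continuous_on_subset[OF cw]) auto
    have "(\<lambda>y. kernel_x \<alpha> s y * w y) integrable_on {0..s}"
      using s by (intro integrable_continuous_real continuous_intros continuous_on_subset[OF cw]) auto
    then have 1: "((\<lambda>y. kernel_ext_x \<alpha> s y * w y) has_integral integral {0..s} (\<lambda>y. kernel_x \<alpha> s y * w y)) {0..s}"
      by (rule has_integral_eq[OF _ integrable_integral, rotated]) (auto simp: glue_def)
    have "((\<lambda>y. - (\<alpha> / 2) * w y) has_integral - (\<alpha> / 2) * integral {s..L} w) {s..L}"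
      using iw s by (intro has_integral_mult_right integrable_integral) auto
    then have 2: "((\<lambda>y. kernel_ext_x \<alpha> s y * w y) has_integral - (\<alpha> / 2) * integral {s..L} w) {s..L}"
      by (rule has_integral_spike_finite[of "{s}", rotated 2]) (auto simp: glue_def)
    have "integral {0..L} (\<lambda>y. kernel_ext_x \<alpha> s y * w y)
        = integral {0..s} (\<lambda>y. kernel_x \<alpha> s y * w y) + - (\<alpha> / 2) * integral {s..L} w"
      using s by (intro integral_unique has_integral_combine[OF _ _ 1 2]) auto
    moreover have "integral {0..s} w + integral {s..L} w = integral {0..L} w"
      using s iw by (intro Henstock_Kurzweil_Integration.integral_combine) auto
    then have "integral {s..L} w = integral {0..L} w - integral {0..s} w" by simp
    moreover have "L2_functional L (kernel_ext_x \<alpha> s) w = integral {0..L} (\<lambda>y. kernel_ext_x \<alpha> s y * w y)"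
      unfolding L2_functional_def using s w
      by (intro LINT_open_eq_integral in_L2_mult in_L2_kernel_ext) (auto simp: in_H1_def)
    ultimately show ?thesis by simp
  qed
  have d1: "((\<lambda>s. integral {0..s} w) has_real_derivative w x) (at x within {0..L})"
    by (rule integral_has_real_derivative[OF cw x])
  have "((\<lambda>s. integral {0..s} (\<lambda>y. kernel_x \<alpha> s y * w y) - (\<alpha> / 2) * (integral {0..L} w - integral {0..s} w))
      has_real_derivative (- (\<alpha> / 2) * w x - L2_functional L (kernel_ext_y \<alpha> x) v'
        + \<alpha> * L2_functional L (kernel_ext_0 \<alpha> x) w) - (\<alpha> / 2) * (0 - w x)) (at x within {0..L})"
    by (intro DERIV_diff DERIV_cmult DERIV_const d1 kernel_moment_derivative[OF L w cw x])
  then have "((\<lambda>s. integral {0..s} (\<lambda>y. kernel_x \<alpha> s y * w y) - (\<alpha> / 2) * (integral {0..L} w - integral {0..s} w))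
      has_real_derivative \<alpha> * L2_functional L (kernel_ext_0 \<alpha> x) v - L2_functional L (kernel_ext_y \<alpha> x) v')
      (at x within {0..L})"
    using eq[OF in_L2_kernel_ext(3)[OF x]] by (simp add: algebra_simps)
  then show ?thesis
    by (rule has_field_derivative_transform_within[where d=1])
      (use x split eq in_L2_kernel_ext in auto)
qed

text \<open>The second derivative in \<open>x\<close>. Defining it by differentiation makes its values independent
  of the choice of a weak derivative \<open>v'\<close> and its linearity a property of derivatives.\<close>

definition kernel_flux :: "real \<Rightarrow> real \<Rightarrow> real \<Rightarrow> (real \<Rightarrow> real) \<Rightarrow> real" where
  "kernel_flux \<alpha> L x v = vector_derivative (\<lambda>s. L2_functional L (kernel_ext_x \<alpha> s) v) (at x within {0..L})"

lemma kernel_flux_eqI: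
  assumes "L > 0" "x \<in> {0..L}"
    "((\<lambda>s. L2_functional L (kernel_ext_x \<alpha> s) v) has_real_derivative d) (at x within {0..L})"
  shows "kernel_flux \<alpha> L x v = d"
  using assms vector_derivative_within_cbox[of 0 L x "\<lambda>s. L2_functional L (kernel_ext_x \<alpha> s) v" d]
  by (simp add: kernel_flux_def has_real_derivative_iff_has_vector_derivative)

lemma kernel_flux_eq:
  assumes "L > 0" "in_H1 L v v'" "x \<in> {0..L}"
  shows "kernel_flux \<alpha> L x v = \<alpha> * L2_functional L (kernel_ext_0 \<alpha> x) v - L2_functional L (kernel_ext_y \<alpha> x) v'"
  using assms by (intro kernel_flux_eqI kernel_functional_derivative)

lemma functional_pair_bound:
  assumes f: "in_L2 L f" and g: "in_L2 L g" and v: "in_H1 L v v'"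
  shows "\<bar>\<alpha> * L2_functional L f v - L2_functional L g v'\<bar> \<le> (\<bar>\<alpha>\<bar> * L2_norm L f + L2_norm L g) * H1_norm L v v'"
proof -
  have "\<bar>L2_functional L f v\<bar> \<le> L2_norm L f * H1_norm L v v'"
    using L2_functional_bound[OF f, of v] v
    by (intro order_trans[OF _ mult_left_mono[OF L2_norm_le_H1_norm(1)]]) (auto simp: in_H1_def)
  then have 1: "\<bar>\<alpha> * L2_functional L f v\<bar> \<le> \<bar>\<alpha>\<bar> * (L2_norm L f * H1_norm L v v')"
    unfolding abs_mult by (rule mult_left_mono) simp
  have 2: "\<bar>L2_functional L g v'\<bar> \<le> L2_norm L g * H1_norm L v v'"
    using L2_functional_bound[OF g, of v'] v
    by (intro order_trans[OF _ mult_left_mono[OF L2_norm_le_H1_norm(2)]]) (auto simp: in_H1_def)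
  have "\<bar>\<alpha> * L2_functional L f v - L2_functional L g v'\<bar> \<le> \<bar>\<alpha> * L2_functional L f v\<bar> + \<bar>L2_functional L g v'\<bar>"
    by (rule abs_triangle_ineq4)
  also have "\<dots> \<le> (\<bar>\<alpha>\<bar> * L2_norm L f + L2_norm L g) * H1_norm L v v'"
    using 1 2 by (simp add: distrib_right mult.assoc)
  finally show ?thesis .
qed

lemma kernel_flux_in_H1_dual:
  assumes L: "L > 0" and x: "x \<in> {0..L}"
  shows "in_H1_dual L (kernel_flux \<alpha> L x)"
  unfolding in_H1_dual_def
proof (intro conjI allI impI)
  fix u u' v v' a b assume "in_H1 L u u' \<and> in_H1 L v v'"
  then have u: "in_H1 L u u'" and v: "in_H1 L v v'" by auto
  let ?P = "\<lambda>s. L2_functional L (kernel_ext_x \<alpha> s)"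
  let ?D = "\<lambda>v v'. \<alpha> * L2_functional L (kernel_ext_0 \<alpha> x) v - L2_functional L (kernel_ext_y \<alpha> x) v'"
  have "((\<lambda>s. a * ?P s u + b * ?P s v) has_real_derivative a * ?D u u' + b * ?D v v') (at x within {0..L})"
    by (intro DERIV_add DERIV_cmult kernel_functional_derivative L u v x)
  moreover have "a * ?P s u + b * ?P s v = ?P s (\<lambda>y. a * u y + b * v y)" if "s \<in> {0..L}" for s
  proof -
    have i: "(\<lambda>y. kernel_ext_x \<alpha> s y * u y) absolutely_integrable_on {0<..<L}"
      "(\<lambda>y. kernel_ext_x \<alpha> s y * v y) absolutely_integrable_on {0<..<L}"
      using u v by (auto intro!: in_L2_mult in_L2_kernel_ext that simp: in_H1_def)
    have "?P s (\<lambda>y. a * u y + b * v y)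
        = (LINT y:{0<..<L}|lebesgue. a * (kernel_ext_x \<alpha> s y * u y) + b * (kernel_ext_x \<alpha> s y * v y))"
      by (simp add: L2_functional_def algebra_simps)
    also have "\<dots> = (LINT y:{0<..<L}|lebesgue. a * (kernel_ext_x \<alpha> s y * u y))
        + (LINT y:{0<..<L}|lebesgue. b * (kernel_ext_x \<alpha> s y * v y))"
      using i by (intro set_integral_add set_integrable_mult_right)
    finally show ?thesis by (simp only: set_integral_mult_right L2_functional_def)
  qed
  ultimately have "((\<lambda>s. ?P s (\<lambda>y. a * u y + b * v y)) has_real_derivative a * ?D u u' + b * ?D v v') (at x within {0..L})"
    using x by (auto intro: has_field_derivative_transform_within[where d=1])
  then show "kernel_flux \<alpha> L x (\<lambda>y. a * u y + b * v y) = a * kernel_flux \<alpha> L x u + b * kernel_flux \<alpha> L x v"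
    unfolding kernel_flux_eq[OF L u x] kernel_flux_eq[OF L v x] by (intro kernel_flux_eqI L x)
next
  show "\<exists>B. \<forall>v v'. in_H1 L v v' \<longrightarrow> \<bar>kernel_flux \<alpha> L x v\<bar> \<le> B * H1_norm L v v'"
    using functional_pair_bound[OF in_L2_kernel_ext(3)[OF x] in_L2_kernel_ext(2)[OF x], of _ _ \<alpha>]
    by (intro exI[of _ "\<bar>\<alpha>\<bar> * L2_norm L (kernel_ext_0 \<alpha> x) + L2_norm L (kernel_ext_y \<alpha> x)"])
      (auto simp: kernel_flux_eq[OF L _ x])
qed

text \<open>Continuity of the second derivative, uniformly on the unit ball of $H^1(0,L)$, follows from the
  continuity of its two $L^2$ densities.\<close>

lemma kernel_flux_modulus:
  assumes L: "L > 0" and x: "x \<in> {0..L}" and e: "e > 0"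
  shows "\<exists>d>0. \<forall>r\<in>{0..L}. \<bar>r - x\<bar> < d \<longrightarrow>
    (\<forall>v v'. in_H1 L v v' \<longrightarrow> \<bar>kernel_flux \<alpha> L r v - kernel_flux \<alpha> L x v\<bar> \<le> e * H1_norm L v v')"
proof -
  let ?\<eta> = "\<lambda>r. \<bar>\<alpha>\<bar> * L2_norm L (\<lambda>y. kernel_ext_0 \<alpha> r y - kernel_ext_0 \<alpha> x y)
    + L2_norm L (\<lambda>y. kernel_ext_y \<alpha> r y - kernel_ext_y \<alpha> x y)"
  have "(?\<eta> \<longlongrightarrow> \<bar>\<alpha>\<bar> * 0 + 0) (at x within {0..L})"
    using cont_L2_kernel_ext(3,2)[of L \<alpha>] x by (intro tendsto_intros) (auto simp: cont_L2_def)
  then have "\<forall>\<^sub>F r in at x within {0..L}. ?\<eta> r < e" using e by (intro order_tendstoD) auto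
  then obtain d where d: "d > 0" "\<And>r. r \<in> {0..L} \<Longrightarrow> r \<noteq> x \<Longrightarrow> dist r x < d \<Longrightarrow> ?\<eta> r < e"
    unfolding eventually_at by blast
  have "\<bar>kernel_flux \<alpha> L r v - kernel_flux \<alpha> L x v\<bar> \<le> e * H1_norm L v v'"
    if r: "r \<in> {0..L}" "\<bar>r - x\<bar> < d" and v: "in_H1 L v v'" for r v v'
  proof (cases "r = x")
    case True then show ?thesis using e by simp
  next
    case False
    have L2: "in_L2 L v" "in_L2 L v'" using v by (auto simp: in_H1_def)
    have eq: "kernel_flux \<alpha> L r v - kernel_flux \<alpha> L x v
        = \<alpha> * L2_functional L (\<lambda>y. kernel_ext_0 \<alpha> r y - kernel_ext_0 \<alpha> x y) v
          - L2_functional L (\<lambda>y. kernel_ext_y \<alpha> r y - kernel_ext_y \<alpha> x y) v'"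
      unfolding kernel_flux_eq[OF L v r(1)] kernel_flux_eq[OF L v x]
        L2_functional_diff[OF in_L2_kernel_ext(3)[OF r(1)] in_L2_kernel_ext(3)[OF x] L2(1), symmetric]
        L2_functional_diff[OF in_L2_kernel_ext(2)[OF r(1)] in_L2_kernel_ext(2)[OF x] L2(2), symmetric]
      by (simp add: algebra_simps)
    have "dist r x < d" using r(2) by (simp add: dist_real_def)
    then have le: "?\<eta> r \<le> e" by (rule less_imp_le[OF d(2)[OF r(1) False]])
    show ?thesis unfolding eq
    proof (rule order_trans)
      show "\<bar>\<alpha> * L2_functional L (\<lambda>y. kernel_ext_0 \<alpha> r y - kernel_ext_0 \<alpha> x y) v
          - L2_functional L (\<lambda>y. kernel_ext_y \<alpha> r y - kernel_ext_y \<alpha> x y) v'\<bar> \<le> ?\<eta> r * H1_norm L v v'"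
        using r x by (intro functional_pair_bound in_L2_diff in_L2_kernel_ext v) auto
      show "?\<eta> r * H1_norm L v v' \<le> e * H1_norm L v v'"
        by (rule mult_right_mono[OF le H1_norm_nonneg])
    qed
  qed
  then show ?thesis using d(1) by blast
qed

lemma cont_H1_dual_kernel_flux:
  assumes L: "L > 0"
  shows "cont_H1_dual L (kernel_flux \<alpha> L)"
  unfolding cont_H1_dual_def
proof (intro ballI conjI)
  fix x assume x: "x \<in> {0..L}"
  then show "in_H1_dual L (kernel_flux \<alpha> L x)" by (rule kernel_flux_in_H1_dual[OF L])
  show "((\<lambda>s. H1_dual_norm L (\<lambda>v. kernel_flux \<alpha> L s v - kernel_flux \<alpha> L x v)) \<longlongrightarrow> 0) (at x within {0..L})"
  proof (rule tendstoI)
    fix e :: real assume e: "e > 0"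
    then obtain d where d: "d > 0" "\<And>r v v'. r \<in> {0..L} \<Longrightarrow> \<bar>r - x\<bar> < d \<Longrightarrow> in_H1 L v v' \<Longrightarrow>
        \<bar>kernel_flux \<alpha> L r v - kernel_flux \<alpha> L x v\<bar> \<le> e / 2 * H1_norm L v v'"
      using kernel_flux_modulus[OF L x, of "e / 2"] by (metis half_gt_zero)
    have "dist (H1_dual_norm L (\<lambda>v. kernel_flux \<alpha> L s v - kernel_flux \<alpha> L x v)) 0 < e"
      if "s \<in> {0..L}" "dist s x < d" for s
      using H1_dual_norm_bounds[of L "\<lambda>v. kernel_flux \<alpha> L s v - kernel_flux \<alpha> L x v" "e / 2"] d(2)[of s] that e
      by (auto simp: dist_real_def)
    then show "\<forall>\<^sub>F s in at x within {0..L}. dist (H1_dual_norm L (\<lambda>v. kernel_flux \<alpha> L s v - kernel_flux \<alpha> L x v)) 0 < e"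
      unfolding eventually_at using d(1) by blast
  qed
qed

text \<open>For each \<open>v\<close> the mean value theorem turns the difference quotient into \<open>kernel_flux\<close> at an
  intermediate point. That point depends on \<open>v\<close>, but the modulus of continuity does not, so the
  convergence holds in the norm of the dual space.\<close>

lemma has_H1_dual_deriv_kernel_flux:
  assumes L: "L > 0"
  shows "has_H1_dual_deriv L (\<lambda>x. L2_functional L (kernel_ext_x \<alpha> x)) (kernel_flux \<alpha> L)"
  unfolding has_H1_dual_deriv_def
proof
  fix x assume x: "x \<in> {0..L}"
  let ?P = "\<lambda>s. L2_functional L (kernel_ext_x \<alpha> s)"
  let ?Q = "\<lambda>s v. (?P s v - ?P x v) / (s - x) - kernel_flux \<alpha> L x v"
  have mean_value: "\<exists>r\<in>{a<..<b}. ?P b v - ?P a v = kernel_flux \<alpha> L r v * (b - a)"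
    if "0 \<le> a" "a < b" "b \<le> L" "in_H1 L v v'" for a b v v'
  proof -
    have "((\<lambda>s. ?P s v) has_derivative (*) (kernel_flux \<alpha> L r v)) (at r within {a..b})"
      if "a \<le> r" "r \<le> b" for r
    proof -
      have r: "r \<in> {0..L}" using that \<open>0 \<le> a\<close> \<open>b \<le> L\<close> by auto
      have "((\<lambda>s. ?P s v) has_real_derivative kernel_flux \<alpha> L r v) (at r within {0..L})"
        unfolding kernel_flux_eq[OF L \<open>in_H1 L v v'\<close> r]
        by (rule kernel_functional_derivative[OF L \<open>in_H1 L v v'\<close> r])
      then have "((\<lambda>s. ?P s v) has_real_derivative kernel_flux \<alpha> L r v) (at r within {a..b})"
        by (rule DERIV_subset) (use \<open>0 \<le> a\<close> \<open>b \<le> L\<close> in auto)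
      then show ?thesis by (simp add: has_field_derivative_def)
    qed
    then show ?thesis using mvt_simple[OF \<open>a < b\<close>, of "\<lambda>s. ?P s v" "\<lambda>r. (*) (kernel_flux \<alpha> L r v)"] by blast
  qed
  show "((\<lambda>s. H1_dual_norm L (?Q s)) \<longlongrightarrow> 0) (at x within {0..L})"
  proof (rule tendstoI)
    fix e :: real assume e: "e > 0"
    then obtain d where d: "d > 0" "\<And>r v v'. r \<in> {0..L} \<Longrightarrow> \<bar>r - x\<bar> < d \<Longrightarrow> in_H1 L v v' \<Longrightarrow>
        \<bar>kernel_flux \<alpha> L r v - kernel_flux \<alpha> L x v\<bar> \<le> e / 2 * H1_norm L v v'"
      using kernel_flux_modulus[OF L x, of "e / 2"] by (metis half_gt_zero)
    have "dist (H1_dual_norm L (?Q s)) 0 < e" if s: "s \<in> {0..L}" "s \<noteq> x" "dist s x < d" for s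
    proof -
      have "\<bar>?Q s v\<bar> \<le> e / 2 * H1_norm L v v'" if v: "in_H1 L v v'" for v v'
      proof -
        have "\<exists>r\<in>{0..L}. \<bar>r - x\<bar> < d \<and> (?P s v - ?P x v) / (s - x) = kernel_flux \<alpha> L r v"
        proof (cases "x < s")
          case True
          then obtain r where "r \<in> {x<..<s}" "?P s v - ?P x v = kernel_flux \<alpha> L r v * (s - x)"
            using mean_value[of x s v v'] x s v by auto
          then show ?thesis using x s True by (intro bexI[of _ r]) (auto simp: dist_real_def)
        next
          case False
          then obtain r where "r \<in> {s<..<x}" "?P x v - ?P s v = kernel_flux \<alpha> L r v * (x - s)"
            using mean_value[of s x v v'] x s v by auto
          moreover from this(2) have "?P s v - ?P x v = kernel_flux \<alpha> L r v * (s - x)"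
            by (simp add: algebra_simps)
          ultimately show ?thesis using x s False by (intro bexI[of _ r]) (auto simp: dist_real_def)
        qed
        then show ?thesis using d(2) v by metis
      qed
      then show ?thesis using H1_dual_norm_bounds[of L "?Q s" "e / 2"] e by (auto simp: dist_real_def)
    qed
    then show "\<forall>\<^sub>F s in at x within {0..L}. dist (H1_dual_norm L (?Q s)) 0 < e"
      unfolding eventually_at using d(1) by blast
  qed
qed

lemma bessel_kernel_weak_solution:
  "weak_solution_grad \<alpha> (bessel_kernel \<alpha>) (kernel_ext_x \<alpha>) (kernel_ext_y \<alpha>)"
  unfolding weak_solution_grad_def kernel_regular_def
proof (intro conjI allI impI exI)
  fix L :: real assume L: "L > 0"
  show "cont_H1 L (kext \<alpha> (bessel_kernel \<alpha>)) (kernel_ext_y \<alpha>)" by (rule cont_H1_kext_kernel[OF L])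
  show "has_L2_deriv L (kext \<alpha> (bessel_kernel \<alpha>)) (kernel_ext_x \<alpha>)" by (rule has_L2_deriv_kext_kernel)
  show "cont_L2 L (kernel_ext_x \<alpha>)" by (rule cont_L2_kernel_ext)
  show "has_H1_dual_deriv L (\<lambda>x. L2_functional L (kernel_ext_x \<alpha> x)) (kernel_flux \<alpha> L)"
    by (rule has_H1_dual_deriv_kernel_flux[OF L])
  show "cont_H1_dual L (kernel_flux \<alpha> L)" by (rule cont_H1_dual_kernel_flux[OF L])
qed (rule kernel_weak_form_kernel)

section \<open>Uniqueness by even moments\<close>

text \<open>Gronwall's inequality for the system $d'=e$, $e'=\alpha d$ with zero initial data: the derivative of
  $d^2+e^2$ is at most $(1+|\alpha|)(d^2+e^2)$.\<close>

lemma linear_ode_zero: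
  fixes d :: "real \<Rightarrow> real"
  assumes X: "0 < X" and cd: "continuous_on {0..X} d" and d0: "d 0 = 0"
    and dd: "\<And>x. 0 < x \<Longrightarrow> x < X \<Longrightarrow> (d has_real_derivative \<alpha> * integral {0..x} d) (at x)"
  shows "d X = 0"
proof -
  define e where "e x = \<alpha> * integral {0..x} d" for x
  define c where "c = 1 + \<bar>\<alpha>\<bar>"
  define g where "g x = exp (- c * x) * ((d x)\<^sup>2 + (e x)\<^sup>2)" for x
  have ce: "continuous_on {0..X} e" unfolding e_def
    by (intro continuous_intros indefinite_integral_continuous_1 integrable_continuous_real cd)
  have de: "(e has_real_derivative \<alpha> * d x) (at x)" if "0 < x" "x < X" for x
  proof -
    have "((\<lambda>x. integral {0..x} d) has_real_derivative d x) (at x within {0..X})"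
      by (rule integral_has_real_derivative[OF cd]) (use that in auto)
    then have "((\<lambda>x. integral {0..x} d) has_real_derivative d x) (at x)"
      using that at_within_interior[of x "{0..X}"] by simp
    then show ?thesis unfolding e_def by (rule DERIV_cmult)
  qed
  have "g X \<le> g 0"
  proof (rule DERIV_nonpos_imp_decreasing_open[OF less_imp_le[OF X]])
    fix x assume x: "0 < x" "x < X"
    have D: "(g has_real_derivative exp (- c * x) * (2 * (1 + \<alpha>) * (d x * e x) - c * ((d x)\<^sup>2 + (e x)\<^sup>2))) (at x)"
      unfolding g_def
      by (rule derivative_eq_intros dd[OF x] de[OF x] refl)+
        (simp add: e_def[symmetric] algebra_simps power2_eq_square)
    have "2 * (1 + \<alpha>) * (d x * e x) \<le> \<bar>1 + \<alpha>\<bar> * (2 * \<bar>d x * e x\<bar>)"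
      by (metis abs_ge_self abs_mult abs_numeral mult.assoc mult.left_commute)
    also have "\<dots> \<le> c * ((d x)\<^sup>2 + (e x)\<^sup>2)"
      using sum_squares_bound[of "\<bar>d x\<bar>" "\<bar>e x\<bar>"] by (intro mult_mono) (auto simp: c_def abs_mult)
    finally have "2 * (1 + \<alpha>) * (d x * e x) - c * ((d x)\<^sup>2 + (e x)\<^sup>2) \<le> 0" by simp
    then have "exp (- c * x) * (2 * (1 + \<alpha>) * (d x * e x) - c * ((d x)\<^sup>2 + (e x)\<^sup>2)) \<le> 0"
      by (intro mult_nonneg_nonpos) auto
    with D show "\<exists>y. (g has_real_derivative y) (at x) \<and> y \<le> 0" by blast
  next
    show "continuous_on {0..X} g" unfolding g_def by (intro continuous_intros cd ce)
  qed
  also have "g 0 = 0" by (simp add: g_def e_def d0)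
  finally have "(d X)\<^sup>2 + (e X)\<^sup>2 \<le> 0" by (simp add: g_def mult_le_0_iff)
  then show ?thesis by (simp add: sum_power2_le_zero_iff)
qed

text \<open>The moments of even order of the kernel satisfy a triangular system of linear differential
  equations in \<open>x\<close>, because the second derivative of $y^{2n}$ is a multiple of $y^{2n-2}$ and its first
  derivative vanishes at \<open>y = 0\<close>.\<close>

definition moment :: "(real \<Rightarrow> real \<Rightarrow> real) \<Rightarrow> nat \<Rightarrow> real \<Rightarrow> real" where
  "moment f n x = (LINT y:{0<..<x}|lebesgue. f x y * y ^ n)"

lemma kernel_regularD:
  assumes "kernel_regular \<alpha> k kx ky" "L > 0"
  shows "\<And>x. x \<in> {0..L} \<Longrightarrow> in_H1 L (kext \<alpha> k x) (ky x)" "\<And>x. x \<in> {0..L} \<Longrightarrow> in_L2 L (kext \<alpha> k x)"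
    "\<And>x. x \<in> {0..L} \<Longrightarrow> in_L2 L (kx x)" "has_L2_deriv L (kext \<alpha> k) kx"
  using assms unfolding kernel_regular_def cont_H1_def cont_L2_def in_H1_def by auto

lemma kernel_regular_in_L2:
  assumes r: "kernel_regular \<alpha> k kx ky" and x: "x > 0"
  shows "in_L2 x (k x)" "in_L2 x (kx x)" "in_L2 x (ky x)"
proof -
  have "in_L2 x (k x) = in_L2 x (kext \<alpha> k x)" by (rule in_L2_cong) (simp add: kext_def)
  then show "in_L2 x (k x)" using kernel_regularD(2)[OF r x, of x] x by simp
  show "in_L2 x (kx x)" using kernel_regularD(3)[OF r x, of x] x by simp
  show "in_L2 x (ky x)" using kernel_regularD(1)[OF r x, of x] x by (simp add: in_H1_def)
qed

text \<open>The continuous representative of the extension takes the value $-\frac\alpha2x$ at \<open>y = x\<close>, because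
  it equals this constant on a whole interval to the right of \<open>x\<close>. For this the interval
  $(0,L)$ must extend beyond \<open>x\<close>.\<close>

lemma kernel_y_by_parts:
  fixes f f' :: "real \<Rightarrow> real"
  assumes r: "kernel_regular \<alpha> k kx ky" and x: "x > 0"
    and f: "\<And>y. (f has_real_derivative f' y) (at y)" and cf': "continuous_on UNIV f'" and f0: "f 0 = 0"
  shows "(LINT y:{0<..<x}|lebesgue. ky x y * f y) = - (\<alpha> / 2) * x * f x - (LINT y:{0<..<x}|lebesgue. k x y * f' y)"
proof -
  define L where "L = x + 1"
  have L: "L > 0" "x < L" "x \<in> {0..L}" using x by (auto simp: L_def)
  obtain w where w: "in_H1 L w (ky x)" and cw: "continuous_on {0..L} w"
    and ae: "AE y in lebesgue. 0 < y \<and> y < L \<longrightarrow> kext \<alpha> k x y = w y"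
    using in_H1_continuous_representative[OF L(1) kernel_regularD(1)[OF r L(1) L(3)]] .
  have cf: "continuous_on S f" for S using f by (meson DERIV_isCont continuous_at_imp_continuous_on)
  have kya: "ky x absolutely_integrable_on {0..L}"
    using w by (auto simp: in_H1_def in_L2_iff_absolutely_integrable absolutely_integrable_on_Icc_iff_Ioo)
  then have kyx: "ky x absolutely_integrable_on {0..x}"
    by (rule absolutely_integrable_on_subinterval) (use L x in auto)
  have "w x + \<alpha> / 2 * x = 0"
  proof (rule continuous_AE_zero[OF L(2), where h="\<lambda>y. w y + \<alpha> / 2 * x" and y=x])
    show "continuous_on {x..L} (\<lambda>y. w y + \<alpha> / 2 * x)"
      by (intro continuous_intros continuous_on_subset[OF cw]) (use x in auto)
    show "AE y in lebesgue. x < y \<and> y < L \<longrightarrow> w y + \<alpha> / 2 * x = 0"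
      using ae by eventually_elim (use x in \<open>auto simp: kext_def\<close>)
  qed (use L in auto)
  then have wx: "w x = - (\<alpha> / 2) * x" by simp
  have "integral {0..x} (\<lambda>y. ky x y * f y) + integral {0..x} (\<lambda>y. w y * f' y) = w x * f x - w 0 * f 0"
  proof (rule integral_by_parts_absolutely_continuous[OF _ kyx])
    show "f' absolutely_integrable_on {0..x}"
      by (intro absolutely_integrable_continuous_real continuous_on_subset[OF cf']) auto
    show "w y = w 0 + integral {0..y} (ky x)" if "0 \<le> y" "y \<le> x" for y
      using that L by (intro in_H1_continuous_representation[OF L(1) w cw]) auto
    show "f y = f 0 + integral {0..y} f'" if "0 \<le> y" "y \<le> x" for y
      by (rule derivative_imp_integral[of x, OF has_field_derivative_at_within[OF f] that])
  qed (use x in auto)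
  moreover have "(LINT y:{0<..<x}|lebesgue. ky x y * f y) = integral {0..x} (\<lambda>y. ky x y * f y)"
    using absolutely_integrable_continuous_mult[OF cf kyx]
    by (intro LINT_open_eq_integral) (simp add: absolutely_integrable_on_Icc_iff_Ioo mult.commute)
  moreover have "(LINT y:{0<..<x}|lebesgue. k x y * f' y) = integral {0..x} (\<lambda>y. w y * f' y)"
  proof -
    have cwx: "continuous_on {0..x} w" by (rule continuous_on_subset[OF cw]) (use L in auto)
    have cf'x: "continuous_on {0..x} f'" by (rule continuous_on_subset[OF cf']) auto
    have "L2_functional x f' (k x) = L2_functional x f' w"
      using ae L(2)
      by (intro L2_functional_cong_AE in_L2_continuous cwx cf'x kernel_regular_in_L2[OF r x])
        (auto simp: kext_def elim!: eventually_mono)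
    also have "L2_functional x f' w = integral {0..x} (\<lambda>y. f' y * w y)"
      unfolding L2_functional_def
      by (intro LINT_open_eq_integral continuous_imp_absolutely_integrable_Ioo continuous_intros cwx cf'x)
    finally show ?thesis by (simp add: L2_functional_def mult.commute)
  qed
  ultimately show ?thesis by (simp add: wx f0)
qed

text \<open>The moment of \<open>k\<close> over $(0,x)$ differs from the pairing of the extension with $y^n$ over $(0,X)$
  by an explicit integral over $(x,X)$. The derivative of the pairing is the pairing with \<open>kx\<close> over
  $(0,X)$, and its part over $(x,X)$ is explicit as well: for $s\le x$ the extension at \<open>s\<close> is
  $-\frac\alpha2s$ there, so the derivative from the left at \<open>x\<close> can be read off.\<close>

lemma moment_derivative:
  assumes r: "kernel_regular \<alpha> k kx ky" and X: "X > 0"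
  shows "continuous_on {0..X} (moment k n)"
    and "\<And>x. 0 < x \<Longrightarrow> x < X \<Longrightarrow>
      (moment k n has_real_derivative moment kx n x - (\<alpha> / 2) * x * x ^ n) (at x)"
proof -
  let ?e = "\<lambda>y::real. y ^ n"
  have ce: "continuous_on S ?e" for S by (intro continuous_intros)
  have e: "in_L2 X ?e" by (rule in_L2_continuous[OF ce])
  have kL: "in_L2 X (kext \<alpha> k s)" "in_L2 X (kx s)" if "s \<in> {0..X}" for s
    using kernel_regularD(2,3)[OF r X that] .
  have tail: "(LINT y:{s<..<X}|lebesgue. ?e y) = integral {0..X} ?e - integral {0..s} ?e" if "s \<in> {0..X}" for s
  proof -
    have "integral {0..s} ?e + integral {s..X} ?e = integral {0..X} ?e"
      using that by (intro Henstock_Kurzweil_Integration.integral_combine integrable_continuous_real ce) auto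
    then show ?thesis
      by (simp add: LINT_open_eq_integral[OF continuous_imp_absolutely_integrable_Ioo[OF ce]])
  qed
  have dL: "((\<lambda>s. L2_functional X (kext \<alpha> k s) v) has_real_derivative L2_functional X (kx x) v) (at x within {0..X})"
    if "x \<in> {0..X}" "in_L2 X v" for x v
    using that kL kernel_regularD(4)[OF r X] by (intro L2_functional_derivative) auto
  have m: "moment k n s = L2_functional X (kext \<alpha> k s) ?e + \<alpha> / 2 * s * (integral {0..X} ?e - integral {0..s} ?e)"
    if s: "s \<in> {0..X}" for s
  proof -
    have "L2_functional X (kext \<alpha> k s) ?e = (LINT y:{0<..<s}|lebesgue. kext \<alpha> k s y * ?e y)
        + (LINT y:{s<..<X}|lebesgue. kext \<alpha> k s y * ?e y)"
      unfolding L2_functional_def by (rule LINT_split) (use s in_L2_mult[OF kL(1)[OF s] e] in auto)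
    also have "(LINT y:{0<..<s}|lebesgue. kext \<alpha> k s y * ?e y) = moment k n s"
      unfolding moment_def by (rule set_lebesgue_integral_cong) (auto simp: kext_def)
    also have "(LINT y:{s<..<X}|lebesgue. kext \<alpha> k s y * ?e y) = (LINT y:{s<..<X}|lebesgue. - (\<alpha> / 2 * s) * ?e y)"
      by (rule set_lebesgue_integral_cong) (auto simp: kext_def)
    also have "\<dots> = - (\<alpha> / 2 * s) * (integral {0..X} ?e - integral {0..s} ?e)"
      by (simp only: set_integral_mult_right tail[OF s])
    finally show ?thesis by simp
  qed
  have d: "(moment k n has_real_derivative L2_functional X (kx x) ?e
      + (\<alpha> / 2 * (integral {0..X} ?e - integral {0..x} ?e) - \<alpha> / 2 * x * ?e x)) (at x within {0..X})"
    if x: "x \<in> {0..X}" for x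
  proof -
    have "((\<lambda>s. integral {0..s} ?e) has_real_derivative ?e x) (at x within {0..X})"
      by (rule integral_has_real_derivative[OF ce x])
    then have "((\<lambda>s. L2_functional X (kext \<alpha> k s) ?e + \<alpha> / 2 * s * (integral {0..X} ?e - integral {0..s} ?e))
      has_real_derivative L2_functional X (kx x) ?e
      + (\<alpha> / 2 * (integral {0..X} ?e - integral {0..x} ?e) - \<alpha> / 2 * x * ?e x)) (at x within {0..X})"
      by (auto intro!: derivative_eq_intros dL[OF x e] simp: algebra_simps)
    then show ?thesis
      by (rule has_field_derivative_transform_within[where d=1]) (use x m in auto)
  qed
  then show "continuous_on {0..X} (moment k n)" by (rule DERIV_continuous_on)
  fix x assume x: "0 < x" "x < X"
  then have xX: "x \<in> {0..X}" by simp
  \<comment> \<open>The truncation of $y^n$ to $(x,X)$, where the extension is explicit for all $s\le x$.\<close>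
  define v where "v y = (if y \<le> x then 0 else ?e y)" for y
  have v: "in_L2 X v"
  proof (rule in_L2_bounded[where B="X ^ n"])
    have "(\<lambda>y. indicator {0<..<X} y *\<^sub>R v y) \<in> borel_measurable borel" unfolding v_def by measurable
    then show "set_borel_measurable lebesgue {0<..<X} v"
      unfolding set_borel_measurable_def by (simp add: measurable_completion)
    show "\<bar>v y\<bar> \<le> X ^ n" if "0 < y" "y < X" for y
      using that by (auto simp: v_def power_mono)
  qed
  have half: "L2_functional X f v = (LINT y:{x<..<X}|lebesgue. f y * ?e y)" if "in_L2 X f" for f
  proof -
    have "L2_functional X f v = (LINT y:{0<..<x}|lebesgue. f y * v y) + (LINT y:{x<..<X}|lebesgue. f y * v y)"
      unfolding L2_functional_def by (rule LINT_split) (use x in_L2_mult[OF that v] in auto)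
    moreover have "(LINT y:{0<..<x}|lebesgue. f y * v y) = (LINT y:{0<..<x}|lebesgue. 0)"
      by (rule set_lebesgue_integral_cong) (auto simp: v_def)
    moreover have "(LINT y:{x<..<X}|lebesgue. f y * v y) = (LINT y:{x<..<X}|lebesgue. f y * ?e y)"
      by (rule set_lebesgue_integral_cong) (auto simp: v_def)
    ultimately show ?thesis by simp
  qed
  have "L2_functional X (kx x) v = - (\<alpha> / 2) * (integral {0..X} ?e - integral {0..x} ?e)"
  proof -
    \<comment> \<open>Two derivatives within $[0,x]$ of the same pairing, the second one explicit, must agree.\<close>
    have A: "((\<lambda>s. L2_functional X (kext \<alpha> k s) v) has_real_derivative L2_functional X (kx x) v) (at x within {0..x})"
      by (rule DERIV_subset[OF dL[OF xX v]]) (use x in auto)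
    have "((\<lambda>s. - (\<alpha> / 2) * (integral {0..X} ?e - integral {0..x} ?e) * s) has_real_derivative
        - (\<alpha> / 2) * (integral {0..X} ?e - integral {0..x} ?e)) (at x within {0..x})"
      by (rule DERIV_cmult_Id)
    then have B: "((\<lambda>s. L2_functional X (kext \<alpha> k s) v) has_real_derivative
        - (\<alpha> / 2) * (integral {0..X} ?e - integral {0..x} ?e)) (at x within {0..x})"
    proof (rule has_field_derivative_transform_within[where d=1])
      fix s assume s: "s \<in> {0..x}"
      then have sX: "s \<in> {0..X}" using x by auto
      have "L2_functional X (kext \<alpha> k s) v = (LINT y:{x<..<X}|lebesgue. - (\<alpha> / 2 * s) * ?e y)"
        unfolding half[OF kL(1)[OF sX]]
        by (rule set_lebesgue_integral_cong) (use s in \<open>auto simp: kext_def\<close>)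
      also have "\<dots> = - (\<alpha> / 2 * s) * (integral {0..X} ?e - integral {0..x} ?e)"
        by (simp only: set_integral_mult_right tail[OF xX])
      finally show "- (\<alpha> / 2) * (integral {0..X} ?e - integral {0..x} ?e) * s = L2_functional X (kext \<alpha> k s) v"
        by simp
    qed (use x in auto)
    show ?thesis
      using vector_derivative_unique_within_closed_interval[of 0 x x "\<lambda>s. L2_functional X (kext \<alpha> k s) v"] A B x
      by (simp add: has_real_derivative_iff_has_vector_derivative)
  qed
  moreover have "L2_functional X (kx x) ?e = moment kx n x + L2_functional X (kx x) v"
    unfolding half[OF kL(2)[OF xX]] unfolding L2_functional_def moment_def
    by (rule LINT_split) (use x in_L2_mult[OF kL(2)[OF xX] e] in auto)
  ultimately have "L2_functional X (kx x) ?e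
      + (\<alpha> / 2 * (integral {0..X} ?e - integral {0..x} ?e) - \<alpha> / 2 * x * ?e x)
      = moment kx n x - (\<alpha> / 2) * x * x ^ n"
    by (simp add: algebra_simps)
  moreover have "at x within {0..X} = at x" by (rule at_within_interior) (use x in simp)
  ultimately show "(moment k n has_real_derivative moment kx n x - (\<alpha> / 2) * x * x ^ n) (at x)"
    using d[OF xX] by (simp only:)
qed

text \<open>The weak equation on $(0,X)$ with $v=y^{2n}$ and $w=1$, after integrating $\partial_yk$ by parts. The
  last integral is the same for all solutions. For \<open>n = 0\<close> the truncated exponents are harmless,
  since the factor \<open>real (2 * n)\<close> is zero.\<close>

lemma moment_x_identity:
  assumes k: "weak_solution_grad \<alpha> k kx ky" and X: "X > 0"
  shows "moment kx (2 * n) X = \<alpha> * integral {0..X} (moment k (2 * n))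
    + real (2 * n) * real (2 * n - 1) * integral {0..X} (moment k (2 * n - 1 - 1))
    + integral {0..X} (\<lambda>x. (\<alpha> / 2) * x * (real (2 * n) * x ^ (2 * n - 1)) - (\<alpha> / 2) * x ^ (2 * n))"
proof -
  have r: "kernel_regular \<alpha> k kx ky" and wf: "kernel_weak_form \<alpha> k kx ky"
    using k by (auto simp: weak_solution_grad_def)
  let ?v = "\<lambda>y::real. y ^ (2 * n)" and ?v' = "\<lambda>y::real. real (2 * n) * y ^ (2 * n - 1)"
  have v: "in_H1 X ?v ?v'"
  proof (rule in_H1_C1[OF X])
    fix y show "(?v has_real_derivative ?v' y) (at y within {0..X})"
      by (rule has_field_derivative_at_within) (auto intro!: derivative_eq_intros)
  qed (intro continuous_intros)
  have w: "in_H1 X (\<lambda>_. 1) (\<lambda>_. 0)" by (rule in_H1_C1[OF X]) auto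
  have cm: "continuous_on {0..X} (moment k j)" for j by (rule moment_derivative(1)[OF r X])
  have cont_LINT: "(LINT x:{0<..<X}|lebesgue. f x) = integral {0..X} f" if "continuous_on {0..X} f" for f :: "real \<Rightarrow> real"
    by (intro LINT_open_eq_integral continuous_imp_absolutely_integrable_Ioo that)
  have "- (LINT x:{0<..<X}|lebesgue. (LINT y:{0<..<x}|lebesgue. kx x y * ?v y) * 0)
     + 1 * (LINT y:{0<..<X}|lebesgue. kx X y * ?v y)
     + (LINT x:{0<..<X}|lebesgue. (LINT y:{0<..<x}|lebesgue. ky x y * ?v' y) * 1)
     = \<alpha> * (LINT x:{0<..<X}|lebesgue. (LINT y:{0<..<x}|lebesgue. k x y * ?v y) * 1)
       - \<alpha> / 2 * (LINT x:{0<..<X}|lebesgue. ?v x * 1)"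
    by (rule wf[unfolded kernel_weak_form_def, rule_format, OF X, of ?v ?v' "\<lambda>_. 1" "\<lambda>_. 0"])
      (use v w in \<open>auto intro!: continuous_intros\<close>)
  then have main: "moment kx (2 * n) X + (LINT x:{0<..<X}|lebesgue. (LINT y:{0<..<x}|lebesgue. ky x y * ?v' y))
     = \<alpha> * (LINT x:{0<..<X}|lebesgue. moment k (2 * n) x) - \<alpha> / 2 * (LINT x:{0<..<X}|lebesgue. ?v x)"
    by (simp add: moment_def)
  have "(LINT x:{0<..<X}|lebesgue. (LINT y:{0<..<x}|lebesgue. ky x y * ?v' y))
      = (LINT x:{0<..<X}|lebesgue. - (\<alpha> / 2) * x * ?v' x - real (2 * n) * real (2 * n - 1) * moment k (2 * n - 1 - 1) x)"
  proof (rule set_lebesgue_integral_cong)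
    show "\<forall>x. x \<in> {0<..<X} \<longrightarrow> (LINT y:{0<..<x}|lebesgue. ky x y * ?v' y)
        = - (\<alpha> / 2) * x * ?v' x - real (2 * n) * real (2 * n - 1) * moment k (2 * n - 1 - 1) x"
    proof (intro allI impI)
      fix x assume "x \<in> {0<..<X}"
      then have x: "x > 0" by simp
      let ?v'' = "\<lambda>y::real. (real (2 * n) * real (2 * n - 1)) * y ^ (2 * n - 1 - 1)"
      have "(LINT y:{0<..<x}|lebesgue. ky x y * ?v' y) = - (\<alpha> / 2) * x * ?v' x - (LINT y:{0<..<x}|lebesgue. k x y * ?v'' y)"
      proof (rule kernel_y_by_parts[OF r x])
        show "(?v' has_real_derivative ?v'' y) (at y)" for y
          unfolding mult.assoc by (intro DERIV_cmult DERIV_pow[THEN DERIV_cong]) simp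
        show "continuous_on UNIV ?v''" by (intro continuous_intros)
        show "?v' 0 = 0" by (cases n) auto
      qed
      also have "(LINT y:{0<..<x}|lebesgue. k x y * ?v'' y)
          = (LINT y:{0<..<x}|lebesgue. (real (2 * n) * real (2 * n - 1)) * (k x y * y ^ (2 * n - 1 - 1)))"
        by (simp only: mult.left_commute)
      also have "\<dots> = real (2 * n) * real (2 * n - 1) * moment k (2 * n - 1 - 1) x"
        unfolding moment_def by (rule set_integral_mult_right)
      finally show "(LINT y:{0<..<x}|lebesgue. ky x y * ?v' y)
        = - (\<alpha> / 2) * x * ?v' x - real (2 * n) * real (2 * n - 1) * moment k (2 * n - 1 - 1) x" .
    qed
  qed simp
  also have "\<dots> = integral {0..X} (\<lambda>x. - (\<alpha> / 2) * x * ?v' x - real (2 * n) * real (2 * n - 1) * moment k (2 * n - 1 - 1) x)"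
    by (intro cont_LINT continuous_intros cm)
  finally have q: "(LINT x:{0<..<X}|lebesgue. (LINT y:{0<..<x}|lebesgue. ky x y * ?v' y)) = \<dots>" .
  have A: "((\<lambda>x. \<alpha> * moment k (2 * n) x - \<alpha> / 2 * ?v x
        - (- (\<alpha> / 2) * x * ?v' x - real (2 * n) * real (2 * n - 1) * moment k (2 * n - 1 - 1) x)) has_integral
      \<alpha> * integral {0..X} (moment k (2 * n)) - \<alpha> / 2 * integral {0..X} ?v
        - integral {0..X} (\<lambda>x. - (\<alpha> / 2) * x * ?v' x - real (2 * n) * real (2 * n - 1) * moment k (2 * n - 1 - 1) x)) {0..X}"
    by (intro has_integral_diff has_integral_mult_right integrable_integral integrable_continuous_real continuous_intros cm)
  have B: "((\<lambda>x. \<alpha> * moment k (2 * n) x + real (2 * n) * real (2 * n - 1) * moment k (2 * n - 1 - 1) x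
        + ((\<alpha> / 2) * x * ?v' x - (\<alpha> / 2) * ?v x)) has_integral
      \<alpha> * integral {0..X} (moment k (2 * n)) + real (2 * n) * real (2 * n - 1) * integral {0..X} (moment k (2 * n - 1 - 1))
        + integral {0..X} (\<lambda>x. (\<alpha> / 2) * x * ?v' x - (\<alpha> / 2) * ?v x)) {0..X}"
    by (intro has_integral_add has_integral_mult_right integrable_integral integrable_continuous_real continuous_intros cm)
  have E: "(\<lambda>x. \<alpha> * moment k (2 * n) x - \<alpha> / 2 * ?v x
        - (- (\<alpha> / 2) * x * ?v' x - real (2 * n) * real (2 * n - 1) * moment k (2 * n - 1 - 1) x))
      = (\<lambda>x. \<alpha> * moment k (2 * n) x + real (2 * n) * real (2 * n - 1) * moment k (2 * n - 1 - 1) x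
        + ((\<alpha> / 2) * x * ?v' x - (\<alpha> / 2) * ?v x))"
    by (simp add: fun_eq_iff)
  have eq: "\<alpha> * integral {0..X} (moment k (2 * n)) - \<alpha> / 2 * integral {0..X} ?v
        - integral {0..X} (\<lambda>x. - (\<alpha> / 2) * x * ?v' x - real (2 * n) * real (2 * n - 1) * moment k (2 * n - 1 - 1) x)
      = \<alpha> * integral {0..X} (moment k (2 * n)) + real (2 * n) * real (2 * n - 1) * integral {0..X} (moment k (2 * n - 1 - 1))
        + integral {0..X} (\<lambda>x. (\<alpha> / 2) * x * ?v' x - (\<alpha> / 2) * ?v x)"
    by (rule has_integral_unique[OF A[unfolded E] B])
  have "moment kx (2 * n) X = \<alpha> * integral {0..X} (moment k (2 * n)) - \<alpha> / 2 * integral {0..X} ?v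
        - integral {0..X} (\<lambda>x. - (\<alpha> / 2) * x * ?v' x - real (2 * n) * real (2 * n - 1) * moment k (2 * n - 1 - 1) x)"
    using main q cont_LINT[OF cm] cont_LINT[of ?v] by (simp add: continuous_intros)
  with eq show ?thesis by simp
qed

lemma moment_at_0 [simp]: "moment f n 0 = 0"
  by (simp add: moment_def set_lebesgue_integral_def)

text \<open>By induction on \<open>n\<close>: once the lower moments agree, the difference of the two moments of order
  \<open>2 * n\<close> satisfies $d''=\alpha d$ with zero initial data.\<close>

lemma moment_unique:
  assumes k: "weak_solution_grad \<alpha> k kx ky" and h: "weak_solution_grad \<alpha> h hx hy"
  shows "0 \<le> x \<Longrightarrow> moment k (2 * n) x = moment h (2 * n) x"
proof (induction n arbitrary: x rule: less_induct)
  case (less n)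
  have r: "kernel_regular \<alpha> k kx ky" "kernel_regular \<alpha> h hx hy"
    using k h by (auto simp: weak_solution_grad_def)
  show ?case
  proof (cases "x = 0")
    case False
    then have x: "0 < x" using less.prems by simp
    define d where "d x = moment k (2 * n) x - moment h (2 * n) x" for x
    have cm: "continuous_on {0..z} (moment k j)" "continuous_on {0..z} (moment h j)" if "z > 0" for z j
      using moment_derivative(1)[OF r(1) that] moment_derivative(1)[OF r(2) that] .
    have "d x = 0"
    proof (rule linear_ode_zero[OF x])
      show "continuous_on {0..x} d" unfolding d_def by (intro continuous_intros cm x)
      show "d 0 = 0" by (simp add: d_def)
      fix z assume z: "0 < z" "z < x"
      have lower: "real (2 * n) * real (2 * n - 1) * integral {0..z} (moment k (2 * n - 1 - 1))
          = real (2 * n) * real (2 * n - 1) * integral {0..z} (moment h (2 * n - 1 - 1))"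
      proof (cases n)
        case (Suc j)
        have "integral {0..z} (moment k (2 * j)) = integral {0..z} (moment h (2 * j))"
          by (rule integral_cong) (use less.IH[of j] Suc in auto)
        then show ?thesis by (simp add: Suc)
      qed simp
      have "moment kx (2 * n) z - moment hx (2 * n) z
          = \<alpha> * (integral {0..z} (moment k (2 * n)) - integral {0..z} (moment h (2 * n)))"
        unfolding moment_x_identity[OF k z(1)] moment_x_identity[OF h z(1)] lower
        by (simp add: algebra_simps)
      also have "integral {0..z} (moment k (2 * n)) - integral {0..z} (moment h (2 * n)) = integral {0..z} d"
        unfolding d_def
        by (intro Henstock_Kurzweil_Integration.integral_diff[symmetric] integrable_continuous_real cm z(1))
      finally have e: "moment kx (2 * n) z - moment hx (2 * n) z = \<alpha> * integral {0..z} d" .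
      have "(d has_real_derivative (moment kx (2 * n) z - (\<alpha> / 2) * z * z ^ (2 * n))
          - (moment hx (2 * n) z - (\<alpha> / 2) * z * z ^ (2 * n))) (at z)"
        unfolding d_def using z by (intro DERIV_diff moment_derivative(2)[OF r(1) x] moment_derivative(2)[OF r(2) x])
      then show "(d has_real_derivative \<alpha> * integral {0..z} d) (at z)" using e by simp
    qed
    then show ?thesis by (simp add: d_def)
  qed simp
qed

lemma moment_x_unique:
  assumes k: "weak_solution_grad \<alpha> k kx ky" and h: "weak_solution_grad \<alpha> h hx hy" and x: "0 < x"
  shows "moment kx (2 * n) x = moment hx (2 * n) x"
proof -
  have eq: "integral {0..x} (moment k (2 * j)) = integral {0..x} (moment h (2 * j))" for j
    by (rule integral_cong) (use moment_unique[OF k h] in auto)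
  have "real (2 * n) * real (2 * n - 1) * integral {0..x} (moment k (2 * n - 1 - 1))
      = real (2 * n) * real (2 * n - 1) * integral {0..x} (moment h (2 * n - 1 - 1))"
    by (cases n) (use eq in auto)
  then show ?thesis
    unfolding moment_x_identity[OF k x] moment_x_identity[OF h x] by (simp only: eq)
qed

text \<open>Integration by parts with $y^{2n+1}$, which vanishes at \<open>y = 0\<close>, reduces the odd moments of
  $\partial_yk$ to even moments of \<open>k\<close>.\<close>

lemma moment_y_unique:
  assumes k: "weak_solution_grad \<alpha> k kx ky" and h: "weak_solution_grad \<alpha> h hx hy" and x: "0 < x"
  shows "moment ky (2 * n + 1) x = moment hy (2 * n + 1) x"
proof -
  have val: "moment ky (2 * n + 1) x = - (\<alpha> / 2) * x * x ^ (2 * n + 1) - real (2 * n + 1) * moment k (2 * n) x"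
    if "kernel_regular \<alpha> k kx ky" for k kx ky
  proof -
    have "(LINT y:{0<..<x}|lebesgue. ky x y * y ^ (2 * n + 1))
        = - (\<alpha> / 2) * x * x ^ (2 * n + 1) - (LINT y:{0<..<x}|lebesgue. k x y * (real (2 * n + 1) * y ^ (2 * n)))"
    proof (rule kernel_y_by_parts[OF that x])
      show "((\<lambda>y. y ^ (2 * n + 1)) has_real_derivative real (2 * n + 1) * y ^ (2 * n)) (at y)" for y :: real
        using DERIV_pow[of "2 * n + 1" y] by simp
      show "continuous_on UNIV (\<lambda>y. real (2 * n + 1) * y ^ (2 * n))" by (intro continuous_intros)
    qed simp
    also have "(LINT y:{0<..<x}|lebesgue. k x y * (real (2 * n + 1) * y ^ (2 * n)))
        = (LINT y:{0<..<x}|lebesgue. real (2 * n + 1) * (k x y * y ^ (2 * n)))"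
      by (simp only: mult.left_commute)
    also have "\<dots> = real (2 * n + 1) * moment k (2 * n) x"
      unfolding moment_def by (rule set_integral_mult_right)
    finally show ?thesis by (simp only: moment_def)
  qed
  have r: "kernel_regular \<alpha> k kx ky" "kernel_regular \<alpha> h hx hy"
    using k h by (auto simp: weak_solution_grad_def)
  show ?thesis unfolding val[OF r(1)] val[OF r(2)] using moment_unique[OF k h, of x n] x by simp
qed

lemma AE_eq_if_even_moments_eq:
  assumes f: "in_L2 x (f x)" and g: "in_L2 x (g x)" and m: "\<And>n. moment f (2 * n) x = moment g (2 * n) x"
  shows "AE y in lebesgue. 0 < y \<and> y < x \<longrightarrow> f x y = g x y"
proof -
  have "AE y in lebesgue. 0 < y \<and> y < x \<longrightarrow> f x y - g x y = 0"
  proof (rule AE_zero_if_even_moments_zero)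
    show "(\<lambda>y. f x y - g x y) absolutely_integrable_on {0<..<x}"
      using in_L2_diff[OF f g] by (simp add: in_L2_iff_absolutely_integrable)
    fix n
    have "in_L2 x (\<lambda>y. y ^ (2 * n))" by (intro in_L2_continuous continuous_intros)
    then have "L2_functional x (f x) (\<lambda>y. y ^ (2 * n)) - L2_functional x (g x) (\<lambda>y. y ^ (2 * n))
        = L2_functional x (\<lambda>y. f x y - g x y) (\<lambda>y. y ^ (2 * n))"
      by (rule L2_functional_diff[OF f g])
    then show "(LINT y:{0<..<x}|lebesgue. (f x y - g x y) * y ^ (2 * n)) = 0"
      using m[of n] by (simp add: L2_functional_def moment_def)
  qed
  then show ?thesis by eventually_elim simp
qed

text \<open>Even moments determine \<open>k\<close>, \<open>kx\<close> and the product of \<open>ky\<close> with \<open>y\<close>. The representatives of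
  the partial derivatives are thus unique too, so that estimates for the explicit kernel hold for
  every solution.\<close>

lemma weak_solution_unique:
  assumes k: "weak_solution_grad \<alpha> k kx ky" and h: "weak_solution_grad \<alpha> h hx hy" and x: "0 < x"
  shows "AE y in lebesgue. 0 < y \<and> y < x \<longrightarrow> k x y = h x y \<and> kx x y = hx x y \<and> ky x y = hy x y"
proof -
  have r: "kernel_regular \<alpha> k kx ky" "kernel_regular \<alpha> h hx hy"
    using k h by (auto simp: weak_solution_grad_def)
  note L2 = kernel_regular_in_L2[OF r(1) x] kernel_regular_in_L2[OF r(2) x]
  have 1: "AE y in lebesgue. 0 < y \<and> y < x \<longrightarrow> k x y = h x y"
    using moment_unique[OF k h] x by (intro AE_eq_if_even_moments_eq L2) auto
  have 2: "AE y in lebesgue. 0 < y \<and> y < x \<longrightarrow> kx x y = hx x y"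
    using moment_x_unique[OF k h x] by (intro AE_eq_if_even_moments_eq L2)
  \<comment> \<open>Only odd moments of \<open>ky\<close> are known; these are the even moments of $y\,\partial_yk$.\<close>
  have times_y: "in_L2 x (\<lambda>y. g y * y)" if g: "in_L2 x g" for g
  proof -
    have "(\<lambda>y. y\<^sup>2 * (g y)\<^sup>2) absolutely_integrable_on {0..x}"
      using g by (intro absolutely_integrable_continuous_mult continuous_intros)
        (simp add: in_L2_iff_absolutely_integrable absolutely_integrable_on_Icc_iff_Ioo)
    moreover have "(\<lambda>y. g y * y) absolutely_integrable_on {0<..<x}"
      by (intro in_L2_mult g in_L2_continuous continuous_intros)
    ultimately show ?thesis
      by (simp add: in_L2_iff_absolutely_integrable absolutely_integrable_on_Icc_iff_Ioo power_mult_distrib mult.commute)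
  qed
  have "AE y in lebesgue. 0 < y \<and> y < x \<longrightarrow> ky x y * y = hy x y * y"
  proof (rule AE_eq_if_even_moments_eq[where f="\<lambda>x y. ky x y * y" and g="\<lambda>x y. hy x y * y"])
    show "in_L2 x (\<lambda>y. ky x y * y)" "in_L2 x (\<lambda>y. hy x y * y)" by (intro times_y L2)+
    show "moment (\<lambda>x y. ky x y * y) (2 * n) x = moment (\<lambda>x y. hy x y * y) (2 * n) x" for n
      using moment_y_unique[OF k h x, of n] by (simp add: moment_def mult.assoc)
  qed
  with 1 2 show ?thesis by eventually_elim auto
qed

section \<open>Energy estimates\<close>

lemma grad_energy_le:
  assumes r: "kernel_regular \<alpha> k kx ky" and x: "0 < x"
    and b: "AE y in lebesgue. 0 < y \<and> y < x \<longrightarrow> \<bar>k x y\<bar> \<le> A \<and> \<bar>kx x y\<bar> \<le> B \<and> \<bar>ky x y\<bar> \<le> C"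
  shows "grad_energy k kx ky x \<le> x * (A\<^sup>2 + (B\<^sup>2 + C\<^sup>2))"
proof -
  have "grad_energy k kx ky x \<le> (LINT y:{0<..<x}|lebesgue. A\<^sup>2 + (B\<^sup>2 + C\<^sup>2))"
    unfolding grad_energy_def
  proof (rule set_integral_mono_AE)
    show "(\<lambda>y. \<bar>k x y\<bar>\<^sup>2 + (\<bar>kx x y\<bar>\<^sup>2 + \<bar>ky x y\<bar>\<^sup>2)) absolutely_integrable_on {0<..<x}"
      using kernel_regular_in_L2[OF r x] by (simp add: in_L2_iff_absolutely_integrable set_integral_add)
    show "(\<lambda>y. A\<^sup>2 + (B\<^sup>2 + C\<^sup>2)) absolutely_integrable_on {0<..<x}"
      by (intro continuous_imp_absolutely_integrable_Ioo continuous_intros)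
    show "AE y\<in>{0<..<x} in lebesgue. \<bar>k x y\<bar>\<^sup>2 + (\<bar>kx x y\<bar>\<^sup>2 + \<bar>ky x y\<bar>\<^sup>2) \<le> A\<^sup>2 + (B\<^sup>2 + C\<^sup>2)"
      using b by eventually_elim (intro impI add_mono power_mono abs_ge_zero; simp)
  qed
  also have "\<dots> = integral {0..x} (\<lambda>y. A\<^sup>2 + (B\<^sup>2 + C\<^sup>2))"
    by (intro LINT_open_eq_integral continuous_imp_absolutely_integrable_Ioo continuous_intros)
  also have "\<dots> = x * (A\<^sup>2 + (B\<^sup>2 + C\<^sup>2))" using x by simp
  finally show ?thesis .
qed

lemma kernel_bounds:
  assumes E: "\<And>m. \<bar>bessel_clifford m (\<alpha> * (x\<^sup>2 - y\<^sup>2) / 4)\<bar> \<le> E" and y: "0 \<le> y" "y \<le> x"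
  shows "\<bar>bessel_kernel \<alpha> x y\<bar> \<le> \<bar>\<alpha>\<bar> * x / 2 * E"
    "\<bar>kernel_x \<alpha> x y\<bar> \<le> (\<bar>\<alpha>\<bar> / 2 + \<alpha>\<^sup>2 * x\<^sup>2 / 4) * E"
    "\<bar>kernel_y \<alpha> x y\<bar> \<le> \<alpha>\<^sup>2 * x\<^sup>2 / 4 * E"
proof -
  have "\<bar>bessel_kernel \<alpha> x y\<bar> = \<bar>\<alpha>\<bar> * x / 2 * \<bar>bessel_clifford 1 (\<alpha> * (x\<^sup>2 - y\<^sup>2) / 4)\<bar>"
    using y by (simp add: bessel_kernel_def abs_mult)
  then show "\<bar>bessel_kernel \<alpha> x y\<bar> \<le> \<bar>\<alpha>\<bar> * x / 2 * E"
    using y E[of 1] by (simp only:) (intro mult_left_mono, auto)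
  have "\<bar>kernel_x \<alpha> x y\<bar> \<le> \<bar>- (\<alpha> / 2) * bessel_clifford 1 (\<alpha> * (x\<^sup>2 - y\<^sup>2) / 4)\<bar>
      + \<bar>\<alpha>\<^sup>2 * x\<^sup>2 / 4 * bessel_clifford 2 (\<alpha> * (x\<^sup>2 - y\<^sup>2) / 4)\<bar>"
    unfolding kernel_x_def by (rule abs_triangle_ineq4)
  also have "\<dots> = \<bar>\<alpha>\<bar> / 2 * \<bar>bessel_clifford 1 (\<alpha> * (x\<^sup>2 - y\<^sup>2) / 4)\<bar>
      + \<alpha>\<^sup>2 * x\<^sup>2 / 4 * \<bar>bessel_clifford 2 (\<alpha> * (x\<^sup>2 - y\<^sup>2) / 4)\<bar>"
    by (simp add: abs_mult)
  also have "\<dots> \<le> \<bar>\<alpha>\<bar> / 2 * E + \<alpha>\<^sup>2 * x\<^sup>2 / 4 * E"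
    using E by (intro add_mono mult_left_mono) auto
  finally show "\<bar>kernel_x \<alpha> x y\<bar> \<le> (\<bar>\<alpha>\<bar> / 2 + \<alpha>\<^sup>2 * x\<^sup>2 / 4) * E" by (simp add: distrib_right)
  have "\<bar>kernel_y \<alpha> x y\<bar> = \<alpha>\<^sup>2 * x * y / 4 * \<bar>bessel_clifford 2 (\<alpha> * (x\<^sup>2 - y\<^sup>2) / 4)\<bar>"
    using y by (simp add: kernel_y_def abs_mult)
  also have "\<dots> \<le> \<alpha>\<^sup>2 * x\<^sup>2 / 4 * E"
  proof (rule mult_mono)
    have "\<alpha>\<^sup>2 * x * y \<le> \<alpha>\<^sup>2 * x * x" using y by (intro mult_left_mono) auto
    then show "\<alpha>\<^sup>2 * x * y / 4 \<le> \<alpha>\<^sup>2 * x\<^sup>2 / 4" by (simp add: power2_eq_square mult.assoc)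
  qed (use E in auto)
  finally show "\<bar>kernel_y \<alpha> x y\<bar> \<le> \<alpha>\<^sup>2 * x\<^sup>2 / 4 * E" .
qed

lemma weak_solution_energy_le:
  assumes k: "weak_solution_grad \<alpha> k kx ky" and x: "0 < x"
    and E: "\<And>y m. 0 \<le> y \<Longrightarrow> y \<le> x \<Longrightarrow> \<bar>bessel_clifford m (\<alpha> * (x\<^sup>2 - y\<^sup>2) / 4)\<bar> \<le> E"
    and A: "\<bar>\<alpha>\<bar> * x / 2 * E \<le> A" and B: "(\<bar>\<alpha>\<bar> / 2 + \<alpha>\<^sup>2 * x\<^sup>2 / 4) * E \<le> B"
  shows "grad_energy k kx ky x \<le> x * (A\<^sup>2 + (B\<^sup>2 + B\<^sup>2))"
proof (rule grad_energy_le[OF _ x])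
  show "kernel_regular \<alpha> k kx ky" using k by (simp add: weak_solution_grad_def)
  have "0 \<le> E" using E[of 0 0] x by linarith
  have B': "\<alpha>\<^sup>2 * x\<^sup>2 / 4 * E \<le> B"
    using mult_right_mono[of "\<alpha>\<^sup>2 * x\<^sup>2 / 4" "\<bar>\<alpha>\<bar> / 2 + \<alpha>\<^sup>2 * x\<^sup>2 / 4" E] \<open>0 \<le> E\<close> B by simp
  show "AE y in lebesgue. 0 < y \<and> y < x \<longrightarrow> \<bar>k x y\<bar> \<le> A \<and> \<bar>kx x y\<bar> \<le> B \<and> \<bar>ky x y\<bar> \<le> B"
    using weak_solution_unique[OF k bessel_kernel_weak_solution x]
  proof eventually_elim
    case (elim y)
    show ?case
    proof
      assume y: "0 < y \<and> y < x"
      with elim have "k x y = bessel_kernel \<alpha> x y" "kx x y = kernel_x \<alpha> x y" "ky x y = kernel_y \<alpha> x y"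
        by (auto simp: glue_def)
      then show "\<bar>k x y\<bar> \<le> A \<and> \<bar>kx x y\<bar> \<le> B \<and> \<bar>ky x y\<bar> \<le> B"
        using kernel_bounds[of \<alpha> x y E] E[of y] y A B B' by (auto intro: order_trans)
    qed
  qed
qed

text \<open>Put $z=e\sqrt a$. Both $x$ and $ax^2$ are controlled by powers of \<open>z\<close>, and $a\le Mz^2$ with a
  constant \<open>M\<close> that depends on the lower bound \<open>e0\<close> of \<open>e\<close> only. Thus every polynomial factor is a
  polynomial in \<open>z\<close> and is absorbed by $e^z$.\<close>

lemma energy_bound_positive:
  assumes k: "weak_solution_grad a k kx ky" and a: "1 \<le> a" and x: "0 < x" "x < e" and e0: "0 < e0" "e0 \<le> e"
  defines "M \<equiv> max 1 (1 / e0\<^sup>2)"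
  shows "grad_energy k kx ky x \<le> 107 * M\<^sup>2 * exp (5 * e * sqrt a)"
proof -
  define z where "z = e * sqrt a"
  define T where "T = exp z"
  have s: "1 \<le> sqrt a" "(sqrt a)\<^sup>2 = a" using a by auto
  have z: "0 \<le> z" using x s by (simp add: z_def)
  have M: "1 \<le> M" "1 / e0\<^sup>2 \<le> M" by (auto simp: M_def)
  have T: "1 \<le> T" using z by (simp add: T_def)
  have xz: "x \<le> z" using mult_mono[of x e 1 "sqrt a"] x s by (simp add: z_def)
  have aM: "a \<le> M * z\<^sup>2"
  proof -
    have "1 = 1 / e0\<^sup>2 * e0\<^sup>2" using e0 by simp
    also have "\<dots> \<le> M * e\<^sup>2" using M e0 by (intro mult_mono power_mono) auto
    finally have "1 * a \<le> (M * e\<^sup>2) * a" using a by (intro mult_right_mono) auto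
    then show ?thesis by (simp add: z_def power_mult_distrib s mult.assoc)
  qed
  have axz: "a * x\<^sup>2 \<le> z\<^sup>2"
    using mult_left_mono[OF power_mono[of x e 2], of a] x a by (simp add: z_def power_mult_distrib s mult.commute)
  have zT: "z \<le> T" "z\<^sup>2 \<le> 2 * T" "z ^ 3 \<le> 6 * T" "z ^ 4 \<le> 24 * T"
    using power_divide_fact_le_exp[OF z, of 1] power_divide_fact_le_exp[OF z, of 2]
      power_divide_fact_le_exp[OF z, of 3] power_divide_fact_le_exp[OF z, of 4]
    by (simp_all add: T_def fact_numeral)
  have E: "\<bar>bessel_clifford m (a * (x\<^sup>2 - y\<^sup>2) / 4)\<bar> \<le> T" if y: "0 \<le> y" "y \<le> x" for y m
  proof -
    have q: "0 \<le> a * (x\<^sup>2 - y\<^sup>2) / 4" using y a by (simp add: power_mono)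
    have "a * (x\<^sup>2 - y\<^sup>2) \<le> a * x\<^sup>2" using a by (intro mult_left_mono) auto
    then have "a * (x\<^sup>2 - y\<^sup>2) / 4 \<le> (z / 2)\<^sup>2" using axz by (simp add: power_divide)
    then have "sqrt (a * (x\<^sup>2 - y\<^sup>2) / 4) \<le> z / 2" using z by (intro real_le_lsqrt) auto
    then have "exp (2 * sqrt (a * (x\<^sup>2 - y\<^sup>2) / 4)) \<le> T" by (simp add: T_def)
    then show ?thesis using bessel_clifford_growth[OF q, of m] by linarith
  qed
  have A: "\<bar>a\<bar> * x / 2 * T \<le> 3 * M * T\<^sup>2"
  proof -
    have "a * x \<le> (M * z\<^sup>2) * z" using aM xz a x M by (intro mult_mono) auto
    also have "\<dots> = M * z ^ 3" by (simp add: power2_eq_square power3_eq_cube)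
    also have "\<dots> \<le> M * (6 * T)" using zT M by (intro mult_left_mono) auto
    finally have "a * x / 2 * T \<le> 3 * M * T * T" using T by (intro mult_right_mono) auto
    then show ?thesis using a by (simp add: power2_eq_square)
  qed
  have B: "(\<bar>a\<bar> / 2 + a\<^sup>2 * x\<^sup>2 / 4) * T \<le> 7 * M * T\<^sup>2"
  proof -
    have "M * z\<^sup>2 \<le> M * (2 * T)" using zT M by (intro mult_left_mono) auto
    then have 1: "a / 2 \<le> M * T" using aM by simp
    have "a\<^sup>2 * x\<^sup>2 = a * (a * x\<^sup>2)" by (simp add: power2_eq_square)
    also have "\<dots> \<le> (M * z\<^sup>2) * z\<^sup>2" using aM axz a M by (intro mult_mono) auto
    also have "\<dots> = M * z ^ 4" by (simp add: power2_eq_square power4_eq_xxxx)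
    also have "\<dots> \<le> M * (24 * T)" using zT M by (intro mult_left_mono) auto
    finally have "a / 2 + a\<^sup>2 * x\<^sup>2 / 4 \<le> 7 * M * T" using 1 by simp
    then have "(a / 2 + a\<^sup>2 * x\<^sup>2 / 4) * T \<le> 7 * M * T * T" using T by (intro mult_right_mono) auto
    then show ?thesis using a by (simp add: power2_eq_square)
  qed
  \<comment> \<open>The squares of the constants \<open>3\<close>, \<open>7\<close> and \<open>7\<close> add up to \<open>107\<close>.\<close>
  have "grad_energy k kx ky x \<le> x * ((3 * M * T\<^sup>2)\<^sup>2 + ((7 * M * T\<^sup>2)\<^sup>2 + (7 * M * T\<^sup>2)\<^sup>2))"
    by (rule weak_solution_energy_le[OF k x(1) E A B])
  also have "\<dots> \<le> T * ((3 * M * T\<^sup>2)\<^sup>2 + ((7 * M * T\<^sup>2)\<^sup>2 + (7 * M * T\<^sup>2)\<^sup>2))"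
    using xz zT by (intro mult_right_mono) auto
  also have "\<dots> = 107 * M\<^sup>2 * T ^ 5"
    by (simp add: power_mult_distrib power_mult[symmetric]) (simp add: algebra_simps power_Suc[symmetric] del: power_Suc)
  also have "T ^ 5 = exp (5 * e * sqrt a)" by (simp add: T_def z_def exp_of_nat_mult[symmetric] mult.assoc)
  finally show ?thesis .
qed

text \<open>The Bessel--Clifford functions are bounded by \<open>1\<close> here, so the kernel and its gradient are at most
  of size $a^2$ times a polynomial in \<open>x\<close>, and only this polynomial is absorbed by an
  exponential.\<close>

lemma energy_bound_negative:
  assumes k: "weak_solution_grad (- a) k kx ky" and a: "1 \<le> a" and x: "0 < x" "x < e"
  shows "grad_energy k kx ky x \<le> 3 * a ^ 4 * exp (5 * e)"
proof -
  define S where "S = exp e"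
  have S: "1 \<le> S" "x \<le> S" "x\<^sup>2 \<le> 2 * S"
  proof -
    show "1 \<le> S" using x by (simp add: S_def)
    have "exp x \<le> S" using x by (simp add: S_def)
    then show "x \<le> S" "x\<^sup>2 \<le> 2 * S"
      using power_divide_fact_le_exp[of x 1] power_divide_fact_le_exp[of x 2] x by auto
  qed
  have aa: "a \<le> a\<^sup>2" using a by (simp add: power2_eq_square)
  have E: "\<bar>bessel_clifford m (- a * (x\<^sup>2 - y\<^sup>2) / 4)\<bar> \<le> 1" if "0 \<le> y" "y \<le> x" for y m
    using that a by (intro bessel_clifford_bounded_nonpos) (simp add: power_mono)
  have A: "\<bar>- a\<bar> * x / 2 * 1 \<le> a\<^sup>2 * S"
  proof -
    have "a * x \<le> a\<^sup>2 * S" using aa S a x by (intro mult_mono) auto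
    moreover have "0 \<le> a * x" using a x by simp
    ultimately show ?thesis using a by simp
  qed
  have B: "(\<bar>- a\<bar> / 2 + (- a)\<^sup>2 * x\<^sup>2 / 4) * 1 \<le> a\<^sup>2 * S"
  proof -
    have "a\<^sup>2 * x\<^sup>2 \<le> a\<^sup>2 * (2 * S)" using S by (intro mult_left_mono) auto
    moreover have "a\<^sup>2 * 1 \<le> a\<^sup>2 * S" using S by (intro mult_left_mono) auto
    ultimately have "a / 2 + a\<^sup>2 * x\<^sup>2 / 4 \<le> a\<^sup>2 * S" using aa by linarith
    then show ?thesis using a by simp
  qed
  have "grad_energy k kx ky x \<le> x * ((a\<^sup>2 * S)\<^sup>2 + ((a\<^sup>2 * S)\<^sup>2 + (a\<^sup>2 * S)\<^sup>2))"
    by (rule weak_solution_energy_le[OF k x(1) E A B])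
  also have "\<dots> \<le> S * ((a\<^sup>2 * S)\<^sup>2 + ((a\<^sup>2 * S)\<^sup>2 + (a\<^sup>2 * S)\<^sup>2))"
    using S by (intro mult_right_mono) auto
  also have "\<dots> = 3 * a ^ 4 * S ^ 3"
    by (simp add: power_mult_distrib power2_eq_square power3_eq_cube power4_eq_xxxx)
  also have "\<dots> \<le> 3 * a ^ 4 * S ^ 5"
    using S a by (intro mult_left_mono power_increasing) auto
  also have "S ^ 5 = exp (5 * e)" by (simp add: S_def exp_of_nat_mult[symmetric])
  finally show ?thesis .
qed

section \<open>Existence, uniqueness and growth of the two kernels\<close>

lemma eq_on_D_weak_solution:
  assumes "weak_solution_grad \<alpha> k kx ky"
  shows "eq_on_D k (bessel_kernel \<alpha>)"
  unfolding eq_on_D_def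
proof (intro allI impI)
  fix x :: real assume "0 < x"
  note AE = weak_solution_unique[OF assms bessel_kernel_weak_solution this]
  have "AE y in lebesgue. y \<noteq> x" by (intro AE_completion AE_lborel_singleton)
  with AE show "AE y in lebesgue. 0 < y \<and> y \<le> x \<longrightarrow> k x y = bessel_kernel \<alpha> x y"
    by eventually_elim auto
qed

theorem proposition3:
  fixes e0 vbar :: real
  assumes "e0 > 0" and "vbar > 0"
  shows "(\<forall>\<sigma>>0. \<forall>lam\<ge>0. unique_on_D (k_solution \<sigma> lam) \<and> unique_on_D (l_solution \<sigma> lam)) \<and>
    (\<exists>C>0. \<exists>c>0. \<forall>\<sigma>>0. \<exists>lam\<^sub>0>0. \<forall>lam\<ge>lam\<^sub>0. \<forall>t\<ge>0. \<forall>x\<in>{0<..<ebar e0 vbar t}.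
       (\<forall>k kx ky. k_solution_grad \<sigma> lam k kx ky \<longrightarrow>
          grad_energy k kx ky x \<le> C * exp (c * ebar e0 vbar t * sqrt (lam / \<sigma>))) \<and>
       (\<forall>l lx ly. l_solution_grad \<sigma> lam l lx ly \<longrightarrow>
          grad_energy l lx ly x \<le> C * (lam / \<sigma>) ^ 4 * exp (c * ebar e0 vbar t)))"
proof
  show "\<forall>\<sigma>>0. \<forall>lam\<ge>0. unique_on_D (k_solution \<sigma> lam) \<and> unique_on_D (l_solution \<sigma> lam)"
  proof (intro allI impI conjI)
    fix \<sigma> lam :: real
    show "unique_on_D (k_solution \<sigma> lam)"
      unfolding unique_on_D_def k_solution_def k_solution_grad_def
      using bessel_kernel_weak_solution eq_on_D_weak_solution by blast
    show "unique_on_D (l_solution \<sigma> lam)"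
      unfolding unique_on_D_def
    proof (intro exI conjI allI impI)
      show "l_solution \<sigma> lam (\<lambda>x y. - bessel_kernel (- lam / \<sigma>) x y)"
        unfolding l_solution_def l_solution_grad_def
        by (rule exI[of _ "\<lambda>x y. - kernel_ext_x (- lam / \<sigma>) x y"], rule exI[of _ "\<lambda>x y. - kernel_ext_y (- lam / \<sigma>) x y"])
          (simp only: minus_minus bessel_kernel_weak_solution)
      fix l assume "l_solution \<sigma> lam l"
      then have "eq_on_D (\<lambda>x y. - l x y) (bessel_kernel (- lam / \<sigma>))"
        unfolding l_solution_def l_solution_grad_def using eq_on_D_weak_solution by blast
      then show "eq_on_D l (\<lambda>x y. - bessel_kernel (- lam / \<sigma>) x y)"
        unfolding eq_on_D_def by (auto elim!: eventually_mono simp: minus_equation_iff[of "l _ _"])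
    qed
  qed
next
  define M where "M = max 1 (1 / e0\<^sup>2)"
  \<comment> \<open>The constant of the bound for the growing kernel; it also exceeds the factor \<open>3\<close> of the other bound.\<close>
  define C where "C = 107 * M\<^sup>2"
  have "1 \<le> M\<^sup>2" by (simp add: M_def)
  then have C: "0 < C" "3 \<le> C" by (auto simp: C_def)
  show "\<exists>C>0. \<exists>c>0. \<forall>\<sigma>>0. \<exists>lam\<^sub>0>0. \<forall>lam\<ge>lam\<^sub>0. \<forall>t\<ge>0. \<forall>x\<in>{0<..<ebar e0 vbar t}.
       (\<forall>k kx ky. k_solution_grad \<sigma> lam k kx ky \<longrightarrow>
          grad_energy k kx ky x \<le> C * exp (c * ebar e0 vbar t * sqrt (lam / \<sigma>))) \<and>
       (\<forall>l lx ly. l_solution_grad \<sigma> lam l lx ly \<longrightarrow>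
          grad_energy l lx ly x \<le> C * (lam / \<sigma>) ^ 4 * exp (c * ebar e0 vbar t))"
  proof (rule exI[of _ C], rule conjI[OF C(1)], rule exI[of _ 5], rule conjI, simp, intro allI impI)
    fix \<sigma> :: real assume \<sigma>: "0 < \<sigma>"
    show "\<exists>lam\<^sub>0>0. \<forall>lam\<ge>lam\<^sub>0. \<forall>t\<ge>0. \<forall>x\<in>{0<..<ebar e0 vbar t}.
       (\<forall>k kx ky. k_solution_grad \<sigma> lam k kx ky \<longrightarrow>
          grad_energy k kx ky x \<le> C * exp (5 * ebar e0 vbar t * sqrt (lam / \<sigma>))) \<and>
       (\<forall>l lx ly. l_solution_grad \<sigma> lam l lx ly \<longrightarrow>
          grad_energy l lx ly x \<le> C * (lam / \<sigma>) ^ 4 * exp (5 * ebar e0 vbar t))"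
    \<comment> \<open>With the threshold \<open>\<sigma>\<close> the ratio \<open>lam / \<sigma>\<close> is at least \<open>1\<close>, as both energy bounds require.\<close>
    proof (rule exI[of _ \<sigma>], rule conjI[OF \<sigma>], intro allI impI ballI conjI)
      fix lam t x :: real
      assume lam: "\<sigma> \<le> lam" and t: "0 \<le> t" and x: "x \<in> {0<..<ebar e0 vbar t}"
      have a: "1 \<le> lam / \<sigma>" using lam \<sigma> by simp
      have x': "0 < x" "x < ebar e0 vbar t" using x by auto
      have e: "e0 \<le> ebar e0 vbar t" using assms t by (simp add: ebar_def)
      show "grad_energy k kx ky x \<le> C * exp (5 * ebar e0 vbar t * sqrt (lam / \<sigma>))"
        if "k_solution_grad \<sigma> lam k kx ky" for k kx ky
        using energy_bound_positive[OF that[unfolded k_solution_grad_def] a x' assms(1) e]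
        by (simp add: C_def M_def)
      show "grad_energy l lx ly x \<le> C * (lam / \<sigma>) ^ 4 * exp (5 * ebar e0 vbar t)"
        if "l_solution_grad \<sigma> lam l lx ly" for l lx ly
      proof -
        have "weak_solution_grad (- (lam / \<sigma>)) (\<lambda>x y. - l x y) (\<lambda>x y. - lx x y) (\<lambda>x y. - ly x y)"
          using that by (simp add: l_solution_grad_def)
        from energy_bound_negative[OF this a x']
        have "grad_energy l lx ly x \<le> 3 * (lam / \<sigma>) ^ 4 * exp (5 * ebar e0 vbar t)"
          by (simp add: grad_energy_def)
        also have "\<dots> \<le> C * (lam / \<sigma>) ^ 4 * exp (5 * ebar e0 vbar t)"
          using C(2) a by (intro mult_right_mono) auto
        finally show ?thesis .
      qed
    qed
  qed
qed

end
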